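(* Let $(M,L,\psi)$ be a weighted Finsler spacetime of dimension $n+1$. Given $N\in(-\infty,0]\cup[n,+\infty]$, take $\epsilon\in\mathbb{R}$ such that $\epsilon=0$ if $N=0$, and $|\epsilon|<\sqrt{\frac{N}{N-n}}$ if $N\ne0$ (the bound is read as $1$ for $N=+\infty$, and as no restriction for $N=n$). Let $c=c(N,\epsilon)=\frac1n\big(1-\epsilon^2\frac{N-n}{N}\big)>0$, with $c(0,0)=\frac1n$ and $c(+\infty,\epsilon)=\frac{1-\epsilon^2}{n}$. Let $\eta:(a,b)\to M$ be a timelike geodesic of unit speed such that $\mathrm{Ric}_N(\eta^* )\ge0$ on $(a,b)$, let $\mathsf{J}$ be a Lagrange tensor field along $\eta$, and let $t_0\in(a,b)$. Set $$s_0:=\tau_\epsilon^{-1}\Big(\tau_\epsilon(t_0)-\frac{1}{c\,\theta_\epsilon(t_0)}\Big)-t_0.$$ If $\theta_\epsilon(t_0)<0$, then $\det\mathsf{J}(t)=0$ for some $t\in[t_0,t_0+s_0]$, provided that $t_0+s_0<b$ (i.e. provided that $\tau_\epsilon(t_0)-\frac{1}{c\theta_\epsilon(t_0)}$ is attained by $\tau_\epsilon$ on $(a,b)$). Similarly, if $\theta_\epsilon(t_0)>0$, then $\det\mathsf{J}(t)=0$ for some $t\in[t_0+s_0,t_0]$, provided that $t_0+s_0>a$ (in the same sense).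
   Context: **Lorentz–Finsler setting.** $M$ is a connected $C^\infty$-manifold without boundary of dimension $n+1\ge2$. A Lorentz–Finsler structure is a function $L:TM\to\mathbb{R}$ such that $L\in C^\infty(TM\setminus\{0\})$; $L(cv)=c^2L(v)$ for all $v\in TM$, $c>0$; and for every $v\in TM\setminus\{0\}$ the matrix $g_{\alpha\beta}(v)=\frac{\partial^2 L}{\partial v^\alpha\partial v^\beta}(v)$, $\alpha,\beta=0,\dots,n$, is non-degenerate of signature $(-,+,\dots,+)$. It defines a Lorentzian inner product $g_v$ on $T_xM$ (for $v\in T_xM\setminus\{0\}$), with $g_v(v,v)=2L(v)$. A vector $v$ is timelike if $L(v)<0$, lightlike if $L(v)=0$ and $v\ne 0$, causal if timelike or lightlike. A Finsler spacetime is such an $(M,L)$ time-oriented by a smooth vector field $X$ with $L(X(x))<0$ for all $x$. A causal $v\in T_xM$ is future-directed if it lies in the same connected component of $\overline{\Omega'_x}\setminus\{0\}$ as $X(x)$, where $\Omega'_x=\{v\in T_xM: L(v)<0\}$. $\Omega_x$ is the set of future-directed timelike vectors, $\overline\Omega=\bigcup_x\overline\Omega_x$. $F(v)=\sqrt{-2L(v)}$ on causal vectors; a timelike geodesic has unit speed if $F(\dot\eta)\equiv1$. All causal curves and geodesics are future-directed. **Connection and curvature.** With $(g^{\alpha\beta}(v))$ the inverse matrix, set $\widetilde\Gamma^\alpha_{\beta\gamma}(v)=\frac12\sum_\delta g^{\alpha\delta}(v)\big(\frac{\partial g_{\delta\gamma}}{\partial x^\beta}+\frac{\partial g_{\beta\delta}}{\partial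 x^\gamma}-\frac{\partial g_{\beta\gamma}}{\partial x^\delta}\big)(v)$, $G^\alpha(v)=\frac12\sum_{\beta,\gamma}\widetilde\Gamma^\alpha_{\beta\gamma}(v)v^\beta v^\gamma$, $N^\alpha_\beta(v)=\frac{\partial G^\alpha}{\partial v^\beta}(v)$, and $\Gamma^\alpha_{\beta\gamma}(v)=\widetilde\Gamma^\alpha_{\beta\gamma}(v)-\frac12\sum_{\delta,\mu}g^{\alpha\delta}(v)\big(\frac{\partial g_{\delta\gamma}}{\partial v^\mu}N^\mu_\beta+\frac{\partial g_{\beta\delta}}{\partial v^\mu}N^\mu_\gamma-\frac{\partial g_{\beta\gamma}}{\partial v^\mu}N^\mu_\delta\big)(v)$. Along a curve $\eta$, the covariant derivative $Y'=D^{\dot\eta}_{\dot\eta}Y$ has components $\dot Y^\alpha+\sum\Gamma^\alpha_{\beta\gamma}(\dot\eta)\dot\eta^\beta Y^\gamma$; for endomorphism fields $E$, $E'(P)=E(P)'-E(P')$. A causal geodesic is a smooth causal curve with $\ddot\eta^\alpha+2G^\alpha(\dot\eta)=0$. Put $R^\alpha_\beta(v)=2\frac{\partial G^\alpha}{\partial x^\beta}-\sum_\gamma\big(\frac{\partial N^\alpha_\beta}{\partial x^\gamma}v^\gamma-2\frac{\partial N^\alpha_\beta}{\partial v^\gamma}G^\gamma\big)-\sum_\gamma N^\alpha_\gamma N^\gamma_\beta$ (all at $v$), $R_v(w)=\sum R^\alpha_\beta(v)w^\beta\frac{\partial}{\partial x^\alpha}$ and $\mathrm{Ric}(v)=\mathrm{trace}(R_v)$.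 **Weight.** $\psi:\overline\Omega\setminus\{0\}\to\mathbb{R}$ is $C^\infty$ with $\psi(cv)=\psi(v)$ for $c>0$. For a causal geodesic $\eta$, $\psi_\eta(t)=\psi(\dot\eta(t))$. For $v\in\overline\Omega\setminus\{0\}$ and the geodesic $\eta$ with $\dot\eta(0)=v$: $\mathrm{Ric}_N(v)=\mathrm{Ric}(v)+\psi_\eta''(0)-\frac{\psi_\eta'(0)^2}{N-n}$ for $N\in\mathbb{R}\setminus\{n\}$; $\mathrm{Ric}_\infty(v)=\mathrm{Ric}(v)+\psi_\eta''(0)$; $\mathrm{Ric}_n(v)=\mathrm{Ric}(v)+\psi_\eta''(0)$ if $\psi_\eta'(0)=0$ and $-\infty$ otherwise. **Lagrange tensors, $\epsilon$-quantities.** Let $\eta$ be a unit-speed timelike geodesic, $N_\eta(t)\subset T_{\eta(t)}M$ the $n$-dimensional $g_{\dot\eta(t)}$-orthogonal complement of $\dot\eta(t)$, $\mathsf{R}(t)=R_{\dot\eta(t)}:N_\eta(t)\to N_\eta(t)$. A Jacobi tensor field is a smooth field of endomorphisms $\mathsf{J}(t)$ of $N_\eta(t)$ with $\mathsf{J}''+\mathsf{R}\mathsf{J}=0$ and $\ker\mathsf{J}(t)\cap\ker\mathsf{J}'(t)=\{0\}$ for all $t$; it is a Lagrange tensor field if moreover $(\mathsf{J}')^{\mathsf{T}}\mathsf{J}-\mathsf{J}^{\mathsf{T}}\mathsf{J}'=0$ ($\mathsf{T}$ = transpose with respect to $g_{\dot\eta}$). The $\epsilon$-proper time is a fixed primitive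 $\tau_\epsilon=\int e^{\frac{2(\epsilon-1)}{n}\psi_\eta(t)}dt$ (a strictly increasing function on $(a,b)$), and $\eta^*=e^{\frac{2(1-\epsilon)}{n}\psi_\eta}\dot\eta$. At $t$ where $\mathsf{J}(t)$ is invertible (in particular this is understood at $t_0$), $\theta(t)=\mathrm{trace}(\mathsf{J}'\mathsf{J}^{-1})(t)$ and the $\epsilon$-expansion is $\theta_\epsilon(t)=e^{\frac{2(1-\epsilon)}{n}\psi_\eta(t)}(\theta(t)-\psi_\eta'(t))$. *)

theory Defs
  imports "HOL-Analysis.Analysis"
begin

section \<open>Smooth maps\<close>

text \<open>\<open>Ck_on k S f\<close> is meant for open \<open>S\<close>; only the values of \<open>f\<close> on \<open>S\<close> matter.\<close>

primrec Ck_on ::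
  "nat \<Rightarrow> 'a::real_normed_vector set \<Rightarrow> ('a \<Rightarrow> 'b::real_normed_vector) \<Rightarrow> bool" where
  "Ck_on 0 S f \<longleftrightarrow> continuous_on S f"
| "Ck_on (Suc k) S f \<longleftrightarrow> (\<forall>x\<in>S. f differentiable (at x)) \<and>
     (\<forall>h. Ck_on k S (\<lambda>x. frechet_derivative f (at x) h))"

text \<open>On an arbitrary set, \<open>f\<close> is smooth if it locally extends to a smooth function on an open
  set; for open \<open>S\<close> this is the usual notion.\<close>

definition smooth_on ::
  "'a::real_normed_vector set \<Rightarrow> ('a \<Rightarrow> 'b::real_normed_vector) \<Rightarrow> bool" where
  "smooth_on S f \<longleftrightarrow> (\<forall>x\<in>S. \<exists>W g. open W \<and> x \<in> W \<and> (\<forall>k. Ck_on k W g) \<and>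
     (\<forall>y\<in>S \<inter> W. f y = g y))"


section \<open>Trace and determinant of an endomorphism of a subspace\<close>

text \<open>With respect to a basis \<open>B\<close> of the subspace \<open>V\<close>, the endomorphism \<open>f\<close> has the matrix
  entries \<open>representation B (f b) b'\<close> in row \<open>b'\<close> and column \<open>b\<close>; neither value depends on the
  choice of \<open>B\<close>.\<close>

definition some_basis :: "'a::real_vector set \<Rightarrow> 'a set" where
  "some_basis V = (SOME B. independent B \<and> span B = V)"

definition trace_on :: "'a::real_vector set \<Rightarrow> ('a \<Rightarrow> 'a) \<Rightarrow> real" where
  "trace_on V f = (let B = some_basis V in \<Sum>b\<in>B. representation B (f b) b)"

definition det_on :: "'a::real_vector set \<Rightarrow> ('a \<Rightarrow> 'a) \<Rightarrow> real" where
  "det_on V f = (let B = some_basis V in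
     \<Sum>\<pi> | \<pi> permutes B. of_int (sign \<pi>) * (\<Prod>b\<in>B. representation B (f b) (\<pi> b)))"


section \<open>Manifolds and tangent vectors\<close>

text \<open>A chart is a pair of its domain and its coordinate map (whose values off the domain are
  irrelevant). The dimension of the manifold is \<open>CARD('m)\<close>.\<close>

type_synonym ('p, 'm) chart = "'p set \<times> ('p \<Rightarrow> real ^ 'm)"

definition chart_inv :: "('p, 'm::finite) chart \<Rightarrow> real ^ 'm \<Rightarrow> 'p" where
  "chart_inv c = inv_into (fst c) (snd c)"

definition smooth_manifold :: "'p topology \<Rightarrow> ('p, 'm::finite) chart set \<Rightarrow> bool" where
  "smooth_manifold M A \<longleftrightarrow>
     Hausdorff_space M \<and> second_countable M \<and> topspace M = (\<Union>c\<in>A. fst c) \<and>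
     (\<forall>c\<in>A. openin M (fst c) \<and> open (snd c ` fst c) \<and>
        homeomorphic_map (subtopology M (fst c)) (top_of_set (snd c ` fst c)) (snd c)) \<and>
     (\<forall>c\<in>A. \<forall>d\<in>A. smooth_on (snd c ` (fst c \<inter> fst d)) (snd d \<circ> chart_inv c))"

definition charts_at :: "('p, 'm::finite) chart set \<Rightarrow> 'p \<Rightarrow> ('p, 'm) chart set" where
  "charts_at A p = {c \<in> A. p \<in> fst c}"

text \<open>A tangent vector is its base point together with its components in all charts around that
  point, related by the Jacobians of the coordinate changes.\<close>

type_synonym ('p, 'm) tangent = "'p \<times> (('p, 'm) chart \<Rightarrow> real ^ 'm)"

definition chart_change_deriv ::
  "('p, 'm::finite) chart \<Rightarrow> ('p, 'm) chart \<Rightarrow> 'p \<Rightarrow> real ^ 'm \<Rightarrow> real ^ 'm" where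
  "chart_change_deriv c d p = frechet_derivative (snd d \<circ> chart_inv c) (at (snd c p))"

definition tangent_space :: "('p, 'm::finite) chart set \<Rightarrow> 'p \<Rightarrow> ('p, 'm) tangent set" where
  "tangent_space A p = {v. fst v = p \<and> (\<forall>c. c \<notin> charts_at A p \<longrightarrow> snd v c = 0) \<and>
     (\<forall>c\<in>charts_at A p. \<forall>d\<in>charts_at A p. snd v d = chart_change_deriv c d p (snd v c))}"

definition tangent_bundle ::
  "'p topology \<Rightarrow> ('p, 'm::finite) chart set \<Rightarrow> ('p, 'm) tangent set" where
  "tangent_bundle M A = (\<Union>p\<in>topspace M. tangent_space A p)"

definition tzero :: "'p \<Rightarrow> ('p, 'm::finite) tangent" where
  "tzero p = (p, \<lambda>_. 0)"

definition tadd :: "('p, 'm::finite) tangent \<Rightarrow> ('p, 'm) tangent \<Rightarrow> ('p, 'm) tangent" where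
  "tadd u w = (fst u, \<lambda>c. snd u c + snd w c)"

definition tscale :: "real \<Rightarrow> ('p, 'm::finite) tangent \<Rightarrow> ('p, 'm) tangent" where
  "tscale r v = (fst v, \<lambda>c. r *\<^sub>R snd v c)"

definition tdiff :: "('p, 'm::finite) tangent \<Rightarrow> ('p, 'm) tangent \<Rightarrow> ('p, 'm) tangent" where
  "tdiff u w = tadd u (tscale (-1) w)"

text \<open>The tangent vector at \<open>p\<close> with components \<open>y\<close> in the chart \<open>c\<close>.\<close>

definition tvec ::
  "('p, 'm::finite) chart set \<Rightarrow> ('p, 'm) chart \<Rightarrow> 'p \<Rightarrow> real ^ 'm \<Rightarrow> ('p, 'm) tangent" where
  "tvec A c p y = (p, \<lambda>d. if d \<in> charts_at A p then chart_change_deriv c d p y else 0)"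

text \<open>\<open>bundle_coords c\<close> is the chart of the tangent bundle induced by \<open>c\<close>, and \<open>bundle_rep A c f\<close>
  is the expression of \<open>f\<close> in that chart.\<close>

definition bundle_coords ::
  "('p, 'm::finite) chart \<Rightarrow> ('p, 'm) tangent \<Rightarrow> (real ^ 'm) \<times> (real ^ 'm)" where
  "bundle_coords c v = (snd c (fst v), snd v c)"

definition bundle_rep ::
  "('p, 'm::finite) chart set \<Rightarrow> ('p, 'm) chart \<Rightarrow> (('p, 'm) tangent \<Rightarrow> real) \<Rightarrow>
   (real ^ 'm) \<times> (real ^ 'm) \<Rightarrow> real" where
  "bundle_rep A c f z = f (tvec A c (chart_inv c (fst z)) (snd z))"

definition smooth_on_bundle ::
  "('p, 'm::finite) chart set \<Rightarrow> ('p, 'm) tangent set \<Rightarrow> (('p, 'm) tangent \<Rightarrow> real) \<Rightarrow> bool" where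
  "smooth_on_bundle A S f \<longleftrightarrow>
     (\<forall>c\<in>A. smooth_on (bundle_coords c ` {v \<in> S. fst v \<in> fst c}) (bundle_rep A c f))"

definition smooth_vector_field ::
  "'p topology \<Rightarrow> ('p, 'm::finite) chart set \<Rightarrow> ('p \<Rightarrow> ('p, 'm) tangent) \<Rightarrow> bool" where
  "smooth_vector_field M A X \<longleftrightarrow> (\<forall>p\<in>topspace M. X p \<in> tangent_space A p) \<and>
     (\<forall>c\<in>A. smooth_on (snd c ` fst c) (\<lambda>x. snd (X (chart_inv c x)) c))"

text \<open>A fixed chart around each point, used to evaluate quantities that do not depend on the
  choice of the chart.\<close>

definition chart_at :: "('p, 'm::finite) chart set \<Rightarrow> 'p \<Rightarrow> ('p, 'm) chart" where
  "chart_at A p = (SOME c. c \<in> charts_at A p)"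


section \<open>Lorentz--Finsler structures\<close>

definition dx :: "'m \<Rightarrow> ((real ^ 'm::finite) \<times> (real ^ 'm) \<Rightarrow> real) \<Rightarrow>
    (real ^ 'm) \<times> (real ^ 'm) \<Rightarrow> real" where
  "dx \<alpha> f z = frechet_derivative f (at z) (axis \<alpha> 1, 0)"

definition dv :: "'m \<Rightarrow> ((real ^ 'm::finite) \<times> (real ^ 'm) \<Rightarrow> real) \<Rightarrow>
    (real ^ 'm) \<times> (real ^ 'm) \<Rightarrow> real" where
  "dv \<alpha> f z = frechet_derivative f (at z) (0, axis \<alpha> 1)"

text \<open>In the following definitions \<open>l\<close> is the expression of the Lorentz--Finsler structure in the
  induced chart of the tangent bundle, and \<open>z = (x, v)\<close>.\<close>

definition gcoef :: "((real ^ 'm::finite) \<times> (real ^ 'm) \<Rightarrow> real) \<Rightarrow> 'm \<Rightarrow> 'm \<Rightarrow>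
    (real ^ 'm) \<times> (real ^ 'm) \<Rightarrow> real" where
  "gcoef l \<alpha> \<beta> = dv \<alpha> (dv \<beta> l)"

definition gmatrix :: "((real ^ 'm::finite) \<times> (real ^ 'm) \<Rightarrow> real) \<Rightarrow>
    (real ^ 'm) \<times> (real ^ 'm) \<Rightarrow> real ^ 'm ^ 'm" where
  "gmatrix l z = (\<chi> \<alpha> \<beta>. gcoef l \<alpha> \<beta> z)"

definition ginv :: "((real ^ 'm::finite) \<times> (real ^ 'm) \<Rightarrow> real) \<Rightarrow> 'm \<Rightarrow> 'm \<Rightarrow>
    (real ^ 'm) \<times> (real ^ 'm) \<Rightarrow> real" where
  "ginv l \<alpha> \<beta> z = matrix_inv (gmatrix l z) $ \<alpha> $ \<beta>"

text \<open>Signature \<open>(-, +, \<dots>, +)\<close>: the form is represented by \<open>diag(-1, 1, \<dots>, 1)\<close> in some basis.\<close>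

definition lorentzian_matrix :: "real ^ 'm ^ 'm::finite \<Rightarrow> bool" where
  "lorentzian_matrix g \<longleftrightarrow> (\<exists>(P :: real ^ 'm ^ 'm) i. invertible P \<and>
     transpose P ** g ** P = (\<chi> \<alpha> \<beta>. if \<alpha> = \<beta> then (if \<alpha> = i then -1 else 1) else 0))"

definition christoffel :: "((real ^ 'm::finite) \<times> (real ^ 'm) \<Rightarrow> real) \<Rightarrow> 'm \<Rightarrow> 'm \<Rightarrow> 'm \<Rightarrow>
    (real ^ 'm) \<times> (real ^ 'm) \<Rightarrow> real" where
  "christoffel l \<alpha> \<beta> \<gamma> z = 1/2 * (\<Sum>\<delta>\<in>UNIV. ginv l \<alpha> \<delta> z *
     (dx \<beta> (gcoef l \<delta> \<gamma>) z + dx \<gamma> (gcoef l \<beta> \<delta>) z - dx \<delta> (gcoef l \<beta> \<gamma>) z))"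

definition spray :: "((real ^ 'm::finite) \<times> (real ^ 'm) \<Rightarrow> real) \<Rightarrow> 'm \<Rightarrow>
    (real ^ 'm) \<times> (real ^ 'm) \<Rightarrow> real" where
  "spray l \<alpha> z = 1/2 * (\<Sum>\<beta>\<in>UNIV. \<Sum>\<gamma>\<in>UNIV. christoffel l \<alpha> \<beta> \<gamma> z * snd z $ \<beta> * snd z $ \<gamma>)"

definition nonlin_conn :: "((real ^ 'm::finite) \<times> (real ^ 'm) \<Rightarrow> real) \<Rightarrow> 'm \<Rightarrow> 'm \<Rightarrow>
    (real ^ 'm) \<times> (real ^ 'm) \<Rightarrow> real" where
  "nonlin_conn l \<alpha> \<beta> = dv \<beta> (spray l \<alpha>)"

definition chern_coef :: "((real ^ 'm::finite) \<times> (real ^ 'm) \<Rightarrow> real) \<Rightarrow> 'm \<Rightarrow> 'm \<Rightarrow> 'm \<Rightarrow>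
    (real ^ 'm) \<times> (real ^ 'm) \<Rightarrow> real" where
  "chern_coef l \<alpha> \<beta> \<gamma> z = christoffel l \<alpha> \<beta> \<gamma> z -
     1/2 * (\<Sum>\<delta>\<in>UNIV. \<Sum>\<mu>\<in>UNIV. ginv l \<alpha> \<delta> z *
       (dv \<mu> (gcoef l \<delta> \<gamma>) z * nonlin_conn l \<mu> \<beta> z
        + dv \<mu> (gcoef l \<beta> \<delta>) z * nonlin_conn l \<mu> \<gamma> z
        - dv \<mu> (gcoef l \<beta> \<gamma>) z * nonlin_conn l \<mu> \<delta> z))"

definition curv_coef :: "((real ^ 'm::finite) \<times> (real ^ 'm) \<Rightarrow> real) \<Rightarrow> 'm \<Rightarrow> 'm \<Rightarrow>
    (real ^ 'm) \<times> (real ^ 'm) \<Rightarrow> real" where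
  "curv_coef l \<alpha> \<beta> z = 2 * dx \<beta> (spray l \<alpha>) z
     - (\<Sum>\<gamma>\<in>UNIV. dx \<gamma> (nonlin_conn l \<alpha> \<beta>) z * snd z $ \<gamma>
          - 2 * dv \<gamma> (nonlin_conn l \<alpha> \<beta>) z * spray l \<gamma> z)
     - (\<Sum>\<gamma>\<in>UNIV. nonlin_conn l \<alpha> \<gamma> z * nonlin_conn l \<gamma> \<beta> z)"

definition curv_matrix :: "((real ^ 'm::finite) \<times> (real ^ 'm) \<Rightarrow> real) \<Rightarrow>
    (real ^ 'm) \<times> (real ^ 'm) \<Rightarrow> real ^ 'm ^ 'm" where
  "curv_matrix l z = (\<chi> \<alpha> \<beta>. curv_coef l \<alpha> \<beta> z)"

definition lorentz_finsler ::
  "'p topology \<Rightarrow> ('p, 'm::finite) chart set \<Rightarrow> (('p, 'm) tangent \<Rightarrow> real) \<Rightarrow> bool" where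
  "lorentz_finsler M A L \<longleftrightarrow>
     smooth_on_bundle A {v \<in> tangent_bundle M A. v \<noteq> tzero (fst v)} L \<and>
     (\<forall>v\<in>tangent_bundle M A. \<forall>r>0. L (tscale r v) = r\<^sup>2 * L v) \<and>
     (\<forall>v\<in>tangent_bundle M A. v \<noteq> tzero (fst v) \<longrightarrow>
        (\<forall>c\<in>charts_at A (fst v).
           lorentzian_matrix (gmatrix (bundle_rep A c L) (bundle_coords c v))))"

definition timelike :: "(('p, 'm::finite) tangent \<Rightarrow> real) \<Rightarrow> ('p, 'm) tangent \<Rightarrow> bool" where
  "timelike L v \<longleftrightarrow> L v < 0"

definition lightlike :: "(('p, 'm::finite) tangent \<Rightarrow> real) \<Rightarrow> ('p, 'm) tangent \<Rightarrow> bool" where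
  "lightlike L v \<longleftrightarrow> L v = 0 \<and> v \<noteq> tzero (fst v)"

definition causal :: "(('p, 'm::finite) tangent \<Rightarrow> real) \<Rightarrow> ('p, 'm) tangent \<Rightarrow> bool" where
  "causal L v \<longleftrightarrow> timelike L v \<or> lightlike L v"

definition finsler_spacetime ::
  "'p topology \<Rightarrow> ('p, 'm::finite) chart set \<Rightarrow> (('p, 'm) tangent \<Rightarrow> real) \<Rightarrow>
   ('p \<Rightarrow> ('p, 'm) tangent) \<Rightarrow> bool" where
  "finsler_spacetime M A L X \<longleftrightarrow>
     2 \<le> CARD('m) \<and> smooth_manifold M A \<and> connected_space M \<and> lorentz_finsler M A L \<and>
     smooth_vector_field M A X \<and> (\<forall>p\<in>topspace M. L (X p) < 0)"

text \<open>Closures and connected components in a tangent space are taken in the components with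
  respect to a chart.\<close>

definition future_directed ::
  "('p, 'm::finite) chart set \<Rightarrow> (('p, 'm) tangent \<Rightarrow> real) \<Rightarrow> ('p \<Rightarrow> ('p, 'm) tangent) \<Rightarrow>
   ('p, 'm) tangent \<Rightarrow> bool" where
  "future_directed A L X v \<longleftrightarrow> (let p = fst v; c = chart_at A p in
     connected_component
       (closure ((\<lambda>u. snd u c) ` {u \<in> tangent_space A p. timelike L u}) - {0})
       (snd (X p) c) (snd v c))"

definition future_timelike_cone ::
  "('p, 'm::finite) chart set \<Rightarrow> (('p, 'm) tangent \<Rightarrow> real) \<Rightarrow> ('p \<Rightarrow> ('p, 'm) tangent) \<Rightarrow>
   'p \<Rightarrow> ('p, 'm) tangent set" where
  "future_timelike_cone A L X p =
     {v \<in> tangent_space A p. timelike L v \<and> future_directed A L X v}"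

definition closed_future_cone ::
  "('p, 'm::finite) chart set \<Rightarrow> (('p, 'm) tangent \<Rightarrow> real) \<Rightarrow> ('p \<Rightarrow> ('p, 'm) tangent) \<Rightarrow>
   'p \<Rightarrow> ('p, 'm) tangent set" where
  "closed_future_cone A L X p = (let c = chart_at A p in
     {v \<in> tangent_space A p. snd v c \<in> closure ((\<lambda>u. snd u c) ` future_timelike_cone A L X p)})"

definition weight_domain ::
  "'p topology \<Rightarrow> ('p, 'm::finite) chart set \<Rightarrow> (('p, 'm) tangent \<Rightarrow> real) \<Rightarrow>
   ('p \<Rightarrow> ('p, 'm) tangent) \<Rightarrow> ('p, 'm) tangent set" where
  "weight_domain M A L X = (\<Union>p\<in>topspace M. closed_future_cone A L X p - {tzero p})"

definition weighted_finsler_spacetime ::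
  "'p topology \<Rightarrow> ('p, 'm::finite) chart set \<Rightarrow> (('p, 'm) tangent \<Rightarrow> real) \<Rightarrow>
   ('p \<Rightarrow> ('p, 'm) tangent) \<Rightarrow> (('p, 'm) tangent \<Rightarrow> real) \<Rightarrow> bool" where
  "weighted_finsler_spacetime M A L X \<psi> \<longleftrightarrow> finsler_spacetime M A L X \<and>
     smooth_on_bundle A (weight_domain M A L X) \<psi> \<and>
     (\<forall>v\<in>weight_domain M A L X. \<forall>r>0. \<psi> (tscale r v) = \<psi> v)"

definition gform ::
  "('p, 'm::finite) chart set \<Rightarrow> (('p, 'm) tangent \<Rightarrow> real) \<Rightarrow> ('p, 'm) tangent \<Rightarrow>
   ('p, 'm) tangent \<Rightarrow> ('p, 'm) tangent \<Rightarrow> real" where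
  "gform A L v u w = (let c = chart_at A (fst v) in
     \<Sum>\<alpha>\<in>UNIV. \<Sum>\<beta>\<in>UNIV. gcoef (bundle_rep A c L) \<alpha> \<beta> (bundle_coords c v) *
       snd u c $ \<alpha> * snd w c $ \<beta>)"

definition curv_op ::
  "('p, 'm::finite) chart set \<Rightarrow> (('p, 'm) tangent \<Rightarrow> real) \<Rightarrow> ('p, 'm) tangent \<Rightarrow>
   ('p, 'm) tangent \<Rightarrow> ('p, 'm) tangent" where
  "curv_op A L v w = (let c = chart_at A (fst v) in
     tvec A c (fst v) (curv_matrix (bundle_rep A c L) (bundle_coords c v) *v snd w c))"

definition ricci ::
  "('p, 'm::finite) chart set \<Rightarrow> (('p, 'm) tangent \<Rightarrow> real) \<Rightarrow> ('p, 'm) tangent \<Rightarrow> real" where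
  "ricci A L v = (let c = chart_at A (fst v) in
     trace (curv_matrix (bundle_rep A c L) (bundle_coords c v)))"


section \<open>Curves and geodesics\<close>

text \<open>Curves live on open intervals \<open>einterval a b\<close> with endpoints in the extended reals.\<close>

definition velocity ::
  "('p, 'm::finite) chart set \<Rightarrow> (real \<Rightarrow> 'p) \<Rightarrow> real \<Rightarrow> ('p, 'm) tangent" where
  "velocity A \<eta> t = (\<eta> t, \<lambda>c. if c \<in> charts_at A (\<eta> t)
     then vector_derivative (\<lambda>s. snd c (\<eta> s)) (at t) else 0)"

definition smooth_curve ::
  "'p topology \<Rightarrow> ('p, 'm::finite) chart set \<Rightarrow> real set \<Rightarrow> (real \<Rightarrow> 'p) \<Rightarrow> bool" where
  "smooth_curve M A I \<eta> \<longleftrightarrow> continuous_map (top_of_set I) M \<eta> \<and>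
     (\<forall>c\<in>A. smooth_on {t \<in> I. \<eta> t \<in> fst c} (\<lambda>t. snd c (\<eta> t)))"

definition causal_geodesic ::
  "'p topology \<Rightarrow> ('p, 'm::finite) chart set \<Rightarrow> (('p, 'm) tangent \<Rightarrow> real) \<Rightarrow>
   ('p \<Rightarrow> ('p, 'm) tangent) \<Rightarrow> ereal \<Rightarrow> ereal \<Rightarrow> (real \<Rightarrow> 'p) \<Rightarrow> bool" where
  "causal_geodesic M A L X a b \<eta> \<longleftrightarrow> smooth_curve M A (einterval a b) \<eta> \<and>
     (\<forall>t\<in>einterval a b. causal L (velocity A \<eta> t) \<and> future_directed A L X (velocity A \<eta> t) \<and>
        (\<forall>c\<in>charts_at A (\<eta> t). \<forall>\<alpha>.
           vector_derivative (\<lambda>s. snd (velocity A \<eta> s) c) (at t) $ \<alpha> +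
           2 * spray (bundle_rep A c L) \<alpha> (bundle_coords c (velocity A \<eta> t)) = 0))"

definition finsler_norm :: "(('p, 'm::finite) tangent \<Rightarrow> real) \<Rightarrow> ('p, 'm) tangent \<Rightarrow> real" where
  "finsler_norm L v = sqrt (- 2 * L v)"

definition unit_timelike_geodesic ::
  "'p topology \<Rightarrow> ('p, 'm::finite) chart set \<Rightarrow> (('p, 'm) tangent \<Rightarrow> real) \<Rightarrow>
   ('p \<Rightarrow> ('p, 'm) tangent) \<Rightarrow> ereal \<Rightarrow> ereal \<Rightarrow> (real \<Rightarrow> 'p) \<Rightarrow> bool" where
  "unit_timelike_geodesic M A L X a b \<eta> \<longleftrightarrow> causal_geodesic M A L X a b \<eta> \<and>
     (\<forall>t\<in>einterval a b. timelike L (velocity A \<eta> t) \<and> finsler_norm L (velocity A \<eta> t) = 1)"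


section \<open>Weighted Ricci curvature\<close>

definition weight_along ::
  "('p, 'm::finite) chart set \<Rightarrow> (('p, 'm) tangent \<Rightarrow> real) \<Rightarrow> (real \<Rightarrow> 'p) \<Rightarrow> real \<Rightarrow> real" where
  "weight_along A \<psi> \<eta> t = \<psi> (velocity A \<eta> t)"

text \<open>Any two geodesics with the same initial velocity agree near \<open>0\<close>.\<close>

definition geodesic_from ::
  "'p topology \<Rightarrow> ('p, 'm::finite) chart set \<Rightarrow> (('p, 'm) tangent \<Rightarrow> real) \<Rightarrow>
   ('p \<Rightarrow> ('p, 'm) tangent) \<Rightarrow> ('p, 'm) tangent \<Rightarrow> real \<Rightarrow> 'p" where
  "geodesic_from M A L X v = (SOME \<eta>. \<exists>a b. a < 0 \<and> 0 < b \<and>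
     causal_geodesic M A L X a b \<eta> \<and> velocity A \<eta> 0 = v)"

text \<open>The parameter \<open>n\<close> is the dimension of the manifold minus one. The value at \<open>N = -\<infinity>\<close> is
  irrelevant.\<close>

definition weighted_ricci ::
  "'p topology \<Rightarrow> ('p, 'm::finite) chart set \<Rightarrow> (('p, 'm) tangent \<Rightarrow> real) \<Rightarrow>
   ('p \<Rightarrow> ('p, 'm) tangent) \<Rightarrow> (('p, 'm) tangent \<Rightarrow> real) \<Rightarrow> nat \<Rightarrow> ereal \<Rightarrow>
   ('p, 'm) tangent \<Rightarrow> ereal" where
  "weighted_ricci M A L X \<psi> n N v =
     (let f = weight_along A \<psi> (geodesic_from M A L X v);
          f1 = deriv f 0; f2 = deriv (deriv f) 0
      in if N = \<infinity> then ereal (ricci A L v + f2)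
         else if N = ereal (real n) then (if f1 = 0 then ereal (ricci A L v + f2) else -\<infinity>)
         else ereal (ricci A L v + f2 - f1\<^sup>2 / (real_of_ereal N - real n)))"


section \<open>Tensor fields along a geodesic\<close>

definition normal_complement ::
  "('p, 'm::finite) chart set \<Rightarrow> (('p, 'm) tangent \<Rightarrow> real) \<Rightarrow> ('p, 'm) tangent \<Rightarrow>
   ('p, 'm) tangent set" where
  "normal_complement A L v = {w \<in> tangent_space A (fst v). gform A L v v w = 0}"

definition smooth_field_along ::
  "('p, 'm::finite) chart set \<Rightarrow> (real \<Rightarrow> 'p) \<Rightarrow> real set \<Rightarrow> (real \<Rightarrow> ('p, 'm) tangent) \<Rightarrow> bool" where
  "smooth_field_along A \<eta> S Y \<longleftrightarrow> (\<forall>t\<in>S. Y t \<in> tangent_space A (\<eta> t)) \<and>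
     (\<forall>c\<in>A. smooth_on {t \<in> S. \<eta> t \<in> fst c} (\<lambda>t. snd (Y t) c))"

definition smooth_normal_field ::
  "('p, 'm::finite) chart set \<Rightarrow> (('p, 'm) tangent \<Rightarrow> real) \<Rightarrow> (real \<Rightarrow> 'p) \<Rightarrow> real set \<Rightarrow>
   (real \<Rightarrow> ('p, 'm) tangent) \<Rightarrow> bool" where
  "smooth_normal_field A L \<eta> S P \<longleftrightarrow> smooth_field_along A \<eta> S P \<and>
     (\<forall>t\<in>S. P t \<in> normal_complement A L (velocity A \<eta> t))"

text \<open>\<open>Z\<close> is the covariant derivative of \<open>Y\<close> along \<open>\<eta>\<close> with reference vector the velocity of
  \<open>\<eta>\<close>: its components are given by the coordinate formula in every chart.\<close>

definition has_covderiv ::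
  "('p, 'm::finite) chart set \<Rightarrow> (('p, 'm) tangent \<Rightarrow> real) \<Rightarrow> (real \<Rightarrow> 'p) \<Rightarrow> real set \<Rightarrow>
   (real \<Rightarrow> ('p, 'm) tangent) \<Rightarrow> (real \<Rightarrow> ('p, 'm) tangent) \<Rightarrow> bool" where
  "has_covderiv A L \<eta> S Y Z \<longleftrightarrow> (\<forall>t\<in>S. Z t \<in> tangent_space A (\<eta> t) \<and>
     (\<forall>c\<in>charts_at A (\<eta> t). \<forall>\<alpha>. snd (Z t) c $ \<alpha> =
        vector_derivative (\<lambda>s. snd (Y s) c) (at t) $ \<alpha> +
        (\<Sum>\<beta>\<in>UNIV. \<Sum>\<gamma>\<in>UNIV.
           chern_coef (bundle_rep A c L) \<alpha> \<beta> \<gamma> (bundle_coords c (velocity A \<eta> t)) *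
           snd (velocity A \<eta> t) c $ \<beta> * snd (Y t) c $ \<gamma>)))"

definition tangent_linear_on ::
  "('p, 'm::finite) tangent set \<Rightarrow> (('p, 'm) tangent \<Rightarrow> ('p, 'm) tangent) \<Rightarrow> bool" where
  "tangent_linear_on V T \<longleftrightarrow> (\<forall>u\<in>V. T u \<in> V) \<and>
     (\<forall>u\<in>V. \<forall>w\<in>V. T (tadd u w) = tadd (T u) (T w)) \<and>
     (\<forall>u\<in>V. \<forall>r. T (tscale r u) = tscale r (T u))"

text \<open>A field of endomorphisms of the normal spaces; the values of \<open>E t\<close> off the normal space at
  \<open>t\<close> are irrelevant. It is smooth if it maps (local) smooth normal fields to smooth fields.\<close>

definition smooth_endo_field ::
  "('p, 'm::finite) chart set \<Rightarrow> (('p, 'm) tangent \<Rightarrow> real) \<Rightarrow> (real \<Rightarrow> 'p) \<Rightarrow> real set \<Rightarrow>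
   (real \<Rightarrow> ('p, 'm) tangent \<Rightarrow> ('p, 'm) tangent) \<Rightarrow> bool" where
  "smooth_endo_field A L \<eta> I E \<longleftrightarrow>
     (\<forall>t\<in>I. tangent_linear_on (normal_complement A L (velocity A \<eta> t)) (E t)) \<and>
     (\<forall>S P. open S \<and> S \<subseteq> I \<and> smooth_normal_field A L \<eta> S P \<longrightarrow>
        smooth_field_along A \<eta> S (\<lambda>t. E t (P t)))"

text \<open>\<open>E'(P) = E(P)' - E(P')\<close> for all (local) smooth normal fields \<open>P\<close>.\<close>

definition has_endo_deriv ::
  "('p, 'm::finite) chart set \<Rightarrow> (('p, 'm) tangent \<Rightarrow> real) \<Rightarrow> (real \<Rightarrow> 'p) \<Rightarrow> real set \<Rightarrow>
   (real \<Rightarrow> ('p, 'm) tangent \<Rightarrow> ('p, 'm) tangent) \<Rightarrow>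
   (real \<Rightarrow> ('p, 'm) tangent \<Rightarrow> ('p, 'm) tangent) \<Rightarrow> bool" where
  "has_endo_deriv A L \<eta> I E E' \<longleftrightarrow>
     smooth_endo_field A L \<eta> I E \<and> smooth_endo_field A L \<eta> I E' \<and>
     (\<forall>S P. open S \<and> S \<subseteq> I \<and> smooth_normal_field A L \<eta> S P \<longrightarrow>
        (\<exists>P' EP'. has_covderiv A L \<eta> S P P' \<and> has_covderiv A L \<eta> S (\<lambda>t. E t (P t)) EP' \<and>
           (\<forall>t\<in>S. E' t (P t) = tdiff (EP' t) (E t (P' t)))))"

definition endo_deriv ::
  "('p, 'm::finite) chart set \<Rightarrow> (('p, 'm) tangent \<Rightarrow> real) \<Rightarrow> (real \<Rightarrow> 'p) \<Rightarrow> real set \<Rightarrow>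
   (real \<Rightarrow> ('p, 'm) tangent \<Rightarrow> ('p, 'm) tangent) \<Rightarrow>
   real \<Rightarrow> ('p, 'm) tangent \<Rightarrow> ('p, 'm) tangent" where
  "endo_deriv A L \<eta> I E = (SOME E'. has_endo_deriv A L \<eta> I E E')"

definition is_transpose ::
  "('p, 'm::finite) chart set \<Rightarrow> (('p, 'm) tangent \<Rightarrow> real) \<Rightarrow> ('p, 'm) tangent \<Rightarrow>
   (('p, 'm) tangent \<Rightarrow> ('p, 'm) tangent) \<Rightarrow> (('p, 'm) tangent \<Rightarrow> ('p, 'm) tangent) \<Rightarrow> bool" where
  "is_transpose A L v T T' \<longleftrightarrow> tangent_linear_on (normal_complement A L v) T' \<and>
     (\<forall>u\<in>normal_complement A L v. \<forall>w\<in>normal_complement A L v.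
        gform A L v (T' u) w = gform A L v u (T w))"

definition jacobi_tensor_field ::
  "('p, 'm::finite) chart set \<Rightarrow> (('p, 'm) tangent \<Rightarrow> real) \<Rightarrow> (real \<Rightarrow> 'p) \<Rightarrow> real set \<Rightarrow>
   (real \<Rightarrow> ('p, 'm) tangent \<Rightarrow> ('p, 'm) tangent) \<Rightarrow> bool" where
  "jacobi_tensor_field A L \<eta> I J \<longleftrightarrow>
     (\<exists>J' J''. has_endo_deriv A L \<eta> I J J' \<and> has_endo_deriv A L \<eta> I J' J'' \<and>
        (\<forall>t\<in>I. \<forall>w\<in>normal_complement A L (velocity A \<eta> t).
           tadd (J'' t w) (curv_op A L (velocity A \<eta> t) (J t w)) = tzero (\<eta> t) \<and>
           (J t w = tzero (\<eta> t) \<and> J' t w = tzero (\<eta> t) \<longrightarrow> w = tzero (\<eta> t))))"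

definition lagrange_tensor_field ::
  "('p, 'm::finite) chart set \<Rightarrow> (('p, 'm) tangent \<Rightarrow> real) \<Rightarrow> (real \<Rightarrow> 'p) \<Rightarrow> real set \<Rightarrow>
   (real \<Rightarrow> ('p, 'm) tangent \<Rightarrow> ('p, 'm) tangent) \<Rightarrow> bool" where
  "lagrange_tensor_field A L \<eta> I J \<longleftrightarrow> jacobi_tensor_field A L \<eta> I J \<and>
     (\<exists>J'. has_endo_deriv A L \<eta> I J J' \<and>
        (\<forall>t\<in>I. \<exists>JT J'T. is_transpose A L (velocity A \<eta> t) (J t) JT \<and>
           is_transpose A L (velocity A \<eta> t) (J' t) J'T \<and>
           (\<forall>w\<in>normal_complement A L (velocity A \<eta> t).
              tdiff (J'T (J t w)) (JT (J' t w)) = tzero (\<eta> t))))"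

definition normal_coords ::
  "('p, 'm::finite) chart set \<Rightarrow> (('p, 'm) tangent \<Rightarrow> real) \<Rightarrow> ('p, 'm) tangent \<Rightarrow>
   (real ^ 'm) set" where
  "normal_coords A L v = (\<lambda>w. snd w (chart_at A (fst v))) ` normal_complement A L v"

definition endo_coords ::
  "('p, 'm::finite) chart set \<Rightarrow> 'p \<Rightarrow> (('p, 'm) tangent \<Rightarrow> ('p, 'm) tangent) \<Rightarrow>
   real ^ 'm \<Rightarrow> real ^ 'm" where
  "endo_coords A p T y = (let c = chart_at A p in snd (T (tvec A c p y)) c)"

definition endo_trace ::
  "('p, 'm::finite) chart set \<Rightarrow> (('p, 'm) tangent \<Rightarrow> real) \<Rightarrow> ('p, 'm) tangent \<Rightarrow>
   (('p, 'm) tangent \<Rightarrow> ('p, 'm) tangent) \<Rightarrow> real" where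
  "endo_trace A L v T = trace_on (normal_coords A L v) (endo_coords A (fst v) T)"

definition endo_det ::
  "('p, 'm::finite) chart set \<Rightarrow> (('p, 'm) tangent \<Rightarrow> real) \<Rightarrow> ('p, 'm) tangent \<Rightarrow>
   (('p, 'm) tangent \<Rightarrow> ('p, 'm) tangent) \<Rightarrow> real" where
  "endo_det A L v T = det_on (normal_coords A L v) (endo_coords A (fst v) T)"

definition expansion ::
  "('p, 'm::finite) chart set \<Rightarrow> (('p, 'm) tangent \<Rightarrow> real) \<Rightarrow> (real \<Rightarrow> 'p) \<Rightarrow> real set \<Rightarrow>
   (real \<Rightarrow> ('p, 'm) tangent \<Rightarrow> ('p, 'm) tangent) \<Rightarrow> real \<Rightarrow> real" where
  "expansion A L \<eta> I J t = endo_trace A L (velocity A \<eta> t)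
     (endo_deriv A L \<eta> I J t \<circ> inv_into (normal_complement A L (velocity A \<eta> t)) (J t))"


section \<open>Quantities depending on \<open>\<epsilon>\<close>\<close>

definition eps_expansion ::
  "('p, 'm::finite) chart set \<Rightarrow> (('p, 'm) tangent \<Rightarrow> real) \<Rightarrow> (('p, 'm) tangent \<Rightarrow> real) \<Rightarrow>
   nat \<Rightarrow> real \<Rightarrow> (real \<Rightarrow> 'p) \<Rightarrow> real set \<Rightarrow>
   (real \<Rightarrow> ('p, 'm) tangent \<Rightarrow> ('p, 'm) tangent) \<Rightarrow> real \<Rightarrow> real" where
  "eps_expansion A L \<psi> n \<epsilon> \<eta> I J t =
     exp (2 * (1 - \<epsilon>) / real n * weight_along A \<psi> \<eta> t) *
     (expansion A L \<eta> I J t - deriv (weight_along A \<psi> \<eta>) t)"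

definition eps_velocity ::
  "('p, 'm::finite) chart set \<Rightarrow> (('p, 'm) tangent \<Rightarrow> real) \<Rightarrow> nat \<Rightarrow> real \<Rightarrow> (real \<Rightarrow> 'p) \<Rightarrow>
   real \<Rightarrow> ('p, 'm) tangent" where
  "eps_velocity A \<psi> n \<epsilon> \<eta> t =
     tscale (exp (2 * (1 - \<epsilon>) / real n * weight_along A \<psi> \<eta> t)) (velocity A \<eta> t)"

definition eps_proper_time ::
  "('p, 'm::finite) chart set \<Rightarrow> (('p, 'm) tangent \<Rightarrow> real) \<Rightarrow> nat \<Rightarrow> real \<Rightarrow> (real \<Rightarrow> 'p) \<Rightarrow>
   real set \<Rightarrow> (real \<Rightarrow> real) \<Rightarrow> bool" where
  "eps_proper_time A \<psi> n \<epsilon> \<eta> I \<tau> \<longleftrightarrow> (\<forall>t\<in>I.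
     (\<tau> has_real_derivative exp (2 * (\<epsilon> - 1) / real n * weight_along A \<psi> \<eta> t)) (at t))"

definition eps_admissible :: "nat \<Rightarrow> ereal \<Rightarrow> real \<Rightarrow> bool" where
  "eps_admissible n N \<epsilon> \<longleftrightarrow>
     (if N = 0 then \<epsilon> = 0
      else if N = \<infinity> then \<bar>\<epsilon>\<bar> < 1
      else if N = ereal (real n) then True
      else \<bar>\<epsilon>\<bar> < sqrt (real_of_ereal N / (real_of_ereal N - real n)))"

definition eps_const :: "nat \<Rightarrow> ereal \<Rightarrow> real \<Rightarrow> real" where
  "eps_const n N \<epsilon> =
     (if N = 0 then 1 / real n
      else if N = \<infinity> then (1 - \<epsilon>\<^sup>2) / real n
      else 1 / real n * (1 - \<epsilon>\<^sup>2 * ((real_of_ereal N - real n) / real_of_ereal N)))"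

end

theory Submission
  imports Defs
begin

text \<open>
  The expansion \<open>\<theta> = trace (J' J\<inverse>)\<close> satisfies the Riccati equation
  \<open>\<theta>' + trace (S\<^sup>2) + Ric = 0\<close> with \<open>S = J' J\<inverse>\<close>. As \<open>J\<close> is Lagrange, \<open>S\<close> is symmetric on the
  \<open>n\<close>-dimensional normal space, where the metric is positive definite, so \<open>trace (S\<^sup>2) \<ge> \<theta>\<^sup>2 / n\<close>.
  Inserting \<open>Ric\<^sub>N \<ge> 0\<close> and completing the square in \<open>\<psi>\<^sub>\<eta>'\<close> gives
  \<open>d\<theta>\<^sub>\<epsilon>/d\<tau>\<^sub>\<epsilon> \<le> - c \<theta>\<^sub>\<epsilon>\<^sup>2\<close> as long as \<open>det J\<close> does not vanish. Then \<open>1/\<theta>\<^sub>\<epsilon> - c \<tau>\<^sub>\<epsilon>\<close> is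
  nondecreasing while \<open>\<theta>\<^sub>\<epsilon>\<close> keeps its sign, which is impossible up to the \<open>\<epsilon>\<close>-proper time
  \<open>\<tau>\<^sub>\<epsilon>(t\<^sub>0) - 1/(c \<theta>\<^sub>\<epsilon>(t\<^sub>0))\<close>.

  The Riccati equation is computed at one parameter at a time, in a chart around that point: the
  normal projections of the coordinate vectors form a moving frame, and everything needed about
  the Chern connection follows from Euler's identity for homogeneous functions.
\<close>

section \<open>Calculus of smooth maps\<close>

text \<open>The bound on \<open>\<epsilon>\<close> is the positivity of \<open>c\<close>. Write x
  for the difference of \<theta> and the derivative y of the weight: \<open>c\<close> is the
  coefficient of x squared that survives once the mixed term in x and y has been absorbed into a
  square. For N = 0 the terms in y squared cancel exactly, nothing is left to absorb a mixed term,
  and \<open>\<epsilon>\<close> has to be 0. No limit is taken at the far end of the interval. If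
  the determinant vanished nowhere on the closed interval, the expansion would be finite and of
  unchanged sign at the far end, which makes the estimate strict, while the far end is chosen to
  give equality. The obstacle is that J acts on a moving hyperplane. Extending J by the identity and
  J' by zero along the velocity turns the expansion into the trace of a product of square matrices.
  The splitting is governed by the covector of velocity derivatives of L, whose chart independence
  is immediate; no transformation law for the metric, the connection or the curvature is used,
  because each point is treated in the very chart in which these objects are evaluated.\<close>

lemma Ck_on_cong:
  assumes "open S" "\<And>x. x \<in> S \<Longrightarrow> f x = g x"
  shows "Ck_on k S f \<longleftrightarrow> Ck_on k S g"
  using assms(2)
proof (induction k arbitrary: f g)
  case 0
  then show ?case by (simp cong: continuous_on_cong)
next
  case (Suc k)
  have d: "f differentiable (at x) \<longleftrightarrow> g differentiable (at x)" if "x \<in> S" for x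
    unfolding differentiable_def
    using has_derivative_transform_within_open[of f _ x UNIV S g]
      has_derivative_transform_within_open[of g _ x UNIV S f] that Suc.prems assms(1) by auto
  show ?case
  proof (cases "\<forall>x\<in>S. f differentiable (at x)")
    case True
    have "frechet_derivative f (at x) = frechet_derivative g (at x)" if "x \<in> S" for x
      by (rule frechet_derivative_transform_within_open[OF True[rule_format, OF that] assms(1) that Suc.prems])
    then have "Ck_on k S (\<lambda>x. frechet_derivative f (at x) h) =
        Ck_on k S (\<lambda>x. frechet_derivative g (at x) h)" for h
      by (intro Suc.IH) simp
    then show ?thesis using d by simp
  next
    case False
    then show ?thesis using d by auto
  qed
qed

lemma Ck_on_subset: "Ck_on k S f \<Longrightarrow> T \<subseteq> S \<Longrightarrow> Ck_on k T f"
  by (induction k arbitrary: f) (auto intro: continuous_on_subset)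

lemma Ck_on_SucD: "Ck_on (Suc k) S f \<Longrightarrow> Ck_on k S f"
proof (induction k arbitrary: f)
  case 0
  then show ?case
    by (auto intro!: continuous_at_imp_continuous_on differentiable_imp_continuous_within)
qed auto

text \<open>Continuity and differentiability at a point see only a neighbourhood. This glues the
  local extensions of \<open>smooth_on\<close> into one statement on the whole set.\<close>

lemma Ck_on_local:
  assumes "\<And>x. x \<in> S \<Longrightarrow> \<exists>W. open W \<and> x \<in> W \<and> Ck_on k W f"
  shows "Ck_on k S f"
  using assms
proof (induction k arbitrary: f)
  case 0
  show ?case
    unfolding Ck_on.simps
  proof (intro continuous_at_imp_continuous_on ballI)
    fix x assume "x \<in> S"
    then obtain W where "open W" "x \<in> W" "continuous_on W f" using 0 by auto
    then show "isCont f x" by (simp add: continuous_on_eq_continuous_at)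
  qed
next
  case (Suc k)
  have "\<exists>W. open W \<and> x \<in> W \<and> Ck_on k W (\<lambda>x. frechet_derivative f (at x) h)" if "x \<in> S" for x h
    using Suc.prems[OF that] by auto
  moreover have "f differentiable (at x)" if "x \<in> S" for x
    using Suc.prems[OF that] by auto
  ultimately show ?case by (simp add: Suc.IH)
qed

text \<open>The closure proofs below supply explicit derivative formulas; this lemma and the next
  hide the choice made by \<open>frechet_derivative\<close>.\<close>

lemma Ck_on_SucI:
  assumes "open S" "\<And>x. x \<in> S \<Longrightarrow> (f has_derivative f' x) (at x)"
    "\<And>h. Ck_on k S (\<lambda>x. f' x h)"
  shows "Ck_on (Suc k) S f"
proof -
  have "frechet_derivative f (at x) = f' x" if "x \<in> S" for x
    using assms(2)[OF that] frechet_derivative_at by metis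
  then have "Ck_on k S (\<lambda>x. frechet_derivative f (at x) h)" for h
    using assms(3)[of h] by (subst Ck_on_cong[OF assms(1), of _ "\<lambda>x. f' x h"]) auto
  then show ?thesis using assms(2) by (auto simp: differentiable_def)
qed

lemma Ck_on_SucE:
  assumes "Ck_on (Suc k) S f"
  obtains f' where "\<And>x. x \<in> S \<Longrightarrow> (f has_derivative f' x) (at x)"
    "\<And>h. Ck_on k S (\<lambda>x. f' x h)"
  using assms that[of "\<lambda>x. frechet_derivative f (at x)"]
  by (simp add: frechet_derivative_works)

lemma Ck_on_const: "open S \<Longrightarrow> Ck_on k S (\<lambda>x. c)"
proof (induction k arbitrary: c)
  case (Suc k)
  show ?case by (rule Ck_on_SucI[where f' = "\<lambda>x h. 0"]) (use Suc in auto)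
qed auto

lemma Ck_on_bounded_linear:
  assumes "open S" "bounded_linear F" "Ck_on k S f"
  shows "Ck_on k S (\<lambda>x. F (f x))"
  using assms(3)
proof (induction k arbitrary: f)
  case 0
  then show ?case
    using bounded_linear.continuous_on[OF assms(2)] by auto
next
  case (Suc k)
  from Suc.prems obtain f' where "\<And>x. x \<in> S \<Longrightarrow> (f has_derivative f' x) (at x)"
    "\<And>h. Ck_on k S (\<lambda>x. f' x h)" by (rule Ck_on_SucE) (rule that)
  then show ?case
    by (intro Ck_on_SucI[OF assms(1), where f' = "\<lambda>x h. F (f' x h)"] Suc.IH
        bounded_linear.has_derivative[OF assms(2)])
qed

lemma Ck_on_add:
  assumes "open S" "Ck_on k S f" "Ck_on k S g"
  shows "Ck_on k S (\<lambda>x. f x + g x)"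
  using assms(2,3)
proof (induction k arbitrary: f g)
  case 0
  then show ?case by (auto intro: continuous_on_add)
next
  case (Suc k)
  from Suc.prems(1) obtain f' where f: "\<And>x. x \<in> S \<Longrightarrow> (f has_derivative f' x) (at x)"
    "\<And>h. Ck_on k S (\<lambda>x. f' x h)" by (rule Ck_on_SucE) (rule that)
  from Suc.prems(2) obtain g' where g: "\<And>x. x \<in> S \<Longrightarrow> (g has_derivative g' x) (at x)"
    "\<And>h. Ck_on k S (\<lambda>x. g' x h)" by (rule Ck_on_SucE) (rule that)
  show ?case
    by (rule Ck_on_SucI[OF assms(1), where f' = "\<lambda>x h. f' x h + g' x h"])
      (use f g Suc.IH in \<open>auto intro: has_derivative_add\<close>)
qed

lemma Ck_on_scaleR:
  assumes "open S" "Ck_on k S f" "Ck_on k S g"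
  shows "Ck_on k S (\<lambda>x. f x *\<^sub>R g x)"
  using assms(2,3)
proof (induction k arbitrary: f g)
  case 0
  then show ?case by (auto intro: continuous_on_scaleR)
next
  case (Suc k)
  from Suc.prems(1) obtain f' where f: "\<And>x. x \<in> S \<Longrightarrow> (f has_derivative f' x) (at x)"
    "\<And>h. Ck_on k S (\<lambda>x. f' x h)" by (rule Ck_on_SucE) (rule that)
  from Suc.prems(2) obtain g' where g: "\<And>x. x \<in> S \<Longrightarrow> (g has_derivative g' x) (at x)"
    "\<And>h. Ck_on k S (\<lambda>x. g' x h)" by (rule Ck_on_SucE) (rule that)
  note fg = Suc.prems[THEN Ck_on_SucD]
  show ?case
  proof (rule Ck_on_SucI[OF assms(1), where f' = "\<lambda>x h. f x *\<^sub>R g' x h + f' x h *\<^sub>R g x"])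
    fix x assume "x \<in> S"
    then show "((\<lambda>x. f x *\<^sub>R g x) has_derivative (\<lambda>h. f x *\<^sub>R g' x h + f' x h *\<^sub>R g x)) (at x)"
      by (intro has_derivative_scaleR f g)
  next
    fix h
    show "Ck_on k S (\<lambda>x. f x *\<^sub>R g' x h + f' x h *\<^sub>R g x)"
      by (intro Ck_on_add[OF assms(1)] Suc.IH fg f g)
  qed
qed

text \<open>The derivative is a product of the derivative of \<open>f\<close> and two copies of the
  inverse itself, so order k + 1 of the inverse reduces to order k.\<close>

lemma Ck_on_inverse:
  fixes f :: "'a::real_normed_vector \<Rightarrow> real"
  assumes "open S" "Ck_on k S f" "\<And>x. x \<in> S \<Longrightarrow> f x \<noteq> 0"
  shows "Ck_on k S (\<lambda>x. inverse (f x))"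
  using assms(2)
proof (induction k)
  case 0
  then show ?case using assms(3) by (auto intro: continuous_on_inverse)
next
  case (Suc k)
  from Suc.prems obtain f' where f: "\<And>x. x \<in> S \<Longrightarrow> (f has_derivative f' x) (at x)"
    "\<And>h. Ck_on k S (\<lambda>x. f' x h)" by (rule Ck_on_SucE) (rule that)
  have i: "Ck_on k S (\<lambda>x. inverse (f x))" using Suc Ck_on_SucD by blast
  show ?case
  proof (rule Ck_on_SucI[OF assms(1), where f' = "\<lambda>x h. inverse (f x) *\<^sub>R f' x h *\<^sub>R (-1) *\<^sub>R inverse (f x)"])
    fix x assume "x \<in> S"
    then show "((\<lambda>x. inverse (f x)) has_derivative (\<lambda>h. inverse (f x) *\<^sub>R f' x h *\<^sub>R (-1) *\<^sub>R inverse (f x))) (at x)"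
      using Deriv.has_derivative_inverse[OF assms(3) f(1)] by (simp add: mult.assoc)
  next
    fix h
    show "Ck_on k S (\<lambda>x. inverse (f x) *\<^sub>R f' x h *\<^sub>R (-1) *\<^sub>R inverse (f x))"
      by (intro Ck_on_scaleR assms i f Ck_on_const)
  qed
qed

text \<open>The chain rule evaluates the derivative of \<open>g\<close> in a direction that moves
  with x, whereas \<open>Ck_on\<close> controls fixed directions only. Expanding the direction in
  the finite basis of the middle space leaves scalar functions times derivatives in fixed
  directions, to which the induction hypothesis applies.\<close>

lemma Ck_on_compose:
  fixes z :: "'a::real_normed_vector \<Rightarrow> 'b::euclidean_space" and g :: "'b \<Rightarrow> 'c::real_normed_vector"
  assumes "open S" "open W" "z ` S \<subseteq> W" "Ck_on k W g" "Ck_on k S z"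
  shows "Ck_on k S (\<lambda>x. g (z x))"
  using assms(4,5)
proof (induction k arbitrary: g)
  case 0
  then show ?case using continuous_on_compose2[of W g S z] assms(3) by auto
next
  case (Suc k)
  from Suc.prems(1) obtain g' where g: "\<And>x. x \<in> W \<Longrightarrow> (g has_derivative g' x) (at x)"
    "\<And>h. Ck_on k W (\<lambda>x. g' x h)" by (rule Ck_on_SucE) (rule that)
  from Suc.prems(2) obtain z' where z: "\<And>x. x \<in> S \<Longrightarrow> (z has_derivative z' x) (at x)"
    "\<And>h. Ck_on k S (\<lambda>x. z' x h)" by (rule Ck_on_SucE) (rule that)
  have zk: "Ck_on k S z" using Suc.prems(2) Ck_on_SucD by blast
  have sums: "Ck_on k S (\<lambda>x. \<Sum>b\<in>B. F b x)"
    if "finite B" "\<And>b. b \<in> B \<Longrightarrow> Ck_on k S (F b)" for B and F :: "'b \<Rightarrow> 'a \<Rightarrow> 'c"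
    using that by (induction B) (auto intro: Ck_on_add Ck_on_const assms(1))
  show ?case
  proof (rule Ck_on_SucI[OF assms(1), where f' = "\<lambda>x h. \<Sum>b\<in>Basis. (z' x h \<bullet> b) *\<^sub>R g' (z x) b"])
    fix x assume x: "x \<in> S"
    then have zx: "z x \<in> W" using assms(3) by auto
    have lin: "linear (g' (z x))" using g(1)[OF zx] by (rule has_derivative_linear)
    have "((\<lambda>x. g (z x)) has_derivative (\<lambda>h. g' (z x) (z' x h))) (at x)"
      by (rule has_derivative_compose[OF z(1)[OF x] g(1)[OF zx]])
    moreover have "g' (z x) (z' x h) = (\<Sum>b\<in>Basis. (z' x h \<bullet> b) *\<^sub>R g' (z x) b)" for h
      by (subst (1) euclidean_representation[symmetric, of "z' x h"])
        (simp add: linear_sum[OF lin] linear_cmul[OF lin])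
    ultimately show "((\<lambda>x. g (z x)) has_derivative
        (\<lambda>h. \<Sum>b\<in>Basis. (z' x h \<bullet> b) *\<^sub>R g' (z x) b)) (at x)" by simp
  next
    fix h
    show "Ck_on k S (\<lambda>x. \<Sum>b\<in>Basis. (z' x h \<bullet> b) *\<^sub>R g' (z x) b)"
      by (intro sums Ck_on_scaleR assms(1) Suc.IH g z zk
          Ck_on_bounded_linear[OF assms(1) bounded_linear_inner_left] finite_Basis)
  qed
qed

text \<open>Smoothness on the set itself, without the extensions of \<open>smooth_on\<close>. The
  two agree on open sets; extensions really matter only for the weight, which lives on closed
  cones.\<close>

definition Cinf_on :: "'a::real_normed_vector set \<Rightarrow> ('a \<Rightarrow> 'b::real_normed_vector) \<Rightarrow> bool" where
  "Cinf_on S f \<longleftrightarrow> (\<forall>k. Ck_on k S f)"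

lemma Cinf_on_cong:
  "open S \<Longrightarrow> (\<And>x. x \<in> S \<Longrightarrow> f x = g x) \<Longrightarrow> Cinf_on S f \<longleftrightarrow> Cinf_on S g"
  unfolding Cinf_on_def using Ck_on_cong[of S f g] by simp

lemma Cinf_on_subset: "Cinf_on S f \<Longrightarrow> T \<subseteq> S \<Longrightarrow> Cinf_on T f"
  unfolding Cinf_on_def using Ck_on_subset by blast

lemma smooth_on_open_iff: "open S \<Longrightarrow> smooth_on S f \<longleftrightarrow> Cinf_on S f"
proof
  assume S: "open S" and f: "smooth_on S f"
  show "Cinf_on S f"
    unfolding Cinf_on_def
  proof (intro allI Ck_on_local)
    fix k x assume "x \<in> S"
    then obtain W g where W: "open W" "x \<in> W" "Ck_on k W g" "\<forall>y\<in>S \<inter> W. f y = g y"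
      using f unfolding smooth_on_def by metis
    have "Ck_on k (S \<inter> W) f"
      using Ck_on_cong[of "S \<inter> W" f g k] Ck_on_subset[OF W(3), of "S \<inter> W"] S W by auto
    then show "\<exists>W. open W \<and> x \<in> W \<and> Ck_on k W f"
      using S W(1,2) \<open>x \<in> S\<close> by blast
  qed
next
  assume "open S" "Cinf_on S f"
  then show "smooth_on S f" unfolding smooth_on_def Cinf_on_def by blast
qed

lemma Cinf_on_continuous: "Cinf_on S f \<Longrightarrow> continuous_on S f"
  unfolding Cinf_on_def using Ck_on.simps(1) by blast

lemma Cinf_on_imp_Ck_on: "Cinf_on S f \<Longrightarrow> Ck_on k S f"
  unfolding Cinf_on_def by simp

lemma Cinf_on_has_derivative:
  "Cinf_on S f \<Longrightarrow> x \<in> S \<Longrightarrow> (f has_derivative frechet_derivative f (at x)) (at x)"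
  using Cinf_on_imp_Ck_on[of S f "Suc 0"] by (simp add: frechet_derivative_works)

lemma Cinf_on_differentiable: "Cinf_on S f \<Longrightarrow> x \<in> S \<Longrightarrow> f differentiable (at x)"
  using Cinf_on_imp_Ck_on[of S f "Suc 0"] by simp

lemma Cinf_on_frechet: "Cinf_on S f \<Longrightarrow> Cinf_on S (\<lambda>x. frechet_derivative f (at x) h)"
proof -
  assume "Cinf_on S f"
  then have "Ck_on (Suc k) S f" for k by (rule Cinf_on_imp_Ck_on)
  then show ?thesis by (simp add: Cinf_on_def)
qed

lemma Cinf_on_const: "open S \<Longrightarrow> Cinf_on S (\<lambda>x. c)"
  unfolding Cinf_on_def by (simp add: Ck_on_const)

lemma Cinf_on_bounded_linear:
  "open S \<Longrightarrow> bounded_linear F \<Longrightarrow> Cinf_on S f \<Longrightarrow> Cinf_on S (\<lambda>x. F (f x))"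
  unfolding Cinf_on_def by (rule allI, rule Ck_on_bounded_linear) auto

lemma Cinf_on_add: "open S \<Longrightarrow> Cinf_on S f \<Longrightarrow> Cinf_on S g \<Longrightarrow> Cinf_on S (\<lambda>x. f x + g x)"
  unfolding Cinf_on_def by (rule allI, rule Ck_on_add) auto

lemma Cinf_on_scaleR:
  "open S \<Longrightarrow> Cinf_on S f \<Longrightarrow> Cinf_on S g \<Longrightarrow> Cinf_on S (\<lambda>x. f x *\<^sub>R g x)"
  unfolding Cinf_on_def by (rule allI, rule Ck_on_scaleR) auto

lemma Cinf_on_mult:
  fixes f g :: "'a::real_normed_vector \<Rightarrow> real"
  shows "open S \<Longrightarrow> Cinf_on S f \<Longrightarrow> Cinf_on S g \<Longrightarrow> Cinf_on S (\<lambda>x. f x * g x)"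
  using Cinf_on_scaleR[of S f g] by simp

lemma Cinf_on_minus: "open S \<Longrightarrow> Cinf_on S f \<Longrightarrow> Cinf_on S (\<lambda>x. - f x)"
  by (rule Cinf_on_bounded_linear[OF _ bounded_linear_minus[OF bounded_linear_ident]])

lemma Cinf_on_diff: "open S \<Longrightarrow> Cinf_on S f \<Longrightarrow> Cinf_on S g \<Longrightarrow> Cinf_on S (\<lambda>x. f x - g x)"
  using Cinf_on_add[of S f "\<lambda>x. - g x"] Cinf_on_minus[of S g] by simp

lemma Cinf_on_inverse:
  fixes f :: "'a::real_normed_vector \<Rightarrow> real"
  shows "open S \<Longrightarrow> Cinf_on S f \<Longrightarrow> (\<And>x. x \<in> S \<Longrightarrow> f x \<noteq> 0) \<Longrightarrow> Cinf_on S (\<lambda>x. inverse (f x))"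
  unfolding Cinf_on_def by (rule allI, rule Ck_on_inverse) auto

lemma Cinf_on_sum:
  "open S \<Longrightarrow> (\<And>i. i \<in> B \<Longrightarrow> Cinf_on S (f i)) \<Longrightarrow> Cinf_on S (\<lambda>x. \<Sum>i\<in>B. f i x)"
  by (induction B rule: infinite_finite_induct) (auto intro: Cinf_on_add Cinf_on_const)

lemma Cinf_on_prod:
  fixes f :: "'i \<Rightarrow> 'a::real_normed_vector \<Rightarrow> real"
  shows "open S \<Longrightarrow> (\<And>i. i \<in> B \<Longrightarrow> Cinf_on S (f i)) \<Longrightarrow> Cinf_on S (\<lambda>x. \<Prod>i\<in>B. f i x)"
  by (induction B rule: infinite_finite_induct) (auto intro: Cinf_on_mult Cinf_on_const)

lemma Cinf_on_compose:
  fixes z :: "'a::real_normed_vector \<Rightarrow> 'b::euclidean_space" and g :: "'b \<Rightarrow> 'c::real_normed_vector"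
  assumes "open S" "open W" "z ` S \<subseteq> W" "Cinf_on W g" "Cinf_on S z"
  shows "Cinf_on S (\<lambda>x. g (z x))"
  using Ck_on_compose[OF assms(1-3), of _ g] assms(4,5) unfolding Cinf_on_def by simp

lemma Cinf_on_ident: "open S \<Longrightarrow> Cinf_on S (\<lambda>x. x)"
  unfolding Cinf_on_def
proof
  fix k assume "open S"
  then show "Ck_on k S (\<lambda>x. x)"
    by (induction k) (auto intro: Ck_on_const)
qed

lemma Cinf_on_nth: "open S \<Longrightarrow> Cinf_on S f \<Longrightarrow> Cinf_on S (\<lambda>x. f x $ i)"
  by (rule Cinf_on_bounded_linear[OF _ bounded_linear_vec_nth])

lemma Cinf_on_vec:
  fixes f :: "'a::real_normed_vector \<Rightarrow> 'b::real_normed_vector ^ 'm"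
  assumes "open S" "\<And>i. Cinf_on S (\<lambda>x. f x $ i)"
  shows "Cinf_on S f"
proof -
  have "bounded_linear (axis i :: 'b \<Rightarrow> 'b ^ 'm)" for i
    by (rule bounded_linear_intro[where K = 1]) (auto simp: vec_eq_iff axis_def norm_vec_def L2_set_def
        if_distrib[of norm] if_distrib[of "\<lambda>x. x\<^sup>2"] cong: if_cong)
  then have "Cinf_on S (\<lambda>x. \<Sum>i\<in>UNIV. axis i (f x $ i))"
    by (intro Cinf_on_sum assms(1) Cinf_on_bounded_linear[OF assms(1) _ assms(2)])
  moreover have "(\<Sum>i\<in>UNIV. axis i (f x $ i)) = f x" for x
    by (simp add: vec_eq_iff axis_def if_distrib cong: if_cong)
  ultimately show ?thesis by simp
qed

lemma Cinf_on_Pair: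
  fixes f :: "'a::real_normed_vector \<Rightarrow> 'b::real_normed_vector" and g :: "'a \<Rightarrow> 'c::real_normed_vector"
  assumes "open S" "Cinf_on S f" "Cinf_on S g"
  shows "Cinf_on S (\<lambda>x. (f x, g x))"
proof -
  have "bounded_linear (\<lambda>u::'b. (u, 0::'c))" "bounded_linear (\<lambda>u::'c. (0::'b, u))"
    by (auto intro!: bounded_linear_Pair bounded_linear_ident bounded_linear_zero)
  from Cinf_on_bounded_linear[OF assms(1) this(1) assms(2)]
    Cinf_on_bounded_linear[OF assms(1) this(2) assms(3)]
  have "Cinf_on S (\<lambda>x. (f x, 0) + (0, g x))"
    by (rule Cinf_on_add[OF assms(1)])
  then show ?thesis by simp
qed

lemma Cinf_on_vector_derivative:
  fixes f :: "real \<Rightarrow> 'b::real_normed_vector"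
  assumes "open S" "Cinf_on S f"
  shows "Cinf_on S (\<lambda>t. vector_derivative f (at t))"
proof -
  have "Cinf_on S (\<lambda>t. frechet_derivative f (at t) 1)" by (rule Cinf_on_frechet[OF assms(2)])
  moreover have "frechet_derivative f (at t) 1 = vector_derivative f (at t)" if "t \<in> S" for t
    by (simp add: frechet_derivative_eq_vector_derivative[OF Cinf_on_differentiable[OF assms(2) that]])
  ultimately show ?thesis
    using Cinf_on_cong[OF assms(1), of "\<lambda>t. frechet_derivative f (at t) 1"] by simp
qed

lemma Cinf_on_has_vector_derivative:
  fixes f :: "real \<Rightarrow> 'b::real_normed_vector"
  shows "Cinf_on S f \<Longrightarrow> t \<in> S \<Longrightarrow> (f has_vector_derivative vector_derivative f (at t)) (at t)"
  using Cinf_on_differentiable vector_derivative_works by blast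

lemma Cinf_on_inner_left:
  fixes f :: "'a::real_normed_vector \<Rightarrow> 'b::euclidean_space"
  shows "open S \<Longrightarrow> Cinf_on S f \<Longrightarrow> Cinf_on S (\<lambda>t. f t \<bullet> y)"
  by (rule Cinf_on_bounded_linear[OF _ bounded_linear_inner_left])

lemma has_vector_derivative_vecI:
  fixes f :: "real \<Rightarrow> real ^ 'm::finite"
  assumes "\<And>i. ((\<lambda>s. f s $ i) has_real_derivative f' $ i) (at t)"
  shows "(f has_vector_derivative f') (at t)"
proof -
  have "((\<lambda>s. \<Sum>i\<in>UNIV. f s $ i *\<^sub>R axis i (1::real)) has_vector_derivative (\<Sum>i\<in>UNIV. f' $ i *\<^sub>R axis i 1)) (at t)"
    using assms by (intro has_vector_derivative_sum)
      (auto intro!: derivative_eq_intros simp: has_real_derivative_iff_has_vector_derivative)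
  then show ?thesis using basis_expansion[where 'a = real and 'n = 'm]
    by (simp add: scalar_mult_eq_scaleR)
qed

section \<open>Smooth dependence of determinants and inverse matrices\<close>

lemma Cinf_on_det:
  fixes G :: "'a::real_normed_vector \<Rightarrow> real ^ 'm ^ 'm"
  assumes "open S" "\<And>i j. Cinf_on S (\<lambda>x. G x $ i $ j)"
  shows "Cinf_on S (\<lambda>x. det (G x))"
  unfolding det_def
  by (intro Cinf_on_sum Cinf_on_mult Cinf_on_prod Cinf_on_const assms)

lemma matrix_det_nonzero_iff:
  fixes F :: "real ^ 'm ^ 'm"
  shows "det F \<noteq> 0 \<longleftrightarrow> (\<forall>y. F *v y = 0 \<longrightarrow> y = 0)"
  by (metis invertible_det_nz invertible_left_inverse matrix_left_invertible_ker)

lemma matrix_inv_works: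
  fixes G :: "real ^ 'm ^ 'm"
  assumes "det G \<noteq> 0"
  shows matrix_inv_right_det: "G ** matrix_inv G = mat 1" and matrix_inv_left_det: "matrix_inv G ** G = mat 1"
proof -
  have "\<exists>H. G ** H = mat 1 \<and> H ** G = mat 1"
    using assms by (simp add: invertible_det_nz[symmetric] invertible_def)
  then have "G ** matrix_inv G = mat 1 \<and> matrix_inv G ** G = mat 1"
    unfolding matrix_inv_def by (rule someI_ex)
  then show "G ** matrix_inv G = mat 1" "matrix_inv G ** G = mat 1" by auto
qed

text \<open>Column \<open>b\<close> of the inverse solves a linear system with right-hand side
  \<open>axis b 1\<close>, so Cramer's rule applies. The formula makes the inverse metric and the
  inverse of J visibly smooth.\<close>

lemma matrix_inv_eq_cramer:
  fixes G :: "real ^ 'm ^ 'm"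
  assumes "det G \<noteq> 0"
  shows "matrix_inv G $ a $ b = det (\<chi> i j. if j = a then axis b 1 $ i else G $ i $ j) / det G"
proof -
  have "G ** matrix_inv G = mat 1"
    by (rule matrix_inv_right_det[OF assms])
  then have "G *v (matrix_inv G *v axis b 1) = axis b 1"
    by (simp add: matrix_vector_mul_assoc)
  then have "matrix_inv G *v axis b 1 =
      (\<chi> k. det (\<chi> i j. if j = k then axis b 1 $ i else G $ i $ j) / det G)"
    using cramer[OF assms] by blast
  moreover have "(matrix_inv G *v axis b 1) $ a = matrix_inv G $ a $ b"
    by (simp add: matrix_vector_mult_def axis_def if_distrib cong: if_cong)
  ultimately show ?thesis by simp
qed

lemma Cinf_on_matrix_inv:
  fixes G :: "'a::real_normed_vector \<Rightarrow> real ^ 'm ^ 'm"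
  assumes "open S" "\<And>i j. Cinf_on S (\<lambda>x. G x $ i $ j)" "\<And>x. x \<in> S \<Longrightarrow> det (G x) \<noteq> 0"
  shows "Cinf_on S (\<lambda>x. matrix_inv (G x) $ a $ b)"
proof -
  have "Cinf_on S (\<lambda>x. det (\<chi> i j. if j = a then axis b 1 $ i else G x $ i $ j) * inverse (det (G x)))"
  proof (intro Cinf_on_mult Cinf_on_det Cinf_on_inverse assms)
    fix i j
    show "Cinf_on S (\<lambda>x. (\<chi> i j. if j = a then axis b 1 $ i else G x $ i $ j) $ i $ j)"
      by (cases "j = a") (simp_all add: assms Cinf_on_const)
  qed
  then show ?thesis
    by (subst Cinf_on_cong[OF assms(1)])
      (simp_all add: matrix_inv_eq_cramer assms(3) divide_inverse)
qed

section \<open>Traces and determinants of endomorphisms\<close>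

lemma matrix_mult_linear:
  fixes f :: "real ^ 'n \<Rightarrow> real ^ 'm"
  assumes "linear f"
  shows "matrix f *v x = f x"
  using matrix_vector_mul(2)[OF assms] by (rule fun_cong)

text \<open>Expand the standard basis vectors in \<open>B\<close> and swap the two sums. This is the
  bridge from the matrix trace to \<open>trace_on\<close>, which is taken in a chosen basis.\<close>

lemma trace_eq_sum_representation:
  fixes f :: "real ^ 'm \<Rightarrow> real ^ 'm"
  assumes f: "linear f" and B: "independent B" "span B = UNIV"
  shows "trace (matrix f) = (\<Sum>b\<in>B. representation B (f b) b)"
proof -
  have fin: "finite B" using B(1) by (rule independent_imp_finite)
  have e: "y = (\<Sum>b\<in>B. representation B y b *\<^sub>R b)" for y
    using sum_representation_eq[OF B(1) _ fin subset_refl, of y] B(2) by simp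
  have fe: "f y = (\<Sum>b\<in>B. representation B y b *\<^sub>R f b)" for y
  proof -
    have "f y = f (\<Sum>b\<in>B. representation B y b *\<^sub>R b)" by (rule arg_cong[OF e])
    then show ?thesis by (simp only: linear_sum[OF f] linear_cmul[OF f])
  qed
  have "trace (matrix f) = (\<Sum>i\<in>UNIV. f (axis i 1) $ i)"
    by (simp add: trace_def matrix_def)
  also have "\<dots> = (\<Sum>i\<in>UNIV. \<Sum>b\<in>B. representation B (axis i 1) b * f b $ i)"
    by (intro sum.cong refl) (subst fe, simp)
  also have "\<dots> = (\<Sum>b\<in>B. \<Sum>i\<in>UNIV. representation B (axis i 1) b * f b $ i)"
    by (rule sum.swap)
  also have "\<dots> = (\<Sum>b\<in>B. representation B (f b) b)"
  proof (rule sum.cong)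
    fix b assume "b \<in> B"
    have "representation B (f b) b = representation B (\<Sum>i\<in>UNIV. f b $ i *\<^sub>R axis i 1) b"
      by (simp add: basis_expansion scalar_mult_eq_scaleR[symmetric])
    also have "\<dots> = (\<Sum>i\<in>UNIV. f b $ i * representation B (axis i 1) b)"
      by (simp add: representation_sum[OF B(1)] representation_scale[OF B(1)] B(2))
    finally show "(\<Sum>i\<in>UNIV. representation B (axis i 1) b * f b $ i) = representation B (f b) b"
      by (simp add: mult.commute)
  qed simp
  finally show ?thesis .
qed

lemma some_basis_works:
  fixes V :: "'a::euclidean_space set"
  assumes "subspace V"
  shows "independent (some_basis V)" "span (some_basis V) = V"
proof -
  obtain B where "B \<subseteq> V" "independent B" "V \<subseteq> span B" "card B = dim V"
    by (rule basis_exists[of V]) (rule that)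
  moreover from this have "span B = V"
    by (intro antisym span_minimal assms)
  ultimately have "\<exists>B. independent B \<and> span B = V" by blast
  then have "independent (some_basis V) \<and> span (some_basis V) = V"
    unfolding some_basis_def by (rule someI_ex)
  then show "independent (some_basis V)" "span (some_basis V) = V" by auto
qed

text \<open>A basis of the hyperplane \<open>V\<close> together with \<open>v\<close> is a basis of
  the whole space, and \<open>v\<close> contributes a zero diagonal entry. Later \<open>V\<close> is
  the normal space and \<open>v\<close> the velocity. The map \<open>h\<close> is compared with
  \<open>f\<close> on \<open>V\<close> only, because endomorphism fields are unspecified
  elsewhere.\<close>

lemma trace_on_eq_trace:
  fixes f :: "real ^ 'm \<Rightarrow> real ^ 'm"
  assumes f: "linear f" and V: "subspace V" "v \<notin> V" "span (insert v V) = UNIV"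
    and fv: "f v = 0" and fV: "\<And>y. y \<in> V \<Longrightarrow> f y \<in> V" and h: "\<And>y. y \<in> V \<Longrightarrow> h y = f y"
  shows "trace_on V h = trace (matrix f)"
proof -
  define B where "B = some_basis V"
  have B: "independent B" "span B = V" unfolding B_def by (rule some_basis_works[OF V(1)])+
  have BV: "B \<subseteq> V" using span_superset[of B] B(2) by simp
  have vB: "v \<notin> B" using BV V(2) by auto
  have ins: "independent (insert v B)" using independent_insertI[of v B] B V(2) by simp
  have "V \<subseteq> span (insert v B)" using B(2) span_mono[of B "insert v B"] by auto
  then have "insert v V \<subseteq> span (insert v B)" by (simp add: span_base)
  then have sp: "span (insert v B) = UNIV"
    using span_minimal[OF _ subspace_span, of "insert v V" "insert v B"] V(3) by auto
  have "trace (matrix f) = (\<Sum>b\<in>insert v B. representation (insert v B) (f b) b)"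
    by (rule trace_eq_sum_representation[OF f ins sp])
  also have "\<dots> = (\<Sum>b\<in>B. representation (insert v B) (f b) b)"
    using independent_imp_finite[OF B(1)] vB by (simp add: fv representation_zero)
  also have "\<dots> = (\<Sum>b\<in>B. representation B (h b) b)"
  proof (rule sum.cong)
    fix b assume b: "b \<in> B"
    then have "f b \<in> span B" using fV BV B(2) by auto
    then have "representation (insert v B) (f b) = representation B (f b)"
      by (intro representation_extend[OF ins]) auto
    then show "representation (insert v B) (f b) b = representation B (h b) b"
      using h[of b] b BV by (simp add: subset_iff)
  qed simp
  finally show ?thesis by (simp add: trace_on_def B_def Let_def)
qed

text \<open>Composing a permutation with the transposition of \<open>i\<close> and \<open>j\<close>
  flips its sign and keeps the product, so the sum equals its own negative.\<close>

lemma leibniz_sum_identical_columns: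
  fixes m :: "'a \<Rightarrow> 'a \<Rightarrow> real"
  assumes "finite B" "i \<in> B" "j \<in> B" "i \<noteq> j" "m i = m j"
  shows "(\<Sum>\<pi> | \<pi> permutes B. of_int (sign \<pi>) * (\<Prod>b\<in>B. m b (\<pi> b))) = 0" (is "?s = 0")
proof -
  let ?t = "Transposition.transpose i j"
  have t: "?t permutes B" using assms by (simp add: permutes_swap_id)
  have "?s = (\<Sum>\<pi> | \<pi> permutes B. of_int (sign (\<pi> \<circ> ?t)) * (\<Prod>b\<in>B. m b ((\<pi> \<circ> ?t) b)))"
    by (rule sum.reindex_bij_witness[of _ "\<lambda>\<pi>. \<pi> \<circ> ?t" "\<lambda>\<pi>. \<pi> \<circ> ?t"])
      (auto simp: comp_assoc intro: permutes_compose[OF t])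
  also have "\<dots> = (\<Sum>\<pi> | \<pi> permutes B. - (of_int (sign \<pi>) * (\<Prod>b\<in>B. m b (\<pi> b))))"
  proof (rule sum.cong)
    fix \<pi> assume "\<pi> \<in> {\<pi>. \<pi> permutes B}"
    then have p: "permutation \<pi>" using assms(1) permutation_permutes by auto
    have "sign (\<pi> \<circ> ?t) = - sign \<pi>"
      using sign_compose[OF p permutation_swap_id[of i j]] assms(4) by (simp add: sign_swap_id)
    moreover have "(\<Prod>b\<in>B. m b ((\<pi> \<circ> ?t) b)) = (\<Prod>b\<in>B. m (?t b) (\<pi> b))"
      by (subst prod.permute[OF t]) (simp add: o_def)
    moreover have "m (?t b) = m b" for b
      using assms(5) by (simp add: Transposition.transpose_def)
    ultimately show "of_int (sign (\<pi> \<circ> ?t)) * (\<Prod>b\<in>B. m b ((\<pi> \<circ> ?t) b)) =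
        - (of_int (sign \<pi>) * (\<Prod>b\<in>B. m b (\<pi> b)))" by simp
  qed simp
  finally show ?thesis by (simp add: sum_negf)
qed

text \<open>Solve the relation for column \<open>i\<close>. Linearity in that column then gives a
  combination of Leibniz sums, each with two equal columns.\<close>

lemma leibniz_sum_dependent_columns:
  fixes m :: "'a \<Rightarrow> 'a \<Rightarrow> real"
  assumes B: "finite B" "i \<in> B" and c: "c i \<noteq> 0" "\<And>r. (\<Sum>b\<in>B. c b * m b r) = 0"
  shows "(\<Sum>\<pi> | \<pi> permutes B. of_int (sign \<pi>) * (\<Prod>b\<in>B. m b (\<pi> b))) = 0"
proof -
  let ?D = "\<lambda>m. \<Sum>\<pi> | \<pi> permutes B. of_int (sign \<pi>) * (\<Prod>b\<in>B. m b (\<pi> b))"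
  let ?k = "\<lambda>b. - c b / c i"
  have mi: "m i r = (\<Sum>j\<in>B - {i}. ?k j * m j r)" for r
  proof -
    have "c i * m i r + (\<Sum>j\<in>B - {i}. c j * m j r) = 0"
      using c(2)[of r] by (simp add: sum.remove[OF B])
    then have "m i r = (- (\<Sum>j\<in>B - {i}. c j * m j r)) / c i"
      using c(1) by (simp add: field_simps)
    also have "\<dots> = (\<Sum>j\<in>B - {i}. ?k j * m j r)"
      by (simp add: sum_divide_distrib sum_negf)
    finally show ?thesis .
  qed
  have "?D m = (\<Sum>\<pi> | \<pi> permutes B. \<Sum>j\<in>B - {i}. ?k j *
      (of_int (sign \<pi>) * (\<Prod>b\<in>B. (m(i := m j)) b (\<pi> b))))"
  proof (rule sum.cong)
    fix \<pi>
    have "(\<Prod>b\<in>B. (m(i := m j)) b (\<pi> b)) = m j (\<pi> i) * (\<Prod>b\<in>B - {i}. m b (\<pi> b))" for j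
      by (simp add: prod.remove[OF B])
    then show "of_int (sign \<pi>) * (\<Prod>b\<in>B. m b (\<pi> b)) =
       (\<Sum>j\<in>B - {i}. ?k j * (of_int (sign \<pi>) * (\<Prod>b\<in>B. (m(i := m j)) b (\<pi> b))))"
      by (simp add: prod.remove[OF B] mi sum_distrib_right sum_distrib_left algebra_simps)
  qed simp
  also have "\<dots> = (\<Sum>j\<in>B - {i}. ?k j * ?D (m(i := m j)))"
    by (subst sum.swap) (simp add: sum_distrib_left)
  also have "\<dots> = 0"
  proof (intro sum.neutral ballI)
    fix j assume "j \<in> B - {i}"
    then have "?D (m(i := m j)) = 0"
      using B by (intro leibniz_sum_identical_columns[of B i j]) auto
    then show "?k j * ?D (m(i := m j)) = 0" by simp
  qed
  finally show ?thesis .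
qed

text \<open>The coordinates of a nonzero kernel vector in the chosen basis are the coefficients of a
  linear relation between the columns.\<close>

lemma det_on_nonzero_imp_inj:
  fixes f :: "'a::euclidean_space \<Rightarrow> 'a"
  assumes f: "linear f" and V: "subspace V" and fV: "\<And>y. y \<in> V \<Longrightarrow> f y \<in> V"
    and h: "\<And>y. y \<in> V \<Longrightarrow> h y = f y" and d: "det_on V h \<noteq> 0"
    and y: "y \<in> V" "f y = 0"
  shows "y = 0"
proof (rule ccontr)
  assume "y \<noteq> 0"
  define B where "B = some_basis V"
  have B: "independent B" "span B = V" unfolding B_def by (rule some_basis_works[OF V])+
  have fin: "finite B" using B(1) by (rule independent_imp_finite)
  have BV: "B \<subseteq> V" using span_superset[of B] B(2) by simp
  let ?c = "representation B y"
  have e: "y = (\<Sum>b\<in>B. ?c b *\<^sub>R b)"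
    using sum_representation_eq[OF B(1) _ fin subset_refl, of y] B(2) y by simp
  obtain i where i: "i \<in> B" "?c i \<noteq> 0"
  proof (rule ccontr)
    assume "\<not> thesis"
    then have "(\<Sum>b\<in>B. ?c b *\<^sub>R b) = 0" using that by (intro sum.neutral) auto
    with e have "y = 0" by (rule trans)
    with \<open>y \<noteq> 0\<close> show False ..
  qed
  have "(\<Sum>b\<in>B. ?c b * representation B (h b) r) = 0" for r
  proof -
    have "0 = f (\<Sum>b\<in>B. ?c b *\<^sub>R b)" by (simp add: e[symmetric] y)
    also have "\<dots> = (\<Sum>b\<in>B. ?c b *\<^sub>R f b)"
      by (simp add: linear_sum[OF f] linear_cmul[OF f])
    also have "\<dots> = (\<Sum>b\<in>B. ?c b *\<^sub>R h b)"
      by (intro sum.cong) (use h BV in auto)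
    finally have z: "0 = (\<Sum>b\<in>B. ?c b *\<^sub>R h b)" .
    have hB: "h b \<in> span B" if "b \<in> B" for b using that h fV BV B(2) by auto
    have "0 = representation B (\<Sum>b\<in>B. ?c b *\<^sub>R h b) r"
      unfolding z[symmetric] by (simp add: representation_zero)
    also have "\<dots> = (\<Sum>b\<in>B. ?c b * representation B (h b) r)"
      by (subst representation_sum[OF B(1)])
        (auto simp: hB span_scale representation_scale[OF B(1)])
    finally show ?thesis by simp
  qed
  from leibniz_sum_dependent_columns[where m = "\<lambda>b. representation B (h b)", OF fin i this]
  show False using d by (simp add: det_on_def B_def Let_def)
qed


section \<open>Lorentzian matrices\<close>

lemma matrix_eq_bilinear:
  fixes G H :: "real ^ 'm ^ 'm"
  assumes "\<And>x y. x \<bullet> (G *v y) = x \<bullet> (H *v y)"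
  shows "G = H"
proof -
  have "G *v y = H *v y" for y using assms vector_eq_ldot[of "G *v y" "H *v y"] by blast
  then show ?thesis by (simp add: matrix_eq)
qed

lemma inner_mult_transpose:
  fixes G Q :: "real ^ 'm ^ 'm"
  shows "x \<bullet> ((transpose Q ** G ** Q) *v y) = (Q *v x) \<bullet> (G *v (Q *v y))"
  by (simp only: matrix_vector_mul_assoc[symmetric] transpose_matrix_vector)
    (subst inner_commute, subst dot_lmul_matrix, rule inner_commute)

definition minkowski :: "'m \<Rightarrow> real ^ 'm ^ 'm::finite" where
  "minkowski i = (\<chi> \<alpha> \<beta>. if \<alpha> = \<beta> then (if \<alpha> = i then -1 else 1) else 0)"

lemma minkowski_mult: "minkowski i *v x = (\<chi> j. (if j = i then - x $ j else x $ j))"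
  by (simp add: vec_eq_iff minkowski_def matrix_vector_mult_def if_distrib[of "\<lambda>x. x * z" for z] cong: if_cong)

lemma transpose_minkowski: "transpose (minkowski i) = minkowski i"
  by (simp add: vec_eq_iff minkowski_def transpose_def)

lemma det_minkowski: "det (minkowski i) \<noteq> 0"
  by (subst det_diagonal) (auto simp: minkowski_def)

lemma lorentzian_matrixE:
  fixes g :: "real ^ 'm ^ 'm"
  assumes "lorentzian_matrix g"
  obtains P :: "real ^ 'm ^ 'm" and i where "invertible P" "transpose P ** g ** P = minkowski i"
  using assms unfolding lorentzian_matrix_def minkowski_def by blast

text \<open>Symmetry is not part of the definition; it is inherited from the diagonal normal form
  under congruence. Applied to \<open>gmatrix\<close> it yields the equality of mixed velocity
  derivatives without Schwarz's theorem.\<close>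

lemma lorentzian_symmetric:
  fixes g :: "real ^ 'm ^ 'm"
  assumes "lorentzian_matrix g"
  shows "transpose g = g"
proof -
  obtain P :: "real ^ 'm ^ 'm" and i where P: "invertible P" "transpose P ** g ** P = minkowski i"
    by (rule lorentzian_matrixE[OF assms]) (rule that)
  obtain R where R: "P ** R = mat 1" using P(1) unfolding invertible_def by blast
  have RT: "transpose R ** transpose P = mat 1"
    using R by (metis matrix_transpose_mul transpose_mat)
  have "g = (transpose R ** transpose P) ** g ** (P ** R)" by (simp add: R RT)
  also have "\<dots> = transpose R ** minkowski i ** R"
    by (simp only: P(2)[symmetric] matrix_mul_assoc)
  finally have g: "g = transpose R ** minkowski i ** R" .
  have "transpose (transpose R ** minkowski i ** R) = transpose R ** minkowski i ** R"
    by (simp add: matrix_transpose_mul transpose_minkowski matrix_mul_assoc)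
  then show ?thesis using g by simp
qed

lemma lorentzian_det_nonzero:
  fixes g :: "real ^ 'm ^ 'm"
  assumes "lorentzian_matrix g"
  shows "det g \<noteq> 0"
proof
  assume "det g = 0"
  moreover obtain P :: "real ^ 'm ^ 'm" and i where "transpose P ** g ** P = minkowski i"
    by (rule lorentzian_matrixE[OF assms]) (rule that)
  then have "det (minkowski i) = det (transpose P) * det g * det P" by (metis det_mul)
  ultimately show False using det_minkowski[of i] by simp
qed

text \<open>The reflection in \<open>e - \<sigma> u\<close> maps the negative unit vector \<open>e\<close> of the standard frame to
  \<open>\<sigma> u\<close>; the sign \<open>\<sigma>\<close> keeps \<open>e - \<sigma> u\<close> from being lightlike.\<close>

lemma lorentzian_adapted_frame:
  fixes g :: "real ^ 'm ^ 'm"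
  assumes "lorentzian_matrix g" "v \<bullet> (g *v v) < 0"
  obtains Q :: "real ^ 'm ^ 'm" and i k where "invertible Q" "transpose Q ** g ** Q = minkowski i" "Q *v axis i 1 = k *\<^sub>R v"
proof -
  obtain P :: "real ^ 'm ^ 'm" and i where P: "invertible P" "transpose P ** g ** P = minkowski i"
    by (rule lorentzian_matrixE[OF assms(1)]) (rule that)
  let ?D = "minkowski i"
  obtain R where R: "P ** R = mat 1" using P(1) unfolding invertible_def by blast
  define s where "s = sqrt (- (v \<bullet> (g *v v)))"
  have s: "s > 0" "s * s = - (v \<bullet> (g *v v))" using assms(2) by (auto simp: s_def)
  define u where "u = (1 / s) *\<^sub>R (R *v v)"
  have Pu: "P *v u = (1 / s) *\<^sub>R v"
    by (simp add: u_def matrix_vector_mult_scaleR matrix_vector_mul_assoc R)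
  have uu: "u \<bullet> (?D *v u) = -1"
    unfolding P(2)[symmetric] inner_mult_transpose Pu using s assms(2)
    by (simp add: matrix_vector_mult_scaleR field_simps)
  define \<sigma> :: real where "\<sigma> = (if u $ i > 0 then -1 else 1)"
  have \<sigma>: "\<sigma> * \<sigma> = 1" "\<sigma> * u $ i \<le> 0" by (auto simp: \<sigma>_def)
  let ?e = "axis i 1 :: real ^ 'm"
  define w where "w = ?e - \<sigma> *\<^sub>R u"
  let ?b = "\<lambda>x y. x \<bullet> (?D *v y)"
  have sym: "?b x y = ?b y x" for x y
    by (metis dot_lmul_matrix inner_commute transpose_minkowski transpose_matrix_vector)
  have De: "?D *v ?e = - ?e" by (simp add: minkowski_mult vec_eq_iff axis_def)
  have ee: "?b ?e ?e = -1" by (simp add: De inner_axis)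
  have ue: "?b u ?e = - u $ i" by (simp add: De inner_axis)
  have we: "?b w ?e = -1 + \<sigma> * u $ i"
    by (simp add: w_def inner_diff_left ee ue)
  have wu: "?b w u = - u $ i + \<sigma>"
    using sym[of ?e u] ue uu by (simp add: w_def inner_diff_left)
  \<comment> \<open>This holds because \<open>?e\<close> and \<open>\<sigma> *\<^sub>R u\<close>
    have the same square -1, and it is what makes the reflection carry one to the other.\<close>
  have ww: "?b w w = 2 * ?b w ?e"
  proof -
    have "?b w w = ?b w ?e - \<sigma> * ?b w u"
      by (subst (2) w_def)
        (simp add: matrix_vector_mult_diff_distrib inner_diff_right matrix_vector_mult_scaleR)
    also have "\<dots> = 2 * (-1 + \<sigma> * u $ i)"
      unfolding wu we using \<sigma>(1) by (simp add: algebra_simps)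
    finally show ?thesis unfolding we .
  qed
  define q where "q = ?b w w"
  have w0: "q \<noteq> 0" using ww we \<sigma> by (simp add: q_def)
  define F where "F = (\<lambda>x. x - (2 / q * ?b w x) *\<^sub>R w)"
  have linF: "linear F"
    by (rule linearI) (simp_all add: F_def matrix_vector_right_distrib
        matrix_vector_mult_scaleR algebra_simps add_divide_distrib)
  have Fe: "F ?e = \<sigma> *\<^sub>R u" using ww w0 by (simp add: F_def w_def[symmetric] q_def) (simp add: w_def)
  have iso: "?b (F x) (F y) = ?b x y" for x y
  proof -
    let ?p = "2 / q * ?b w x" and ?r = "2 / q * ?b w y"
    have "?b (F x) (F y) = ?b x y - ?r * ?b x w - ?p * ?b w y + ?p * ?r * q"
      unfolding F_def q_def
      by (simp only: inner_diff_left inner_diff_right matrix_vector_mult_diff_distrib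
          matrix_vector_mult_scaleR inner_scaleR_left inner_scaleR_right) (simp only: algebra_simps)
    also have "?p * ?r * q = 2 * ?p * ?b w y" using w0 by simp
    finally show ?thesis using sym[of x w] by simp
  qed
  define Q where "Q = P ** matrix F"
  have Qx: "Q *v x = P *v F x" for x
    by (simp add: Q_def matrix_vector_mul_assoc[symmetric] matrix_mult_linear[OF linF])
  have QD: "transpose Q ** g ** Q = ?D"
  proof (rule matrix_eq_bilinear)
    fix x y
    show "x \<bullet> ((transpose Q ** g ** Q) *v y) = x \<bullet> (?D *v y)"
      unfolding inner_mult_transpose Qx using iso[of x y]
      by (simp only: P(2)[symmetric] inner_mult_transpose)
  qed
  have "det Q \<noteq> 0"
    using arg_cong[OF QD, of det] det_minkowski[of i] by (auto simp: det_mul)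
  then have "invertible Q" by (simp add: invertible_det_nz)
  moreover have "Q *v ?e = (\<sigma> / s) *\<^sub>R v"
    by (simp add: Qx Fe matrix_vector_mult_scaleR Pu)
  ultimately show ?thesis using QD that by blast
qed

text \<open>In a frame adapted to \<open>v\<close> the matrix of \<open>S\<close> is symmetric with vanishing row and column at
  the timelike index, so that Cauchy--Schwarz applies to the remaining diagonal entries.\<close>

lemma lorentzian_trace_square:
  fixes g S :: "real ^ 'm ^ 'm"
  assumes g: "lorentzian_matrix g" "v \<bullet> (g *v v) < 0"
    and S: "transpose S ** g = g ** S" "S *v v = 0"
  shows "(trace S)\<^sup>2 \<le> (real CARD('m) - 1) * trace (S ** S)"
proof -
  obtain Q :: "real ^ 'm ^ 'm" and i k where Q: "invertible Q" "transpose Q ** g ** Q = minkowski i" "Q *v axis i 1 = k *\<^sub>R v"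
    by (rule lorentzian_adapted_frame[OF g]) (rule that)
  obtain R where R: "Q ** R = mat 1" "R ** Q = mat 1" using Q(1) unfolding invertible_def by blast
  define T where "T = R ** S ** Q"
  have trT: "trace T = trace S"
    unfolding T_def by (subst trace_mul_sym) (simp add: matrix_mul_assoc R)
  have "T ** T = R ** S ** (Q ** R) ** S ** Q" by (simp add: T_def matrix_mul_assoc)
  then have "T ** T = R ** (S ** S) ** Q" by (simp add: R matrix_mul_assoc)
  then have trTT: "trace (T ** T) = trace (S ** S)"
    by (simp only:) (subst trace_mul_sym, simp add: matrix_mul_assoc R)
  have RT: "transpose Q ** transpose R = mat 1"
    using R by (metis matrix_transpose_mul transpose_mat)
  have "minkowski i ** T = transpose Q ** g ** (Q ** R) ** S ** Q"
    by (simp add: Q(2)[symmetric] T_def matrix_mul_assoc)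
  also have "\<dots> = transpose Q ** (g ** S) ** Q" by (simp add: R matrix_mul_assoc)
  also have "\<dots> = transpose Q ** transpose S ** g ** Q"
    by (simp add: S(1)[symmetric] matrix_mul_assoc)
  also have "\<dots> = transpose Q ** transpose S ** (transpose R ** transpose Q) ** g ** Q"
    using R by (simp add: matrix_transpose_mul[symmetric] transpose_mat)
  also have "\<dots> = transpose T ** minkowski i"
    by (simp add: T_def Q(2)[symmetric] matrix_transpose_mul matrix_mul_assoc)
  finally have sym: "minkowski i ** T = transpose T ** minkowski i" .
  have "T *v axis i 1 = R *v (S *v (Q *v axis i 1))"
    by (simp add: T_def matrix_vector_mul_assoc matrix_mul_assoc)
  then have "T *v axis i 1 = 0" by (simp add: Q(3) matrix_vector_mult_scaleR S(2))
  then have col: "T $ j $ i = 0" for j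
    by (simp add: vec_eq_iff matrix_vector_mult_def axis_def if_distrib cong: if_cong)
  have comp: "(if j = i then -1 else 1) * T $ j $ l = (if l = i then -1 else 1) * T $ l $ j" for j l
  proof -
    have "(minkowski i ** T) $ j $ l = (if j = i then -1 else 1) * T $ j $ l"
      by (simp add: matrix_matrix_mult_def minkowski_def if_distrib[of "\<lambda>x. x * z" for z] cong: if_cong)
    moreover have "(transpose T ** minkowski i) $ j $ l = (if l = i then -1 else 1) * T $ l $ j"
      by (simp add: matrix_matrix_mult_def minkowski_def transpose_def
          if_distrib[of "\<lambda>x. z * x" for z] cong: if_cong)
    ultimately show ?thesis using sym by simp
  qed
  have row: "T $ i $ l = 0" for l using comp[of i l] col[of l] by (cases "l = i") auto
  have sy: "T $ j $ l = T $ l $ j" for j l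
    using comp[of j l] row col by (cases "j = i"; cases "l = i") auto
  have "(trace T)\<^sup>2 = (\<Sum>j\<in>UNIV - {i}. T $ j $ j)\<^sup>2"
    by (simp add: trace_def sum.remove[of UNIV i] row)
  also have "\<dots> \<le> (\<Sum>j\<in>UNIV - {i}. (T $ j $ j)\<^sup>2) * card (UNIV - {i})"
    by (rule sum_squared_le_sum_of_squares)
  also have "\<dots> \<le> (\<Sum>j\<in>UNIV. \<Sum>l\<in>UNIV. (T $ j $ l)\<^sup>2) * card (UNIV - {i})"
  proof (rule mult_right_mono)
    have "(T $ j $ j)\<^sup>2 \<le> (\<Sum>l\<in>UNIV. (T $ j $ l)\<^sup>2)" for j
      by (rule member_le_sum) auto
    then have "(\<Sum>j\<in>UNIV - {i}. (T $ j $ j)\<^sup>2) \<le> (\<Sum>j\<in>UNIV - {i}. \<Sum>l\<in>UNIV. (T $ j $ l)\<^sup>2)"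
      by (rule sum_mono)
    also have "\<dots> \<le> (\<Sum>j\<in>UNIV. \<Sum>l\<in>UNIV. (T $ j $ l)\<^sup>2)"
      by (rule sum_mono2) (auto intro: sum_nonneg)
    finally show "(\<Sum>j\<in>UNIV - {i}. (T $ j $ j)\<^sup>2) \<le> (\<Sum>j\<in>UNIV. \<Sum>l\<in>UNIV. (T $ j $ l)\<^sup>2)" .
  qed simp
  \<comment> \<open>Symmetry of \<open>T\<close> identifies the trace of its square with the sum of
    the squares of all entries.\<close>
  also have "(\<Sum>j\<in>UNIV. \<Sum>l\<in>UNIV. (T $ j $ l)\<^sup>2) = trace (T ** T)"
    unfolding trace_def matrix_matrix_mult_def power2_eq_square
    by (simp add: sy[symmetric])
  finally show ?thesis
    by (simp add: trT trTT card_Diff_singleton mult.commute of_nat_diff)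
qed

section \<open>Finsler geometry in a chart\<close>

lemma frechet_derivative_coords:
  fixes f :: "(real ^ 'm::finite) \<times> (real ^ 'm) \<Rightarrow> real"
  assumes "f differentiable (at z)"
  shows "frechet_derivative f (at z) (a, b) = (\<Sum>\<alpha>\<in>UNIV. a $ \<alpha> * dx \<alpha> f z) + (\<Sum>\<alpha>\<in>UNIV. b $ \<alpha> * dv \<alpha> f z)"
proof -
  have lin: "linear (frechet_derivative f (at z))" using assms by (rule linear_frechet_derivative)
  have a: "(a, 0::real ^ 'm) = (\<Sum>\<alpha>\<in>UNIV. a $ \<alpha> *\<^sub>R (axis \<alpha> 1, 0))"
    using basis_expansion[of a] by (simp add: prod_eq_iff fst_sum snd_sum scalar_mult_eq_scaleR)
  have b: "(0::real ^ 'm, b) = (\<Sum>\<alpha>\<in>UNIV. b $ \<alpha> *\<^sub>R (0, axis \<alpha> 1))"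
    using basis_expansion[of b] by (simp add: prod_eq_iff fst_sum snd_sum scalar_mult_eq_scaleR)
  have "frechet_derivative f (at z) (a, b) =
      frechet_derivative f (at z) (a, 0) + frechet_derivative f (at z) (0, b)"
    by (simp add: linear_add[OF lin, symmetric])
  also have "\<dots> = (\<Sum>\<alpha>\<in>UNIV. a $ \<alpha> * dx \<alpha> f z) + (\<Sum>\<alpha>\<in>UNIV. b $ \<alpha> * dv \<alpha> f z)"
    by (simp only: a b linear_sum[OF lin] linear_cmul[OF lin] dx_def dv_def real_scaleR_def)
  finally show ?thesis .
qed

lemma sum_swap4:
  fixes F :: "'m::finite \<Rightarrow> 'm \<Rightarrow> 'm \<Rightarrow> 'm \<Rightarrow> real"
  shows "(\<Sum>\<beta>\<in>UNIV. \<Sum>\<gamma>\<in>UNIV. \<Sum>\<delta>\<in>UNIV. \<Sum>\<mu>\<in>UNIV. F \<beta> \<gamma> \<delta> \<mu>) =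
    (\<Sum>\<delta>\<in>UNIV. \<Sum>\<mu>\<in>UNIV. \<Sum>\<beta>\<in>UNIV. \<Sum>\<gamma>\<in>UNIV. F \<beta> \<gamma> \<delta> \<mu>)"
proof -
  have "(\<Sum>\<beta>\<in>UNIV. \<Sum>\<gamma>\<in>UNIV. \<Sum>\<delta>\<in>UNIV. \<Sum>\<mu>\<in>UNIV. F \<beta> \<gamma> \<delta> \<mu>) =
      (\<Sum>\<beta>\<in>UNIV. \<Sum>\<delta>\<in>UNIV. \<Sum>\<gamma>\<in>UNIV. \<Sum>\<mu>\<in>UNIV. F \<beta> \<gamma> \<delta> \<mu>)"
    by (rule sum.cong[OF refl], rule sum.swap)
  also have "\<dots> = (\<Sum>\<delta>\<in>UNIV. \<Sum>\<beta>\<in>UNIV. \<Sum>\<gamma>\<in>UNIV. \<Sum>\<mu>\<in>UNIV. F \<beta> \<gamma> \<delta> \<mu>)"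
    by (rule sum.swap)
  also have "\<dots> = (\<Sum>\<delta>\<in>UNIV. \<Sum>\<beta>\<in>UNIV. \<Sum>\<mu>\<in>UNIV. \<Sum>\<gamma>\<in>UNIV. F \<beta> \<gamma> \<delta> \<mu>)"
    by (rule sum.cong[OF refl], rule sum.cong[OF refl], rule sum.swap)
  also have "\<dots> = (\<Sum>\<delta>\<in>UNIV. \<Sum>\<mu>\<in>UNIV. \<Sum>\<beta>\<in>UNIV. \<Sum>\<gamma>\<in>UNIV. F \<beta> \<gamma> \<delta> \<mu>)"
    by (rule sum.cong[OF refl], rule sum.swap)
  finally show ?thesis .
qed

lemma sum2_half_diff:
  fixes v :: "'m::finite \<Rightarrow> real"
  shows "(\<Sum>\<alpha>\<in>UNIV. \<Sum>\<beta>\<in>UNIV. (1/2 * P \<alpha> \<beta> - 1/2 * Q \<alpha> \<beta>) * (v \<alpha> * v \<beta>)) =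
    1/2 * (\<Sum>\<alpha>\<in>UNIV. \<Sum>\<beta>\<in>UNIV. P \<alpha> \<beta> * v \<alpha> * v \<beta>) - 1/2 * (\<Sum>\<alpha>\<in>UNIV. \<Sum>\<beta>\<in>UNIV. Q \<alpha> \<beta> * v \<alpha> * v \<beta>)"
  by (simp only: sum_distrib_left sum_subtractf[symmetric] left_diff_distrib mult.assoc)

text \<open>The terms by which the Chern connection differs from the formal Christoffel symbols vanish
  when contracted twice with the reference vector.\<close>

lemma contract_torsion:
  fixes v :: "'m::finite \<Rightarrow> real"
  assumes C: "\<And>\<delta> \<mu>. (\<Sum>\<gamma>\<in>UNIV. C \<delta> \<gamma> \<mu> * v \<gamma>) = 0" "\<And>\<delta> \<mu>. (\<Sum>\<gamma>\<in>UNIV. C \<gamma> \<delta> \<mu> * v \<gamma>) = 0"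
  shows "(\<Sum>\<beta>\<in>UNIV. \<Sum>\<gamma>\<in>UNIV. (C \<delta> \<gamma> \<mu> * m \<mu> \<beta> + C \<beta> \<delta> \<mu> * m \<mu> \<gamma> - C \<beta> \<gamma> \<mu> * m \<mu> \<delta>) * v \<beta> * v \<gamma>) = 0"
      (is "?L1 = 0")
    and "(\<Sum>\<delta>\<in>UNIV. \<Sum>\<beta>\<in>UNIV. (C \<delta> \<gamma> \<mu> * m \<mu> \<beta> + C \<beta> \<delta> \<mu> * m \<mu> \<gamma> - C \<beta> \<gamma> \<mu> * m \<mu> \<delta>) * v \<delta> * v \<beta>) = 0"
      (is "?L2 = 0")
proof -
  have 1: "(\<Sum>\<beta>\<in>UNIV. \<Sum>\<gamma>\<in>UNIV. (m \<mu> \<beta> * v \<beta>) * (C \<delta> \<gamma> \<mu> * v \<gamma>)) = 0" for \<delta>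
    by (simp only: sum_product[symmetric] C mult_zero_right)
  have 2: "(\<Sum>\<beta>\<in>UNIV. \<Sum>\<gamma>\<in>UNIV. (C \<beta> \<delta> \<mu> * v \<beta>) * (m \<mu> \<gamma> * v \<gamma>)) = 0" for \<delta>
    by (simp only: sum_product[symmetric] C mult_zero_left)
  have 3: "(\<Sum>\<beta>\<in>UNIV. \<Sum>\<gamma>\<in>UNIV. (m \<mu> \<delta> * v \<beta>) * (C \<beta> \<gamma> \<mu> * v \<gamma>)) = 0" for \<delta>
    by (simp only: sum_distrib_left[symmetric] C mult_zero_right sum.neutral_const)
  have 4: "(\<Sum>\<delta>\<in>UNIV. \<Sum>\<beta>\<in>UNIV. (C \<delta> \<gamma> \<mu> * v \<delta>) * (m \<mu> \<beta> * v \<beta>)) = 0"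
    by (simp only: sum_product[symmetric] C mult_zero_left)
  have 5: "(\<Sum>\<delta>\<in>UNIV. \<Sum>\<beta>\<in>UNIV. (m \<mu> \<gamma> * v \<delta>) * (C \<beta> \<delta> \<mu> * v \<beta>)) = 0"
    by (simp only: sum_distrib_left[symmetric] C mult_zero_right sum.neutral_const)
  have 6: "(\<Sum>\<delta>\<in>UNIV. \<Sum>\<beta>\<in>UNIV. (m \<mu> \<delta> * v \<delta>) * (C \<beta> \<gamma> \<mu> * v \<beta>)) = 0"
    by (simp only: sum_product[symmetric] C mult_zero_right)
  have "?L1 =
    (\<Sum>\<beta>\<in>UNIV. \<Sum>\<gamma>\<in>UNIV. (m \<mu> \<beta> * v \<beta>) * (C \<delta> \<gamma> \<mu> * v \<gamma>)) +
    (\<Sum>\<beta>\<in>UNIV. \<Sum>\<gamma>\<in>UNIV. (C \<beta> \<delta> \<mu> * v \<beta>) * (m \<mu> \<gamma> * v \<gamma>)) -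
    (\<Sum>\<beta>\<in>UNIV. \<Sum>\<gamma>\<in>UNIV. (m \<mu> \<delta> * v \<beta>) * (C \<beta> \<gamma> \<mu> * v \<gamma>))"
    by (simp only: sum.distrib[symmetric] sum_subtractf[symmetric]) (simp only: algebra_simps)
  then show "?L1 = 0"
    by (simp only: 1 2 3 add_0_left diff_0_right)
  have "?L2 =
    (\<Sum>\<delta>\<in>UNIV. \<Sum>\<beta>\<in>UNIV. (C \<delta> \<gamma> \<mu> * v \<delta>) * (m \<mu> \<beta> * v \<beta>)) +
    (\<Sum>\<delta>\<in>UNIV. \<Sum>\<beta>\<in>UNIV. (m \<mu> \<gamma> * v \<delta>) * (C \<beta> \<delta> \<mu> * v \<beta>)) -
    (\<Sum>\<delta>\<in>UNIV. \<Sum>\<beta>\<in>UNIV. (m \<mu> \<delta> * v \<delta>) * (C \<beta> \<gamma> \<mu> * v \<beta>))"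
    by (simp only: sum.distrib[symmetric] sum_subtractf[symmetric]) (simp only: algebra_simps)
  then show "?L2 = 0"
    by (simp only: 4 5 6 add_0_left diff_0_right)
qed

text \<open>The local model: \<open>D\<close> is the image of a chart and \<open>l\<close> the
  expression of the structure over it. The coordinate identities are proved here free of the
  manifold.\<close>

locale lf_chart =
  fixes l :: "(real ^ 'm::finite) \<times> (real ^ 'm) \<Rightarrow> real" and D :: "(real ^ 'm) set"
  assumes openD: "open D"
    and smooth_l: "Cinf_on (D \<times> (- {0})) l"
    and homogeneous_l: "\<And>x v r. x \<in> D \<Longrightarrow> r > 0 \<Longrightarrow> l (x, r *\<^sub>R v) = r\<^sup>2 * l (x, v)"
    and lorentzian_l: "\<And>x v. x \<in> D \<Longrightarrow> v \<noteq> 0 \<Longrightarrow> lorentzian_matrix (gmatrix l (x, v))"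
begin

abbreviation U :: "((real ^ 'm) \<times> (real ^ 'm)) set" where
  "U \<equiv> D \<times> (- {0})"

section \<open>Smoothness of the metric, the spray and the nonlinear connection\<close>

lemma openU: "open U"
  by (intro open_Times openD) auto

lemma Cinf_dv: "Cinf_on U f \<Longrightarrow> Cinf_on U (dv \<alpha> f)"
  unfolding dv_def by (rule Cinf_on_frechet)

lemma Cinf_dx: "Cinf_on U f \<Longrightarrow> Cinf_on U (dx \<alpha> f)"
  unfolding dx_def by (rule Cinf_on_frechet)

lemma Cinf_snd_nth: "Cinf_on U (\<lambda>z. snd z $ \<beta>)"
  by (intro Cinf_on_nth openU Cinf_on_bounded_linear[OF openU bounded_linear_snd Cinf_on_ident])

lemma Cinf_gcoef: "Cinf_on U (gcoef l \<alpha> \<beta>)"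
  unfolding gcoef_def by (intro Cinf_dv smooth_l)

lemma det_gmatrix: "z \<in> U \<Longrightarrow> det (gmatrix l z) \<noteq> 0"
  using lorentzian_det_nonzero[OF lorentzian_l, of "fst z" "snd z"] by (cases z) auto

lemma Cinf_ginv: "Cinf_on U (ginv l \<alpha> \<beta>)"
  unfolding ginv_def
  by (intro Cinf_on_matrix_inv openU det_gmatrix) (simp_all add: gmatrix_def Cinf_gcoef)

lemma Cinf_christoffel: "Cinf_on U (christoffel l \<alpha> \<beta> \<gamma>)"
  unfolding christoffel_def
  by (intro Cinf_on_mult Cinf_on_sum Cinf_on_add Cinf_on_diff Cinf_on_const openU Cinf_ginv
      Cinf_dx Cinf_gcoef)

lemma Cinf_spray: "Cinf_on U (spray l \<alpha>)"
  unfolding spray_def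
  by (intro Cinf_on_mult Cinf_on_sum Cinf_on_const openU Cinf_christoffel Cinf_snd_nth)

lemma Cinf_nonlin_conn: "Cinf_on U (nonlin_conn l \<alpha> \<beta>)"
  unfolding nonlin_conn_def by (intro Cinf_dv Cinf_spray)

subsection \<open>Homogeneity\<close>

text \<open>The degree is an integer so that differentiating in the velocity can lower it by one
  without a side condition.\<close>

definition homog :: "int \<Rightarrow> ((real ^ 'm) \<times> (real ^ 'm) \<Rightarrow> real) \<Rightarrow> bool" where
  "homog k f \<longleftrightarrow> (\<forall>x\<in>D. \<forall>v r. v \<noteq> 0 \<and> r > 0 \<longrightarrow> f (x, r *\<^sub>R v) = r powi k * f (x, v))"

lemma homogD: "homog k f \<Longrightarrow> x \<in> D \<Longrightarrow> v \<noteq> 0 \<Longrightarrow> r > 0 \<Longrightarrow> f (x, r *\<^sub>R v) = r powi k * f (x, v)"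
  unfolding homog_def by blast

lemma homog_snd: "homog 1 (\<lambda>z. snd z $ \<beta>)"
  by (simp add: homog_def)

lemma homog_add: "homog k f \<Longrightarrow> homog k g \<Longrightarrow> homog k (\<lambda>z. f z + g z)"
  by (simp add: homog_def distrib_left)

lemma homog_diff: "homog k f \<Longrightarrow> homog k g \<Longrightarrow> homog k (\<lambda>z. f z - g z)"
  by (simp add: homog_def right_diff_distrib)

lemma homog_sum: "(\<And>i. i \<in> I \<Longrightarrow> homog k (f i)) \<Longrightarrow> homog k (\<lambda>z. \<Sum>i\<in>I. f i z)"
  by (simp add: homog_def sum_distrib_left)

lemma homog_mult: "homog j f \<Longrightarrow> homog k g \<Longrightarrow> j + k = i \<Longrightarrow> homog i (\<lambda>z. f z * g z)"
  by (auto simp: homog_def power_int_add)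

lemma homog_cmult: "homog k f \<Longrightarrow> homog k (\<lambda>z. c * f z)"
  by (simp add: homog_def)

text \<open>Differentiate the homogeneity relation in both arguments at once. The two special
  directions give the degrees of \<open>dx\<close> (unchanged) and \<open>dv\<close> (lowered by
  one).\<close>

lemma homog_derivative:
  assumes f: "homog k f" "Cinf_on U f" and z: "x \<in> D" "v \<noteq> 0" "r > 0"
  shows "frechet_derivative f (at (x, r *\<^sub>R v)) (a, r *\<^sub>R b) = r powi k * frechet_derivative f (at (x, v)) (a, b)"
proof -
  let ?S = "\<lambda>z::(real ^ 'm) \<times> (real ^ 'm). (fst z, r *\<^sub>R snd z)"
  have U: "(x, v) \<in> U" "(x, r *\<^sub>R v) \<in> U" using z by auto
  have "(?S has_derivative ?S) (at (x, v))"
    by (auto intro!: derivative_eq_intros)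
  moreover have "(f has_derivative frechet_derivative f (at (x, r *\<^sub>R v))) (at (?S (x, v)))"
    using Cinf_on_has_derivative[OF f(2) U(2)] by simp
  ultimately have 1: "((\<lambda>z. f (?S z)) has_derivative (\<lambda>h. frechet_derivative f (at (x, r *\<^sub>R v)) (?S h))) (at (x, v))"
    by (rule has_derivative_compose)
  have "((\<lambda>z. r powi k * f z) has_derivative (\<lambda>h. r powi k * frechet_derivative f (at (x, v)) h)) (at (x, v))"
    by (intro has_derivative_mult_right Cinf_on_has_derivative[OF f(2) U(1)])
  then have 2: "((\<lambda>z. f (?S z)) has_derivative (\<lambda>h. r powi k * frechet_derivative f (at (x, v)) h)) (at (x, v))"
    by (rule has_derivative_transform_within_open[OF _ openU U(1)]) (use homogD[OF f(1) _ _ z(3)] in fastforce)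
  have "(\<lambda>h. frechet_derivative f (at (x, r *\<^sub>R v)) (?S h)) = (\<lambda>h. r powi k * frechet_derivative f (at (x, v)) h)"
    using 1 2 by (rule has_derivative_unique)
  from fun_cong[OF this, of "(a, b)"] show ?thesis by simp
qed

lemma homog_dx:
  assumes "homog k f" "Cinf_on U f"
  shows "homog k (dx \<alpha> f)"
  unfolding homog_def dx_def using homog_derivative[OF assms, of _ _ _ _ 0] by simp

lemma homog_dv:
  assumes "homog k f" "Cinf_on U f"
  shows "homog (k - 1) (dv \<alpha> f)"
  unfolding homog_def
proof (intro ballI allI impI)
  fix x v :: "real ^ 'm" and r :: real assume x: "x \<in> D" and v: "v \<noteq> 0 \<and> r > 0"
  have lin: "linear (frechet_derivative f (at (x, r *\<^sub>R v)))"
    using x v by (intro linear_frechet_derivative Cinf_on_differentiable[OF assms(2)]) auto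
  have "r * dv \<alpha> f (x, r *\<^sub>R v) = frechet_derivative f (at (x, r *\<^sub>R v)) (r *\<^sub>R (0, axis \<alpha> 1))"
    unfolding dv_def linear_cmul[OF lin] by simp
  also have "\<dots> = r powi k * dv \<alpha> f (x, v)"
    using homog_derivative[OF assms x, of v r 0 "axis \<alpha> 1"] v by (simp add: dv_def)
  finally show "dv \<alpha> f (x, r *\<^sub>R v) = r powi (k - 1) * dv \<alpha> f (x, v)"
    using v by (simp add: power_int_diff field_simps)
qed

text \<open>Differentiate the homogeneity relation with respect to the factor \<open>r\<close> at
  \<open>r = 1\<close>.\<close>

lemma euler:
  assumes f: "homog k f" "Cinf_on U f" and z: "z \<in> U"
  shows "(\<Sum>\<gamma>\<in>UNIV. dv \<gamma> f z * snd z $ \<gamma>) = of_int k * f z"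
proof -
  obtain x v where zz: "z = (x, v)" "x \<in> D" "v \<noteq> 0" using z by auto
  let ?c = "\<lambda>r. (x, r *\<^sub>R v)"
  have "(?c has_derivative (\<lambda>h. (0, h *\<^sub>R v))) (at 1)"
    by (auto intro!: derivative_eq_intros)
  moreover have "(f has_derivative frechet_derivative f (at z)) (at (?c 1))"
    using Cinf_on_has_derivative[OF f(2) z] zz by simp
  ultimately have "((\<lambda>r. f (?c r)) has_derivative (\<lambda>h. frechet_derivative f (at z) (0, h *\<^sub>R v))) (at 1)"
    by (rule has_derivative_compose)
  moreover have "((\<lambda>r. f (?c r)) has_derivative (\<lambda>h. h * (of_int k * f z))) (at 1)"
  proof (rule has_derivative_transform_within_open[where s = "{0<..}"])
    show "((\<lambda>r. r powi k * f (x, v)) has_derivative (\<lambda>h. h * (of_int k * f z))) (at 1)"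
      by (auto intro!: derivative_eq_intros simp: zz)
  qed (use homogD[OF f(1)] zz in auto)
  ultimately have "(\<lambda>h. frechet_derivative f (at z) (0, h *\<^sub>R v)) = (\<lambda>h. h * (of_int k * f z))"
    by (rule has_derivative_unique)
  from fun_cong[OF this, of 1] have "frechet_derivative f (at z) (0, v) = of_int k * f z" by simp
  then show ?thesis
    using frechet_derivative_coords[OF Cinf_on_differentiable[OF f(2) z], of 0 v] zz
    by (simp add: mult.commute)
qed

text \<open>The product rule for a contraction with the velocity: a velocity derivative also hits
  the factor \<open>snd z\<close>, whence the extra term \<open>f \<mu> z\<close>. Together with
  \<open>euler\<close> it yields the contraction identities below.\<close>

lemma derivative_contract:
  assumes f: "\<And>\<gamma>. Cinf_on U (f \<gamma>)" and F: "\<And>z. z \<in> U \<Longrightarrow> (\<Sum>\<gamma>\<in>UNIV. f \<gamma> z * snd z $ \<gamma>) = F z"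
    and z: "z \<in> U"
  shows "dx \<mu> F z = (\<Sum>\<gamma>\<in>UNIV. dx \<mu> (f \<gamma>) z * snd z $ \<gamma>)"
    and "dv \<mu> F z = (\<Sum>\<gamma>\<in>UNIV. dv \<mu> (f \<gamma>) z * snd z $ \<gamma>) + f \<mu> z"
proof -
  have "((\<lambda>z. \<Sum>\<gamma>\<in>UNIV. f \<gamma> z * snd z $ \<gamma>) has_derivative
      (\<lambda>h. \<Sum>\<gamma>\<in>UNIV. f \<gamma> z * snd h $ \<gamma> + frechet_derivative (f \<gamma>) (at z) h * snd z $ \<gamma>)) (at z)"
    by (intro has_derivative_sum has_derivative_mult Cinf_on_has_derivative[OF f z]
        bounded_linear.has_derivative[OF bounded_linear_vec_nth]
        bounded_linear.has_derivative[OF bounded_linear_snd] has_derivative_ident)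
  then have "(F has_derivative
      (\<lambda>h. \<Sum>\<gamma>\<in>UNIV. f \<gamma> z * snd h $ \<gamma> + frechet_derivative (f \<gamma>) (at z) h * snd z $ \<gamma>)) (at z)"
    by (rule has_derivative_transform_within_open[OF _ openU z]) (simp add: F)
  then have D: "frechet_derivative F (at z) =
      (\<lambda>h. \<Sum>\<gamma>\<in>UNIV. f \<gamma> z * snd h $ \<gamma> + frechet_derivative (f \<gamma>) (at z) h * snd z $ \<gamma>)"
    by (rule frechet_derivative_at[symmetric])
  show "dx \<mu> F z = (\<Sum>\<gamma>\<in>UNIV. dx \<mu> (f \<gamma>) z * snd z $ \<gamma>)"
    by (simp add: dx_def D)
  show "dv \<mu> F z = (\<Sum>\<gamma>\<in>UNIV. dv \<mu> (f \<gamma>) z * snd z $ \<gamma>) + f \<mu> z"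
    by (simp add: dv_def D sum.distrib axis_def if_distrib cong: if_cong)
qed

lemma homog_l: "homog 2 l"
  using homogeneous_l by (auto simp: homog_def)

lemma homog_gcoef: "homog 0 (gcoef l \<alpha> \<beta>)"
  unfolding gcoef_def
  using homog_dv[OF homog_dv[OF homog_l smooth_l] Cinf_dv[OF smooth_l], of \<alpha> \<beta>] by simp

lemma homog_ginv: "homog 0 (ginv l \<alpha> \<beta>)"
  unfolding homog_def ginv_def gmatrix_def using homogD[OF homog_gcoef] by simp

lemma homog_christoffel: "homog 0 (christoffel l \<alpha> \<beta> \<gamma>)"
  unfolding christoffel_def
  by (intro homog_cmult homog_sum homog_mult[where j = 0 and k = 0] homog_ginv homog_diff homog_add
      homog_dx homog_gcoef Cinf_gcoef) simp

lemma homog_spray: "homog 2 (spray l \<alpha>)"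
  unfolding spray_def
  by (intro homog_cmult homog_sum homog_mult[where j = 1 and k = 1] homog_snd
      homog_mult[where j = 0 and k = 1] homog_christoffel) simp_all

lemma homog_nonlin_conn: "homog 1 (nonlin_conn l \<alpha> \<beta>)"
  unfolding nonlin_conn_def using homog_dv[OF homog_spray Cinf_spray] by simp

text \<open>Degree two is what relates the Ricci curvature at the rescaled velocity
  \<open>eps_velocity\<close> to the one at the unit velocity.\<close>

lemma homog_curv_coef: "homog 2 (curv_coef l \<alpha> \<beta>)"
proof -
  have "homog 0 (dv \<gamma> (nonlin_conn l \<alpha> \<beta>))" for \<gamma>
    using homog_dv[OF homog_nonlin_conn Cinf_nonlin_conn] by simp
  then have "homog 2 (\<lambda>z. 2 * dv \<gamma> (nonlin_conn l \<alpha> \<beta>) z * spray l \<gamma> z)" for \<gamma>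
    by (intro homog_mult[OF homog_cmult homog_spray]) simp_all
  moreover have "homog 2 (\<lambda>z. dx \<gamma> (nonlin_conn l \<alpha> \<beta>) z * snd z $ \<gamma>)" for \<gamma>
    by (rule homog_mult[OF homog_dx[OF homog_nonlin_conn Cinf_nonlin_conn] homog_snd]) simp
  moreover have "homog 2 (\<lambda>z. nonlin_conn l \<alpha> \<gamma> z * nonlin_conn l \<gamma> \<beta> z)" for \<gamma>
    by (rule homog_mult[OF homog_nonlin_conn homog_nonlin_conn]) simp
  ultimately show ?thesis
    unfolding curv_coef_def
    by (intro homog_diff homog_sum homog_cmult[OF homog_dx[OF homog_spray Cinf_spray]])
qed

subsection \<open>Contractions\<close>

lemma gcoef_commute: "z \<in> U \<Longrightarrow> gcoef l \<alpha> \<beta> z = gcoef l \<beta> \<alpha> z"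
proof -
  assume "z \<in> U"
  then have "transpose (gmatrix l z) = gmatrix l z"
    using lorentzian_symmetric[OF lorentzian_l, of "fst z" "snd z"] by (cases z) auto
  then show ?thesis by (auto simp: gmatrix_def transpose_def vec_eq_iff)
qed

lemma dx_gcoef_commute: "z \<in> U \<Longrightarrow> dx \<gamma> (gcoef l \<alpha> \<beta>) z = dx \<gamma> (gcoef l \<beta> \<alpha>) z"
  unfolding dx_def
  using frechet_derivative_transform_within_open[OF Cinf_on_differentiable[OF Cinf_gcoef] openU _ gcoef_commute]
  by metis

lemma dv_gcoef_commute: "z \<in> U \<Longrightarrow> dv \<gamma> (gcoef l \<alpha> \<beta>) z = dv \<gamma> (gcoef l \<beta> \<alpha>) z"
  unfolding dv_def
  using frechet_derivative_transform_within_open[OF Cinf_on_differentiable[OF Cinf_gcoef] openU _ gcoef_commute]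
  by metis

lemma dv_l_contract: "z \<in> U \<Longrightarrow> (\<Sum>\<gamma>\<in>UNIV. dv \<gamma> l z * snd z $ \<gamma>) = 2 * l z"
  using euler[OF homog_l smooth_l] by simp

lemma gcoef_contract: "z \<in> U \<Longrightarrow> (\<Sum>\<gamma>\<in>UNIV. gcoef l \<gamma> \<beta> z * snd z $ \<gamma>) = dv \<beta> l z"
  unfolding gcoef_def using euler[OF homog_dv[OF homog_l smooth_l] Cinf_dv[OF smooth_l]] by simp

lemma gcoef_contract': "z \<in> U \<Longrightarrow> (\<Sum>\<gamma>\<in>UNIV. gcoef l \<beta> \<gamma> z * snd z $ \<gamma>) = dv \<beta> l z"
  using gcoef_contract[of z \<beta>] by (simp add: gcoef_commute[of z \<beta>])

text \<open>The Cartan tensor annihilates the reference vector: the extra term of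
  \<open>derivative_contract\<close> is \<open>gcoef\<close> itself, which is also the velocity
  derivative of \<open>dv \<beta> l\<close>, so the two cancel.\<close>

lemma dv_gcoef_contract: "z \<in> U \<Longrightarrow> (\<Sum>\<gamma>\<in>UNIV. dv \<mu> (gcoef l \<gamma> \<beta>) z * snd z $ \<gamma>) = 0"
  using derivative_contract(2)[where f = "\<lambda>\<gamma>. gcoef l \<gamma> \<beta>" and z = z and \<mu> = \<mu>, OF Cinf_gcoef gcoef_contract]
  by (simp add: gcoef_def)

lemma dv_gcoef_contract': "z \<in> U \<Longrightarrow> (\<Sum>\<gamma>\<in>UNIV. dv \<mu> (gcoef l \<beta> \<gamma>) z * snd z $ \<gamma>) = 0"
  using dv_gcoef_contract[of z \<mu> \<beta>] by (simp add: dv_gcoef_commute[of z \<mu> \<beta>])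

lemma dx_gcoef_contract: "z \<in> U \<Longrightarrow> (\<Sum>\<delta>\<in>UNIV. dx \<gamma> (gcoef l \<delta> \<beta>) z * snd z $ \<delta>) = dx \<gamma> (dv \<beta> l) z"
  using derivative_contract(1)[where f = "\<lambda>\<gamma>. gcoef l \<gamma> \<beta>" and z = z and \<mu> = \<gamma>, OF Cinf_gcoef gcoef_contract] by simp

lemma dx_gcoef_contract': "z \<in> U \<Longrightarrow> (\<Sum>\<delta>\<in>UNIV. dx \<gamma> (gcoef l \<beta> \<delta>) z * snd z $ \<delta>) = dx \<gamma> (dv \<beta> l) z"
  using dx_gcoef_contract[of z \<gamma> \<beta>] by (simp add: dx_gcoef_commute[of z \<gamma> \<beta>])

lemma dx_dv_contract: "z \<in> U \<Longrightarrow> (\<Sum>\<beta>\<in>UNIV. dx \<gamma> (dv \<beta> l) z * snd z $ \<beta>) = 2 * dx \<gamma> l z"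
proof -
  assume z: "z \<in> U"
  have "dx \<gamma> (\<lambda>z. 2 * l z) z = (\<Sum>\<beta>\<in>UNIV. dx \<gamma> (dv \<beta> l) z * snd z $ \<beta>)"
    by (rule derivative_contract(1)[where f = "\<lambda>\<gamma>. dv \<gamma> l", OF Cinf_dv[OF smooth_l] dv_l_contract z])
  moreover have "dx \<gamma> (\<lambda>z. 2 * l z) z = 2 * dx \<gamma> l z"
    unfolding dx_def
    using frechet_derivative_at[OF has_derivative_mult_right[OF Cinf_on_has_derivative[OF smooth_l z], of 2]]
    by metis
  ultimately show ?thesis by simp
qed

lemma gcoef_ginv: "z \<in> U \<Longrightarrow> (\<Sum>\<alpha>\<in>UNIV. gcoef l \<delta> \<alpha> z * ginv l \<alpha> \<beta> z) = (if \<delta> = \<beta> then 1 else 0)"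
proof -
  assume "z \<in> U"
  then have "(gmatrix l z ** matrix_inv (gmatrix l z)) $ \<delta> $ \<beta> = (mat 1 :: real ^ 'm ^ 'm) $ \<delta> $ \<beta>"
    by (simp add: matrix_inv_right_det det_gmatrix)
  then show ?thesis
    by (simp add: matrix_matrix_mult_def gmatrix_def ginv_def mat_def)
qed

text \<open>Spray and Chern coefficients contain the inverse metric linearly; lowering their first
  index removes it, and they are only computed in that form.\<close>

lemma gcoef_raise:
  assumes "z \<in> U"
  shows "(\<Sum>\<alpha>\<in>UNIV. gcoef l \<delta> \<alpha> z * (\<Sum>\<beta>\<in>UNIV. ginv l \<alpha> \<beta> z * h \<beta>)) = h \<delta>"
proof -
  have "(\<Sum>\<alpha>\<in>UNIV. gcoef l \<delta> \<alpha> z * (\<Sum>\<beta>\<in>UNIV. ginv l \<alpha> \<beta> z * h \<beta>)) =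
     (\<Sum>\<beta>\<in>UNIV. \<Sum>\<alpha>\<in>UNIV. (gcoef l \<delta> \<alpha> z * ginv l \<alpha> \<beta> z) * h \<beta>)"
    by (subst sum.swap) (simp add: sum_distrib_left mult.assoc)
  also have "\<dots> = (\<Sum>\<beta>\<in>UNIV. (if \<delta> = \<beta> then 1 else 0) * h \<beta>)"
    by (simp only: sum_distrib_right[symmetric] gcoef_ginv[OF assms])
  also have "\<dots> = h \<delta>" by (simp add: if_distrib[of "\<lambda>x. x * y" for y] cong: if_cong)
  finally show ?thesis .
qed

text \<open>In lowered form the geodesic equation is the Euler-Lagrange equation of
  \<open>l\<close>.\<close>

lemma spray_lowered:
  assumes z: "z \<in> U"
  shows "(\<Sum>\<alpha>\<in>UNIV. gcoef l \<delta> \<alpha> z * (2 * spray l \<alpha> z)) =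
    (\<Sum>\<gamma>\<in>UNIV. dx \<gamma> (dv \<delta> l) z * snd z $ \<gamma>) - dx \<delta> l z"
proof -
  let ?v = "\<lambda>\<beta>. snd z $ \<beta>"
  let ?T = "\<lambda>\<delta> \<beta> \<gamma>. dx \<beta> (gcoef l \<delta> \<gamma>) z + dx \<gamma> (gcoef l \<beta> \<delta>) z - dx \<delta> (gcoef l \<beta> \<gamma>) z"
  let ?h = "\<lambda>\<delta>. 1/2 * (\<Sum>\<beta>\<in>UNIV. \<Sum>\<gamma>\<in>UNIV. ?T \<delta> \<beta> \<gamma> * ?v \<beta> * ?v \<gamma>)"
  have "2 * spray l \<alpha> z = (\<Sum>\<delta>\<in>UNIV. ginv l \<alpha> \<delta> z * ?h \<delta>)" for \<alpha>
  proof -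
    have "2 * spray l \<alpha> z = (\<Sum>\<beta>\<in>UNIV. \<Sum>\<gamma>\<in>UNIV. \<Sum>\<delta>\<in>UNIV. ginv l \<alpha> \<delta> z * (1/2 * (?T \<delta> \<beta> \<gamma> * ?v \<beta> * ?v \<gamma>)))"
      unfolding spray_def christoffel_def
      by (simp add: sum_distrib_left sum_distrib_right mult_ac)
    also have "\<dots> = (\<Sum>\<beta>\<in>UNIV. \<Sum>\<delta>\<in>UNIV. \<Sum>\<gamma>\<in>UNIV. ginv l \<alpha> \<delta> z * (1/2 * (?T \<delta> \<beta> \<gamma> * ?v \<beta> * ?v \<gamma>)))"
      by (intro sum.cong refl sum.swap)
    also have "\<dots> = (\<Sum>\<delta>\<in>UNIV. \<Sum>\<beta>\<in>UNIV. \<Sum>\<gamma>\<in>UNIV. ginv l \<alpha> \<delta> z * (1/2 * (?T \<delta> \<beta> \<gamma> * ?v \<beta> * ?v \<gamma>)))"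
      by (rule sum.swap)
    finally show ?thesis by (simp only: sum_distrib_left)
  qed
  then have "(\<Sum>\<alpha>\<in>UNIV. gcoef l \<delta> \<alpha> z * (2 * spray l \<alpha> z)) = ?h \<delta>"
    using gcoef_raise[OF z, of \<delta> ?h] by simp
  also have "(\<Sum>\<beta>\<in>UNIV. \<Sum>\<gamma>\<in>UNIV. ?T \<delta> \<beta> \<gamma> * ?v \<beta> * ?v \<gamma>) =
      (\<Sum>\<beta>\<in>UNIV. (\<Sum>\<gamma>\<in>UNIV. dx \<beta> (gcoef l \<delta> \<gamma>) z * ?v \<gamma>) * ?v \<beta>) +
      (\<Sum>\<beta>\<in>UNIV. \<Sum>\<gamma>\<in>UNIV. dx \<gamma> (gcoef l \<beta> \<delta>) z * ?v \<beta> * ?v \<gamma>) -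
      (\<Sum>\<beta>\<in>UNIV. (\<Sum>\<gamma>\<in>UNIV. dx \<delta> (gcoef l \<beta> \<gamma>) z * ?v \<gamma>) * ?v \<beta>)"
    by (simp only: sum_distrib_right sum.distrib[symmetric] sum_subtractf[symmetric]) (simp only: algebra_simps)
  also have "(\<Sum>\<beta>\<in>UNIV. \<Sum>\<gamma>\<in>UNIV. dx \<gamma> (gcoef l \<beta> \<delta>) z * ?v \<beta> * ?v \<gamma>) =
      (\<Sum>\<gamma>\<in>UNIV. (\<Sum>\<beta>\<in>UNIV. dx \<gamma> (gcoef l \<beta> \<delta>) z * ?v \<beta>) * ?v \<gamma>)"
    by (subst sum.swap) (simp add: sum_distrib_right)
  finally show ?thesis
    by (simp add: dx_gcoef_contract[OF z] dx_gcoef_contract'[OF z] dx_dv_contract[OF z])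
qed

text \<open>The Cartan corrections drop out by \<open>contract_torsion\<close>. Consequence: a
  solution of the spray equation has parallel velocity.\<close>

lemma chern_contract:
  assumes z: "z \<in> U"
  shows "(\<Sum>\<beta>\<in>UNIV. \<Sum>\<gamma>\<in>UNIV. chern_coef l \<alpha> \<beta> \<gamma> z * snd z $ \<beta> * snd z $ \<gamma>) = 2 * spray l \<alpha> z"
proof -
  let ?v = "\<lambda>\<beta>. snd z $ \<beta>"
  let ?X = "\<lambda>\<delta> \<mu> \<beta> \<gamma>. dv \<mu> (gcoef l \<delta> \<gamma>) z * nonlin_conn l \<mu> \<beta> z
        + dv \<mu> (gcoef l \<beta> \<delta>) z * nonlin_conn l \<mu> \<gamma> z
        - dv \<mu> (gcoef l \<beta> \<gamma>) z * nonlin_conn l \<mu> \<delta> z"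
  have X: "(\<Sum>\<beta>\<in>UNIV. \<Sum>\<gamma>\<in>UNIV. ?X \<delta> \<mu> \<beta> \<gamma> * ?v \<beta> * ?v \<gamma>) = 0" for \<delta> \<mu>
    by (rule contract_torsion[where C = "\<lambda>\<delta> \<gamma> \<mu>. dv \<mu> (gcoef l \<delta> \<gamma>) z" and m = "\<lambda>\<mu> \<beta>. nonlin_conn l \<mu> \<beta> z"])
      (simp_all add: dv_gcoef_contract[OF z] dv_gcoef_contract'[OF z])
  have "(\<Sum>\<beta>\<in>UNIV. \<Sum>\<gamma>\<in>UNIV. (\<Sum>\<delta>\<in>UNIV. \<Sum>\<mu>\<in>UNIV. ginv l \<alpha> \<delta> z * ?X \<delta> \<mu> \<beta> \<gamma>) * ?v \<beta> * ?v \<gamma>) =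
     (\<Sum>\<delta>\<in>UNIV. \<Sum>\<mu>\<in>UNIV. \<Sum>\<beta>\<in>UNIV. \<Sum>\<gamma>\<in>UNIV. ginv l \<alpha> \<delta> z * (?X \<delta> \<mu> \<beta> \<gamma> * ?v \<beta> * ?v \<gamma>))"
    by (simp only: sum_distrib_right mult.assoc) (rule sum_swap4)
  then have zero: "(\<Sum>\<beta>\<in>UNIV. \<Sum>\<gamma>\<in>UNIV. (\<Sum>\<delta>\<in>UNIV. \<Sum>\<mu>\<in>UNIV. ginv l \<alpha> \<delta> z * ?X \<delta> \<mu> \<beta> \<gamma>) * ?v \<beta> * ?v \<gamma>) = 0"
    by (simp only: sum_distrib_left[symmetric] X mult_zero_right sum.neutral_const)
  have "chern_coef l \<alpha> \<beta> \<gamma> z * ?v \<beta> * ?v \<gamma> = christoffel l \<alpha> \<beta> \<gamma> z * ?v \<beta> * ?v \<gamma> -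
     1/2 * ((\<Sum>\<delta>\<in>UNIV. \<Sum>\<mu>\<in>UNIV. ginv l \<alpha> \<delta> z * ?X \<delta> \<mu> \<beta> \<gamma>) * ?v \<beta> * ?v \<gamma>)" for \<beta> \<gamma>
    unfolding chern_coef_def by (simp only: left_diff_distrib mult.assoc)
  then have "(\<Sum>\<beta>\<in>UNIV. \<Sum>\<gamma>\<in>UNIV. chern_coef l \<alpha> \<beta> \<gamma> z * ?v \<beta> * ?v \<gamma>) =
      (\<Sum>\<beta>\<in>UNIV. \<Sum>\<gamma>\<in>UNIV. christoffel l \<alpha> \<beta> \<gamma> z * ?v \<beta> * ?v \<gamma>) -
      1/2 * (\<Sum>\<beta>\<in>UNIV. \<Sum>\<gamma>\<in>UNIV. (\<Sum>\<delta>\<in>UNIV. \<Sum>\<mu>\<in>UNIV. ginv l \<alpha> \<delta> z * ?X \<delta> \<mu> \<beta> \<gamma>) * ?v \<beta> * ?v \<gamma>)"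
    by (simp only: sum_subtractf sum_distrib_left[symmetric])
  then show ?thesis unfolding zero by (simp add: spray_def)
qed

text \<open>By Euler's identity \<open>dv \<alpha> l\<close> is the metric contracted with the
  velocity, so the left side is the lowered connection with the velocity in two slots. The Cartan
  corrections vanish again, and of the formal Christoffel symbols one position derivative of
  \<open>l\<close> survives. This is the part of metric compatibility that the proof uses.\<close>

lemma chern_lowered:
  assumes z: "z \<in> U"
  shows "(\<Sum>\<alpha>\<in>UNIV. dv \<alpha> l z * (\<Sum>\<beta>\<in>UNIV. chern_coef l \<alpha> \<beta> \<gamma> z * snd z $ \<beta>)) = dx \<gamma> l z"
proof -
  let ?v = "\<lambda>\<beta>. snd z $ \<beta>"
  let ?T = "\<lambda>\<delta> \<beta>. dx \<beta> (gcoef l \<delta> \<gamma>) z + dx \<gamma> (gcoef l \<beta> \<delta>) z - dx \<delta> (gcoef l \<beta> \<gamma>) z"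
  let ?X = "\<lambda>\<mu> \<delta> \<beta>. dv \<mu> (gcoef l \<delta> \<gamma>) z * nonlin_conn l \<mu> \<beta> z
        + dv \<mu> (gcoef l \<beta> \<delta>) z * nonlin_conn l \<mu> \<gamma> z
        - dv \<mu> (gcoef l \<beta> \<gamma>) z * nonlin_conn l \<mu> \<delta> z"
  let ?H = "\<lambda>\<beta> \<delta>. 1/2 * ?T \<delta> \<beta> - 1/2 * (\<Sum>\<mu>\<in>UNIV. ?X \<mu> \<delta> \<beta>)"
  have "chern_coef l \<alpha> \<beta> \<gamma> z = (\<Sum>\<delta>\<in>UNIV. ginv l \<alpha> \<delta> z * ?H \<beta> \<delta>)" for \<alpha> \<beta>
    unfolding chern_coef_def christoffel_def
    by (simp only: sum_distrib_left sum_subtractf[symmetric] right_diff_distrib mult_ac)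
  then have low: "(\<Sum>\<alpha>\<in>UNIV. gcoef l \<epsilon> \<alpha> z * chern_coef l \<alpha> \<beta> \<gamma> z) = ?H \<beta> \<epsilon>" for \<beta> \<epsilon>
    using gcoef_raise[OF z, of \<epsilon> "?H \<beta>"] by simp
  have "(\<Sum>\<alpha>\<in>UNIV. dv \<alpha> l z * (\<Sum>\<beta>\<in>UNIV. chern_coef l \<alpha> \<beta> \<gamma> z * ?v \<beta>)) =
      (\<Sum>\<alpha>\<in>UNIV. \<Sum>\<epsilon>\<in>UNIV. \<Sum>\<beta>\<in>UNIV. gcoef l \<epsilon> \<alpha> z * chern_coef l \<alpha> \<beta> \<gamma> z * (?v \<epsilon> * ?v \<beta>))"
    by (simp only: gcoef_contract[OF z, symmetric] sum_product) (simp only: mult_ac)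
  also have "\<dots> = (\<Sum>\<epsilon>\<in>UNIV. \<Sum>\<alpha>\<in>UNIV. \<Sum>\<beta>\<in>UNIV. gcoef l \<epsilon> \<alpha> z * chern_coef l \<alpha> \<beta> \<gamma> z * (?v \<epsilon> * ?v \<beta>))"
    by (rule sum.swap)
  also have "\<dots> = (\<Sum>\<epsilon>\<in>UNIV. \<Sum>\<beta>\<in>UNIV. \<Sum>\<alpha>\<in>UNIV. gcoef l \<epsilon> \<alpha> z * chern_coef l \<alpha> \<beta> \<gamma> z * (?v \<epsilon> * ?v \<beta>))"
    by (rule sum.cong[OF refl], rule sum.swap)
  \<comment> \<open>Only here are the raised coefficients replaced by their lowered form
    \<open>?H\<close>, after the sum over \<alpha> has been moved innermost.\<close>
  also have "\<dots> = (\<Sum>\<epsilon>\<in>UNIV. \<Sum>\<beta>\<in>UNIV. ?H \<beta> \<epsilon> * (?v \<epsilon> * ?v \<beta>))"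
    by (simp only: sum_distrib_right[symmetric] low)
  also have "\<dots> = 1/2 * (\<Sum>\<epsilon>\<in>UNIV. \<Sum>\<beta>\<in>UNIV. ?T \<epsilon> \<beta> * ?v \<epsilon> * ?v \<beta>) -
      1/2 * (\<Sum>\<epsilon>\<in>UNIV. \<Sum>\<beta>\<in>UNIV. (\<Sum>\<mu>\<in>UNIV. ?X \<mu> \<epsilon> \<beta>) * ?v \<epsilon> * ?v \<beta>)"
    by (rule sum2_half_diff)
  also have "(\<Sum>\<epsilon>\<in>UNIV. \<Sum>\<beta>\<in>UNIV. (\<Sum>\<mu>\<in>UNIV. ?X \<mu> \<epsilon> \<beta>) * ?v \<epsilon> * ?v \<beta>) = 0"
  proof -
    have "(\<Sum>\<epsilon>\<in>UNIV. \<Sum>\<beta>\<in>UNIV. (\<Sum>\<mu>\<in>UNIV. ?X \<mu> \<epsilon> \<beta>) * ?v \<epsilon> * ?v \<beta>) =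
      (\<Sum>\<epsilon>\<in>UNIV. \<Sum>\<mu>\<in>UNIV. \<Sum>\<beta>\<in>UNIV. ?X \<mu> \<epsilon> \<beta> * ?v \<epsilon> * ?v \<beta>)"
      by (simp only: sum_distrib_right) (rule sum.cong[OF refl], rule sum.swap)
    also have "\<dots> = (\<Sum>\<mu>\<in>UNIV. \<Sum>\<epsilon>\<in>UNIV. \<Sum>\<beta>\<in>UNIV. ?X \<mu> \<epsilon> \<beta> * ?v \<epsilon> * ?v \<beta>)"
      by (rule sum.swap)
    also have "\<dots> = (\<Sum>\<mu>\<in>(UNIV :: 'm set). 0)"
      by (rule sum.cong[OF refl], rule contract_torsion(2)[where C = "\<lambda>\<delta> \<gamma> \<mu>. dv \<mu> (gcoef l \<delta> \<gamma>) z"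
            and m = "\<lambda>\<mu> \<beta>. nonlin_conn l \<mu> \<beta> z" and v = ?v])
        (simp_all add: dv_gcoef_contract[OF z] dv_gcoef_contract'[OF z])
    finally show ?thesis by simp
  qed
  also have "(\<Sum>\<epsilon>\<in>UNIV. \<Sum>\<beta>\<in>UNIV. ?T \<epsilon> \<beta> * ?v \<epsilon> * ?v \<beta>) =
      (\<Sum>\<epsilon>\<in>UNIV. \<Sum>\<beta>\<in>UNIV. dx \<beta> (gcoef l \<epsilon> \<gamma>) z * ?v \<epsilon> * ?v \<beta>) +
      (\<Sum>\<epsilon>\<in>UNIV. (\<Sum>\<beta>\<in>UNIV. dx \<gamma> (gcoef l \<beta> \<epsilon>) z * ?v \<beta>) * ?v \<epsilon>) -
      (\<Sum>\<epsilon>\<in>UNIV. (\<Sum>\<beta>\<in>UNIV. dx \<epsilon> (gcoef l \<beta> \<gamma>) z * ?v \<beta>) * ?v \<epsilon>)"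
    by (simp only: sum_distrib_right sum.distrib[symmetric] sum_subtractf[symmetric]) (simp only: algebra_simps)
  also have "(\<Sum>\<epsilon>\<in>UNIV. \<Sum>\<beta>\<in>UNIV. dx \<beta> (gcoef l \<epsilon> \<gamma>) z * ?v \<epsilon> * ?v \<beta>) =
      (\<Sum>\<beta>\<in>UNIV. (\<Sum>\<epsilon>\<in>UNIV. dx \<beta> (gcoef l \<epsilon> \<gamma>) z * ?v \<epsilon>) * ?v \<beta>)"
    by (simp only: sum_distrib_right) (rule sum.swap)
  finally show ?thesis
    by (simp add: dx_gcoef_contract[OF z] dx_dv_contract[OF z])
qed

lemma dx_cmult: "Cinf_on U f \<Longrightarrow> z \<in> U \<Longrightarrow> dx \<gamma> (\<lambda>z. k * f z) z = k * dx \<gamma> f z"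
  unfolding dx_def
  using frechet_derivative_at[OF has_derivative_mult_right[OF Cinf_on_has_derivative, of U f z k]]
  by metis

lemma dv_cmult: "Cinf_on U f \<Longrightarrow> z \<in> U \<Longrightarrow> dv \<gamma> (\<lambda>z. k * f z) z = k * dv \<gamma> f z"
  unfolding dv_def
  using frechet_derivative_at[OF has_derivative_mult_right[OF Cinf_on_has_derivative, of U f z k]]
  by metis

lemma nonlin_conn_contract: "z \<in> U \<Longrightarrow> (\<Sum>\<beta>\<in>UNIV. nonlin_conn l \<alpha> \<beta> z * snd z $ \<beta>) = 2 * spray l \<alpha> z"
  unfolding nonlin_conn_def using euler[OF homog_spray Cinf_spray] by simp

text \<open>Differentiating the Euler relation between \<open>nonlin_conn\<close> and
  \<open>spray\<close> makes all terms cancel. It allows J to be replaced by its extension along the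
  velocity in the Jacobi equation.\<close>

lemma curv_contract:
  assumes z: "z \<in> U"
  shows "(\<Sum>\<beta>\<in>UNIV. curv_coef l \<alpha> \<beta> z * snd z $ \<beta>) = 0"
proof -
  let ?v = "\<lambda>\<beta>. snd z $ \<beta>"
  let ?N = "nonlin_conn l"
  note dc = derivative_contract[where f = "?N \<alpha>", OF Cinf_nonlin_conn nonlin_conn_contract z]
  have dxN: "(\<Sum>\<beta>\<in>UNIV. dx \<gamma> (?N \<alpha> \<beta>) z * ?v \<beta>) = 2 * dx \<gamma> (spray l \<alpha>) z" for \<gamma>
    using dc(1)[of \<gamma>] by (simp add: dx_cmult[OF Cinf_spray z])
  have dvN: "(\<Sum>\<beta>\<in>UNIV. dv \<gamma> (?N \<alpha> \<beta>) z * ?v \<beta>) = ?N \<alpha> \<gamma> z" for \<gamma>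
    using dc(2)[of \<gamma>] by (simp add: dv_cmult[OF Cinf_spray z] nonlin_conn_def[of l \<alpha> \<gamma>])
  have "(\<Sum>\<beta>\<in>UNIV. curv_coef l \<alpha> \<beta> z * ?v \<beta>) =
     2 * (\<Sum>\<beta>\<in>UNIV. dx \<beta> (spray l \<alpha>) z * ?v \<beta>)
     - ((\<Sum>\<beta>\<in>UNIV. \<Sum>\<gamma>\<in>UNIV. dx \<gamma> (?N \<alpha> \<beta>) z * ?v \<beta> * ?v \<gamma>)
       - 2 * (\<Sum>\<beta>\<in>UNIV. \<Sum>\<gamma>\<in>UNIV. dv \<gamma> (?N \<alpha> \<beta>) z * ?v \<beta> * spray l \<gamma> z))
     - (\<Sum>\<beta>\<in>UNIV. \<Sum>\<gamma>\<in>UNIV. ?N \<alpha> \<gamma> z * (?N \<gamma> \<beta> z * ?v \<beta>))"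
    unfolding curv_coef_def
    by (simp add: sum_distrib_left sum_distrib_right sum_subtractf left_diff_distrib right_diff_distrib mult_ac)
  also have "(\<Sum>\<beta>\<in>UNIV. \<Sum>\<gamma>\<in>UNIV. dx \<gamma> (?N \<alpha> \<beta>) z * ?v \<beta> * ?v \<gamma>) = (\<Sum>\<gamma>\<in>UNIV. 2 * dx \<gamma> (spray l \<alpha>) z * ?v \<gamma>)"
    by (subst sum.swap) (simp only: sum_distrib_right[symmetric] dxN)
  also have "(\<Sum>\<beta>\<in>UNIV. \<Sum>\<gamma>\<in>UNIV. dv \<gamma> (?N \<alpha> \<beta>) z * ?v \<beta> * spray l \<gamma> z) = (\<Sum>\<gamma>\<in>UNIV. ?N \<alpha> \<gamma> z * spray l \<gamma> z)"
    by (subst sum.swap) (simp only: sum_distrib_right[symmetric] dvN)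
  also have "(\<Sum>\<beta>\<in>UNIV. \<Sum>\<gamma>\<in>UNIV. ?N \<alpha> \<gamma> z * (?N \<gamma> \<beta> z * ?v \<beta>)) = (\<Sum>\<gamma>\<in>UNIV. ?N \<alpha> \<gamma> z * (2 * spray l \<gamma> z))"
    by (subst sum.swap) (simp only: sum_distrib_left[symmetric] nonlin_conn_contract[OF z])
  finally show ?thesis
    by (simp add: sum_distrib_left mult_ac)
qed

end

section \<open>Charts and tangent vectors\<close>

locale smooth_atlas =
  fixes M :: "'p topology" and A :: "('p, 'm::finite) chart set"
  assumes manifold: "smooth_manifold M A"
begin

lemma chart_domain:
  assumes "c \<in> A"
  shows "openin M (fst c)" "open (snd c ` fst c)" "fst c \<subseteq> topspace M"
  using manifold assms openin_subset unfolding smooth_manifold_def by auto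

lemma chart_homeomorphic:
  "c \<in> A \<Longrightarrow> homeomorphic_map (subtopology M (fst c)) (top_of_set (snd c ` fst c)) (snd c)"
  using manifold unfolding smooth_manifold_def by blast

lemma chart_inj: "c \<in> A \<Longrightarrow> inj_on (snd c) (fst c)"
  using homeomorphic_imp_injective_map[OF chart_homeomorphic] chart_domain(3)
  by (simp add: Int_absorb1)

lemma chart_inv_chart: "c \<in> A \<Longrightarrow> p \<in> fst c \<Longrightarrow> chart_inv c (snd c p) = p"
  unfolding chart_inv_def by (rule inv_into_f_f[OF chart_inj])

lemma chart_image_open:
  assumes "c \<in> A" "openin M V" "V \<subseteq> fst c"
  shows "open (snd c ` V)"
proof -
  have "openin (subtopology M (fst c)) V"
    using assms by (auto simp: openin_subtopology)
  then have "openin (top_of_set (snd c ` fst c)) (snd c ` V)"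
    using homeomorphic_imp_open_map[OF chart_homeomorphic[OF assms(1)]] unfolding open_map_def by blast
  then show ?thesis using chart_domain(2)[OF assms(1)] openin_open_trans by blast
qed

lemma transition_domain_open:
  "c \<in> A \<Longrightarrow> d \<in> A \<Longrightarrow> open (snd c ` (fst c \<inter> fst d))"
  by (rule chart_image_open) (auto intro: openin_Int chart_domain)

lemma transition_Cinf:
  "c \<in> A \<Longrightarrow> d \<in> A \<Longrightarrow> Cinf_on (snd c ` (fst c \<inter> fst d)) (snd d \<circ> chart_inv c)"
  using manifold smooth_on_open_iff[OF transition_domain_open]
  unfolding smooth_manifold_def by blast

lemma transition_derivative:
  assumes "c \<in> charts_at A p" "d \<in> charts_at A p"
  shows "((snd d \<circ> chart_inv c) has_derivative chart_change_deriv c d p) (at (snd c p))"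
  unfolding chart_change_deriv_def
  by (rule Cinf_on_has_derivative[OF transition_Cinf]) (use assms in \<open>auto simp: charts_at_def\<close>)

lemma linear_chart_change:
  "c \<in> charts_at A p \<Longrightarrow> d \<in> charts_at A p \<Longrightarrow> linear (chart_change_deriv c d p)"
  by (rule has_derivative_linear[OF transition_derivative])

lemma chart_change_self:
  assumes "c \<in> charts_at A p"
  shows "chart_change_deriv c c p y = y"
proof -
  have c: "c \<in> A" "p \<in> fst c" using assms by (auto simp: charts_at_def)
  have "((\<lambda>x. x) has_derivative chart_change_deriv c c p) (at (snd c p))"
    by (rule has_derivative_transform_within_open[OF transition_derivative[OF assms assms] chart_domain(2)[OF c(1)]])
      (use c in \<open>auto simp: chart_inv_chart\<close>)
  then have "chart_change_deriv c c p = (\<lambda>y. y)"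
    by (rule has_derivative_unique[OF _ has_derivative_ident])
  then show ?thesis by simp
qed

lemma chart_change_compose:
  assumes "c \<in> charts_at A p" "d \<in> charts_at A p" "e \<in> charts_at A p"
  shows "chart_change_deriv d e p (chart_change_deriv c d p y) = chart_change_deriv c e p y"
proof -
  have m: "c \<in> A" "p \<in> fst c" "d \<in> A" "p \<in> fst d" "e \<in> A" "p \<in> fst e"
    using assms by (auto simp: charts_at_def)
  have dp: "(snd d \<circ> chart_inv c) (snd c p) = snd d p" using m by (simp add: chart_inv_chart)
  have "(snd e \<circ> chart_inv d has_derivative chart_change_deriv d e p) (at ((snd d \<circ> chart_inv c) (snd c p)))"
    unfolding dp by (rule transition_derivative[OF assms(2,3)])
  from has_derivative_compose[OF transition_derivative[OF assms(1,2)] this]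
  have "((\<lambda>x. (snd e \<circ> chart_inv d) ((snd d \<circ> chart_inv c) x)) has_derivative
      (\<lambda>y. chart_change_deriv d e p (chart_change_deriv c d p y))) (at (snd c p))" .
  then have "((snd e \<circ> chart_inv c) has_derivative
      (\<lambda>y. chart_change_deriv d e p (chart_change_deriv c d p y))) (at (snd c p))"
  proof (rule has_derivative_transform_within_open[OF _ transition_domain_open[OF m(1,3)]])
    fix x assume "x \<in> snd c ` (fst c \<inter> fst d)"
    then show "(snd e \<circ> chart_inv d) ((snd d \<circ> chart_inv c) x) = (snd e \<circ> chart_inv c) x"
      using m by (auto simp: chart_inv_chart)
  qed (use m in auto)
  from fun_cong[OF has_derivative_unique[OF this transition_derivative[OF assms(1,3)]]]
  show ?thesis .
qed

lemma charts_at_topspace: "c \<in> charts_at A p \<Longrightarrow> p \<in> topspace M"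
  using chart_domain(3)[of c] by (auto simp: charts_at_def)

lemma charts_atD: "c \<in> charts_at A p \<Longrightarrow> c \<in> A" "c \<in> charts_at A p \<Longrightarrow> p \<in> fst c"
  by (auto simp: charts_at_def)

lemma chart_at_in: "p \<in> topspace M \<Longrightarrow> chart_at A p \<in> charts_at A p"
proof -
  assume "p \<in> topspace M"
  then have "\<exists>c. c \<in> charts_at A p"
    using manifold unfolding smooth_manifold_def charts_at_def by auto
  then show ?thesis unfolding chart_at_def by (rule someI_ex)
qed

lemma tvec_in:
  assumes "c \<in> charts_at A p"
  shows "tvec A c p y \<in> tangent_space A p"
  unfolding tangent_space_def tvec_def using chart_change_compose[OF assms] by simp

lemma fst_tvec [simp]: "fst (tvec A c p y) = p"
  by (simp add: tvec_def)

lemma snd_tvec: "d \<in> charts_at A p \<Longrightarrow> snd (tvec A c p y) d = chart_change_deriv c d p y"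
  by (simp add: tvec_def)

lemma snd_tvec_self: "c \<in> charts_at A p \<Longrightarrow> snd (tvec A c p y) c = y"
  by (simp add: snd_tvec chart_change_self)

lemma tangent_change:
  "v \<in> tangent_space A p \<Longrightarrow> c \<in> charts_at A p \<Longrightarrow> d \<in> charts_at A p \<Longrightarrow>
    snd v d = chart_change_deriv c d p (snd v c)"
  unfolding tangent_space_def by blast

lemma tangent_fst: "v \<in> tangent_space A p \<Longrightarrow> fst v = p"
  by (simp add: tangent_space_def)

lemma tangent_outside: "v \<in> tangent_space A p \<Longrightarrow> c \<notin> charts_at A p \<Longrightarrow> snd v c = 0"
  unfolding tangent_space_def by blast

lemma tangentI:
  assumes "fst v = p" "\<And>c. c \<notin> charts_at A p \<Longrightarrow> snd v c = 0"
    "\<And>c d. c \<in> charts_at A p \<Longrightarrow> d \<in> charts_at A p \<Longrightarrow> snd v d = chart_change_deriv c d p (snd v c)"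
  shows "v \<in> tangent_space A p"
  unfolding tangent_space_def using assms by blast

lemma tangent_eqI:
  assumes "u \<in> tangent_space A p" "v \<in> tangent_space A p" "c \<in> charts_at A p" "snd u c = snd v c"
  shows "u = v"
proof -
  have "snd u d = snd v d" for d
  proof (cases "d \<in> charts_at A p")
    case True
    then show ?thesis
      using tangent_change[OF assms(1,3)] tangent_change[OF assms(2,3)] assms(4) by simp
  next
    case False
    then show ?thesis using tangent_outside assms(1,2) by metis
  qed
  then show ?thesis using tangent_fst[OF assms(1)] tangent_fst[OF assms(2)] by (simp add: prod_eq_iff fun_eq_iff)
qed

lemma tvec_eq: "v \<in> tangent_space A p \<Longrightarrow> c \<in> charts_at A p \<Longrightarrow> tvec A c p (snd v c) = v"
  by (rule tangent_eqI[OF tvec_in]) (auto simp: snd_tvec_self)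

lemma tvec_change:
  assumes "c \<in> charts_at A p" "d \<in> charts_at A p"
  shows "tvec A d p (chart_change_deriv c d p y) = tvec A c p y"
  using tvec_eq[OF tvec_in[OF assms(1)] assms(2)] assms by (simp add: snd_tvec)

lemma tadd_in:
  assumes "u \<in> tangent_space A p" "v \<in> tangent_space A p"
  shows "tadd u v \<in> tangent_space A p"
proof (rule tangentI)
  fix c d assume "c \<in> charts_at A p" "d \<in> charts_at A p"
  then show "snd (tadd u v) d = chart_change_deriv c d p (snd (tadd u v) c)"
    using tangent_change[OF assms(1), of c d] tangent_change[OF assms(2), of c d]
    by (simp add: tadd_def linear_add[OF linear_chart_change])
qed (simp_all add: tadd_def tangent_fst[OF assms(1)] tangent_outside[OF assms(1)] tangent_outside[OF assms(2)])

lemma tscale_in: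
  assumes "u \<in> tangent_space A p"
  shows "tscale r u \<in> tangent_space A p"
proof (rule tangentI)
  fix c d assume "c \<in> charts_at A p" "d \<in> charts_at A p"
  then show "snd (tscale r u) d = chart_change_deriv c d p (snd (tscale r u) c)"
    using tangent_change[OF assms, of c d] by (simp add: tscale_def linear_cmul[OF linear_chart_change])
qed (simp_all add: tscale_def tangent_fst[OF assms] tangent_outside[OF assms])

lemma tzero_in: "tzero p \<in> tangent_space A p"
  by (rule tangentI) (simp_all add: tzero_def linear_0[OF linear_chart_change])

lemma snd_tadd [simp]: "snd (tadd u v) c = snd u c + snd v c"
  by (simp add: tadd_def)

lemma snd_tscale [simp]: "snd (tscale r u) c = r *\<^sub>R snd u c"
  by (simp add: tscale_def)

lemma snd_tdiff [simp]: "snd (tdiff u v) c = snd u c - snd v c"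
  by (simp add: tdiff_def)

lemma snd_tzero [simp]: "snd (tzero p) c = 0"
  by (simp add: tzero_def)

lemma snd_eq_0_iff: "v \<in> tangent_space A p \<Longrightarrow> c \<in> charts_at A p \<Longrightarrow> snd v c = 0 \<longleftrightarrow> v = tzero p"
  using tangent_eqI[OF _ tzero_in, of v p c] by fastforce

lemma tvec_add: "c \<in> charts_at A p \<Longrightarrow> tvec A c p (x + y) = tadd (tvec A c p x) (tvec A c p y)"
  by (rule tangent_eqI[OF tvec_in tadd_in[OF tvec_in tvec_in]]) (auto simp: snd_tvec_self)

lemma tvec_scale: "c \<in> charts_at A p \<Longrightarrow> tvec A c p (r *\<^sub>R x) = tscale r (tvec A c p x)"
  by (rule tangent_eqI[OF tvec_in tscale_in[OF tvec_in]]) (auto simp: snd_tvec_self)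

end

locale lorentz_finsler_manifold = smooth_atlas M A
  for M :: "'p topology" and A :: "('p, 'm::finite) chart set" +
  fixes L :: "('p, 'm) tangent \<Rightarrow> real"
  assumes finsler: "lorentz_finsler M A L"
begin

lemma homogeneous_L: "v \<in> tangent_bundle M A \<Longrightarrow> r > 0 \<Longrightarrow> L (tscale r v) = r\<^sup>2 * L v"
  using finsler unfolding lorentz_finsler_def by blast

text \<open>Scaling by 2 fixes the zero vector and multiplies L by 4. So vectors with L < 0 are
  nonzero and the smooth part of the structure applies to them.\<close>

lemma L_tzero: "p \<in> topspace M \<Longrightarrow> L (tzero p) = 0"
proof -
  assume "p \<in> topspace M"
  then have "tzero p \<in> tangent_bundle M A" using tzero_in unfolding tangent_bundle_def by blast
  from homogeneous_L[OF this, of 2] show ?thesis by (simp add: tscale_def tzero_def)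
qed

lemma tangent_bundleI: "v \<in> tangent_space A p \<Longrightarrow> c \<in> charts_at A p \<Longrightarrow> v \<in> tangent_bundle M A"
  using charts_at_topspace unfolding tangent_bundle_def by blast

lemma bundle_rep_coords:
  assumes "v \<in> tangent_space A p" "c \<in> charts_at A p"
  shows "bundle_rep A c f (bundle_coords c v) = f v"
proof -
  have "c \<in> A" "p \<in> fst c" using assms(2) by (auto simp: charts_at_def)
  then show ?thesis
    using assms by (simp add: bundle_rep_def bundle_coords_def chart_inv_chart tangent_fst tvec_eq)
qed

lemma bundle_coords_image:
  assumes c: "c \<in> A"
  shows "bundle_coords c ` {v \<in> {v \<in> tangent_bundle M A. v \<noteq> tzero (fst v)}. fst v \<in> fst c} =
    (snd c ` fst c) \<times> (- {0})" (is "?L = ?R")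
proof
  show "?L \<subseteq> ?R"
  proof
    fix z assume "z \<in> ?L"
    then obtain v p where v: "v \<in> tangent_space A p" "v \<noteq> tzero p" "p \<in> fst c" "z = bundle_coords c v"
      unfolding tangent_bundle_def using tangent_fst by blast
    then show "z \<in> ?R"
      using c snd_eq_0_iff[OF v(1), of c] by (auto simp: bundle_coords_def charts_at_def tangent_fst)
  qed
  show "?R \<subseteq> ?L"
  proof
    fix z assume "z \<in> ?R"
    then obtain p y where z: "z = (snd c p, y)" "p \<in> fst c" "y \<noteq> 0" by auto
    have cp: "c \<in> charts_at A p" using c z by (simp add: charts_at_def)
    let ?v = "tvec A c p y"
    have "?v \<in> tangent_bundle M A" by (rule tangent_bundleI[OF tvec_in[OF cp] cp])
    moreover have "?v \<noteq> tzero p" using snd_tvec_self[OF cp, of y] z by auto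
    moreover have "bundle_coords c ?v = z" by (simp add: bundle_coords_def z snd_tvec_self[OF cp])
    ultimately show "z \<in> ?L" using z by (intro image_eqI[of _ _ ?v]) auto
  qed
qed

lemma lf_chart:
  assumes c: "c \<in> A"
  shows "lf_chart (bundle_rep A c L) (snd c ` fst c)"
proof
  show "open (snd c ` fst c)" by (rule chart_domain(2)[OF c])
  then have "open ((snd c ` fst c) \<times> (- {0 :: real ^ 'm}))" by (intro open_Times) auto
  moreover have "smooth_on ((snd c ` fst c) \<times> (- {0})) (bundle_rep A c L)"
    using finsler c unfolding lorentz_finsler_def smooth_on_bundle_def
    by (simp only: bundle_coords_image[OF c, symmetric])
  ultimately show "Cinf_on ((snd c ` fst c) \<times> (- {0})) (bundle_rep A c L)"
    by (simp add: smooth_on_open_iff)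
next
  fix x v and r :: real assume "x \<in> snd c ` fst c" "r > 0"
  then obtain p where p: "x = snd c p" "p \<in> fst c" by auto
  have cp: "c \<in> charts_at A p" using c p by (simp add: charts_at_def)
  show "bundle_rep A c L (x, r *\<^sub>R v) = r\<^sup>2 * bundle_rep A c L (x, v)"
    using homogeneous_L[OF tangent_bundleI[OF tvec_in[OF cp] cp] \<open>r > 0\<close>]
    by (simp add: bundle_rep_def p chart_inv_chart[OF c p(2)] tvec_scale[OF cp])
next
  fix x v assume "x \<in> snd c ` fst c" and v: "v \<noteq> (0 :: real ^ 'm)"
  then obtain p where p: "x = snd c p" "p \<in> fst c" by auto
  have cp: "c \<in> charts_at A p" using c p by (simp add: charts_at_def)
  let ?v = "tvec A c p v"
  have 1: "?v \<in> tangent_bundle M A" by (rule tangent_bundleI[OF tvec_in[OF cp] cp])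
  have 2: "?v \<noteq> tzero (fst ?v)" using snd_tvec_self[OF cp, of v] v by auto
  have "lorentzian_matrix (gmatrix (bundle_rep A c L) (bundle_coords c ?v))"
    using finsler 1 2 cp unfolding lorentz_finsler_def by auto
  then show "lorentzian_matrix (gmatrix (bundle_rep A c L) (x, v))"
    by (simp add: bundle_coords_def p snd_tvec_self[OF cp])
qed

lemma bundle_coords_in:
  assumes "v \<in> tangent_space A p" "v \<noteq> tzero p" "c \<in> charts_at A p"
  shows "bundle_coords c v \<in> (snd c ` fst c) \<times> (- {0})"
  using assms snd_eq_0_iff[OF assms(1,3)]
  by (auto simp: bundle_coords_def charts_at_def tangent_fst)

text \<open>The Legendre transform of \<open>v\<close>; by Euler's identity it represents the
  functional g_v(v, .).\<close>

definition momentum :: "('p, 'm) chart \<Rightarrow> ('p, 'm) tangent \<Rightarrow> real ^ 'm" where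
  "momentum c v = (\<chi> \<beta>. dv \<beta> (bundle_rep A c L) (bundle_coords c v))"

text \<open>The left side differentiates \<open>L\<close> along a line in one tangent space and
  mentions no chart; uniqueness of derivatives then makes the pairing with \<open>w\<close> chart
  independent.\<close>

lemma momentum_derivative:
  assumes v: "v \<in> tangent_space A p" "v \<noteq> tzero p" and w: "w \<in> tangent_space A p"
    and c: "c \<in> charts_at A p"
  shows "((\<lambda>s. L (tadd v (tscale s w))) has_real_derivative (momentum c v \<bullet> snd w c)) (at 0)"
proof -
  have cA: "c \<in> A" using c by (simp add: charts_at_def)
  interpret lf_chart "bundle_rep A c L" "snd c ` fst c" by (rule lf_chart[OF cA])
  let ?z = "\<lambda>s. (snd c p, snd v c + s *\<^sub>R snd w c)"
  have z0: "?z 0 = bundle_coords c v" using v by (simp add: bundle_coords_def tangent_fst)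
  have eq: "L (tadd v (tscale s w)) = bundle_rep A c L (?z s)" for s
    using bundle_rep_coords[OF tadd_in[OF v(1) tscale_in[OF w]] c, of L s] v
    by (simp add: bundle_coords_def tadd_def tscale_def tangent_fst)
  have "(?z has_derivative (\<lambda>h. (0, h *\<^sub>R snd w c))) (at 0)"
    by (auto intro!: derivative_eq_intros)
  moreover have "(bundle_rep A c L has_derivative
      frechet_derivative (bundle_rep A c L) (at (bundle_coords c v))) (at (?z 0))"
    unfolding z0 by (rule Cinf_on_has_derivative[OF smooth_l bundle_coords_in[OF v c]])
  ultimately have "((\<lambda>s. bundle_rep A c L (?z s)) has_derivative
      (\<lambda>h. frechet_derivative (bundle_rep A c L) (at (bundle_coords c v)) (0, h *\<^sub>R snd w c))) (at 0)"
    by (rule has_derivative_compose)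
  moreover have "frechet_derivative (bundle_rep A c L) (at (bundle_coords c v)) (0, h *\<^sub>R snd w c) =
      (momentum c v \<bullet> snd w c) * h" for h
    by (subst frechet_derivative_coords[OF Cinf_on_differentiable[OF smooth_l bundle_coords_in[OF v c]]])
      (simp add: momentum_def inner_vec_def sum_distrib_left mult_ac)
  ultimately show ?thesis
    unfolding eq has_field_derivative_def by (simp only:)
qed

lemma momentum_chart:
  assumes "v \<in> tangent_space A p" "v \<noteq> tzero p" "w \<in> tangent_space A p"
    "c \<in> charts_at A p" "d \<in> charts_at A p"
  shows "momentum c v \<bullet> snd w c = momentum d v \<bullet> snd w d"
  by (rule DERIV_unique[OF momentum_derivative[OF assms(1-4)] momentum_derivative[OF assms(1-3,5)]])

lemma momentum_self:
  assumes "v \<in> tangent_space A p" "v \<noteq> tzero p" "c \<in> charts_at A p"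
  shows "momentum c v \<bullet> snd v c = 2 * L v"
proof -
  have cA: "c \<in> A" using assms by (simp add: charts_at_def)
  interpret lf_chart "bundle_rep A c L" "snd c ` fst c" by (rule lf_chart[OF cA])
  show ?thesis
    using dv_l_contract[OF bundle_coords_in[OF assms]] bundle_rep_coords[OF assms(1,3), of L]
    by (simp add: momentum_def inner_vec_def) (simp add: bundle_coords_def)
qed

text \<open>\<open>gform\<close> is evaluated in one chosen chart. When one argument is the
  reference vector it becomes a momentum pairing, so the normal space can be described in any chart
  without transforming the metric.\<close>

lemma gform_self:
  assumes "v \<in> tangent_space A p" "v \<noteq> tzero p" "w \<in> tangent_space A p" "c \<in> charts_at A p"
  shows "gform A L v v w = momentum c v \<bullet> snd w c"
proof -
  have p: "p \<in> topspace M" using assms(4) by (rule charts_at_topspace)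
  define d where "d = chart_at A p"
  have d: "d \<in> charts_at A p" "d \<in> A" using chart_at_in[OF p] by (auto simp: d_def charts_at_def)
  interpret lf_chart "bundle_rep A d L" "snd d ` fst d" by (rule lf_chart[OF d(2)])
  have "gform A L v v w = (\<Sum>\<beta>\<in>UNIV. (\<Sum>\<alpha>\<in>UNIV. gcoef (bundle_rep A d L) \<alpha> \<beta> (bundle_coords d v) *
      snd v d $ \<alpha>) * snd w d $ \<beta>)"
    unfolding gform_def tangent_fst[OF assms(1)] Let_def d_def[symmetric]
    by (subst sum.swap) (simp add: sum_distrib_right)
  also have "\<dots> = momentum d v \<bullet> snd w d"
    using gcoef_contract[OF bundle_coords_in[OF assms(1,2) d(1)]]
    by (simp add: momentum_def inner_vec_def) (simp add: bundle_coords_def)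
  also have "\<dots> = momentum c v \<bullet> snd w c"
    by (rule momentum_chart[OF assms(1-3) d(1) assms(4)])
  finally show ?thesis .
qed

lemma normal_complement_iff:
  assumes "v \<in> tangent_space A p" "v \<noteq> tzero p" "c \<in> charts_at A p"
  shows "w \<in> normal_complement A L v \<longleftrightarrow> w \<in> tangent_space A p \<and> momentum c v \<bullet> snd w c = 0"
  using gform_self[OF assms(1,2) _ assms(3), of w] tangent_fst[OF assms(1)]
  unfolding normal_complement_def by fastforce

end

section \<open>Fields along a geodesic\<close>

locale finsler_geodesic = lorentz_finsler_manifold M A L
  for M :: "'p topology" and A :: "('p, 'm::finite) chart set" and L :: "('p, 'm) tangent \<Rightarrow> real" +
  fixes X :: "'p \<Rightarrow> ('p, 'm) tangent" and a b :: ereal and \<eta> :: "real \<Rightarrow> 'p"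
  assumes geodesic: "causal_geodesic M A L X a b \<eta>"
begin

abbreviation I :: "real set" where "I \<equiv> einterval a b"

abbreviation vel :: "real \<Rightarrow> ('p, 'm) tangent" where "vel \<equiv> velocity A \<eta>"

definition T :: "('p, 'm) chart \<Rightarrow> real set" where "T c = {t \<in> I. \<eta> t \<in> fst c}"

definition pos :: "('p, 'm) chart \<Rightarrow> real \<Rightarrow> real ^ 'm" where "pos c t = snd c (\<eta> t)"

definition vcoord :: "('p, 'm) chart \<Rightarrow> real \<Rightarrow> real ^ 'm" where "vcoord c t = snd (vel t) c"

definition state :: "('p, 'm) chart \<Rightarrow> real \<Rightarrow> (real ^ 'm) \<times> (real ^ 'm)" where
  "state c t = bundle_coords c (vel t)"

lemma curve: "smooth_curve M A I \<eta>"
  using geodesic unfolding causal_geodesic_def by blast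

lemma eta_in: "t \<in> I \<Longrightarrow> \<eta> t \<in> topspace M"
  using curve unfolding smooth_curve_def continuous_map_def by auto

lemma open_I: "open I"
  by (rule open_einterval)

lemma charts_at_eta: "c \<in> A \<Longrightarrow> t \<in> T c \<Longrightarrow> c \<in> charts_at A (\<eta> t)"
  unfolding T_def charts_at_def by blast

lemma in_T: "t \<in> I \<Longrightarrow> c \<in> charts_at A (\<eta> t) \<Longrightarrow> t \<in> T c"
  unfolding T_def charts_at_def by blast

lemma T_D: "t \<in> T c \<Longrightarrow> t \<in> I"
  unfolding T_def by blast

lemma open_T:
  assumes "c \<in> A"
  shows "open (T c)"
proof -
  have "openin (top_of_set I) {t \<in> topspace (top_of_set I). \<eta> t \<in> fst c}"
    by (rule openin_continuous_map_preimage[OF _ chart_domain(1)[OF assms]])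
      (use curve in \<open>simp add: smooth_curve_def\<close>)
  then show ?thesis using openin_open_trans[OF _ open_I] by (simp add: T_def)
qed

lemma Cinf_pos: "c \<in> A \<Longrightarrow> Cinf_on (T c) (pos c)"
  using curve smooth_on_open_iff[OF open_T] unfolding smooth_curve_def T_def pos_def by blast

lemma vcoord_eq: "c \<in> A \<Longrightarrow> t \<in> T c \<Longrightarrow> vcoord c t = vector_derivative (pos c) (at t)"
  using charts_at_eta[of c t] by (simp add: vcoord_def velocity_def pos_def[abs_def])

lemma Cinf_vcoord:
  assumes "c \<in> A"
  shows "Cinf_on (T c) (vcoord c)"
  using Cinf_on_vector_derivative[OF open_T Cinf_pos, OF assms assms]
  by (simp add: Cinf_on_cong[OF open_T[OF assms], of "vcoord c"] vcoord_eq[OF assms])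

lemma pos_derivative:
  assumes "c \<in> A" "t \<in> T c"
  shows "(pos c has_vector_derivative vcoord c t) (at t)"
  unfolding vcoord_eq[OF assms] by (rule Cinf_on_has_vector_derivative[OF Cinf_pos[OF assms(1)] assms(2)])

lemma velocity_in:
  assumes "t \<in> I"
  shows "vel t \<in> tangent_space A (\<eta> t)"
proof (rule tangentI)
  fix c d assume cd: "c \<in> charts_at A (\<eta> t)" "d \<in> charts_at A (\<eta> t)"
  have c: "c \<in> A" "t \<in> T c" and d: "d \<in> A" "t \<in> T d"
    using cd assms in_T charts_atD(1) by blast+
  have "((snd d \<circ> chart_inv c) has_derivative chart_change_deriv c d (\<eta> t)) (at (pos c t))"
    unfolding pos_def by (rule transition_derivative[OF cd])
  from vector_derivative_diff_chain_within[OF pos_derivative[OF c]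
      has_derivative_at_withinI[OF this]]
  have "((snd d \<circ> chart_inv c) \<circ> pos c has_vector_derivative chart_change_deriv c d (\<eta> t) (vcoord c t)) (at t)" .
  then have "(pos d has_vector_derivative chart_change_deriv c d (\<eta> t) (vcoord c t)) (at t)"
  proof (rule has_vector_derivative_transform_within_open[OF _ open_T[OF c(1)] c(2)])
    fix s assume "s \<in> T c"
    then have "\<eta> s \<in> fst c" by (simp add: T_def)
    then show "((snd d \<circ> chart_inv c) \<circ> pos c) s = pos d s"
      by (simp add: pos_def chart_inv_chart[OF c(1)])
  qed
  then have "vcoord d t = chart_change_deriv c d (\<eta> t) (vcoord c t)"
    using pos_derivative[OF d] vector_derivative_unique_at by blast
  then show "snd (vel t) d = chart_change_deriv c d (\<eta> t) (snd (vel t) c)"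
    by (simp add: vcoord_def)
qed (simp_all add: velocity_def)

lemma fst_velocity [simp]: "fst (vel t) = \<eta> t"
  by (simp add: velocity_def)

lemma velocity_nonzero: "t \<in> I \<Longrightarrow> vel t \<noteq> tzero (\<eta> t)"
  using geodesic L_tzero[OF eta_in, of t]
  by (fastforce simp: causal_geodesic_def causal_def timelike_def lightlike_def)

lemma state_eq: "state c t = (pos c t, vcoord c t)"
  by (simp add: state_def bundle_coords_def pos_def vcoord_def)

lemma Cinf_state: "c \<in> A \<Longrightarrow> Cinf_on (T c) (state c)"
  unfolding state_eq[abs_def] by (intro Cinf_on_Pair open_T Cinf_pos Cinf_vcoord)

lemma state_in:
  assumes "c \<in> A" "t \<in> T c"
  shows "state c t \<in> (snd c ` fst c) \<times> (- {0})"
  unfolding state_def using assms(1)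
  by (intro bundle_coords_in[OF velocity_in velocity_nonzero charts_at_eta] T_D[OF assms(2)] assms)

abbreviation rep :: "('p, 'm) chart \<Rightarrow> (real ^ 'm) \<times> (real ^ 'm) \<Rightarrow> real" where
  "rep c \<equiv> bundle_rep A c L"

definition accel :: "('p, 'm) chart \<Rightarrow> real \<Rightarrow> real ^ 'm" where
  "accel c t = (\<chi> \<alpha>. - 2 * spray (rep c) \<alpha> (state c t))"

lemma vcoord_derivative:
  assumes "c \<in> A" "t \<in> T c"
  shows "(vcoord c has_vector_derivative accel c t) (at t)"
proof -
  have "vector_derivative (\<lambda>s. snd (vel s) c) (at t) $ \<alpha> + 2 * spray (rep c) \<alpha> (state c t) = 0" for \<alpha>
    using geodesic charts_at_eta[OF assms] T_D[OF assms(2)]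
    unfolding causal_geodesic_def state_def by blast
  then have "vector_derivative (vcoord c) (at t) = accel c t"
    by (simp add: vec_eq_iff accel_def vcoord_def[abs_def] eq_neg_iff_add_eq_0)
  then show ?thesis
    using Cinf_on_has_vector_derivative[OF Cinf_vcoord[OF assms(1)] assms(2)] by simp
qed

lemma state_derivative:
  assumes "c \<in> A" "t \<in> T c"
  shows "(state c has_vector_derivative (vcoord c t, accel c t)) (at t)"
  unfolding state_eq[abs_def]
  by (rule has_vector_derivative_Pair[OF pos_derivative vcoord_derivative]) fact+

lemma state_compose_derivative:
  fixes f :: "(real ^ 'm) \<times> (real ^ 'm) \<Rightarrow> real"
  assumes "c \<in> A" "t \<in> T c" "f differentiable (at (state c t))"
  shows "((\<lambda>s. f (state c s)) has_real_derivative
    frechet_derivative f (at (state c t)) (vcoord c t, accel c t)) (at t)"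
proof -
  have "(f has_derivative frechet_derivative f (at (state c t))) (at (state c t))"
    using assms(3) frechet_derivative_works by blast
  from vector_derivative_diff_chain_within[OF state_derivative[OF assms(1,2)]
      has_derivative_at_withinI[OF this]]
  show ?thesis by (simp add: has_real_derivative_iff_has_vector_derivative o_def)
qed

section \<open>Momentum and connection along the geodesic\<close>

definition mom :: "('p, 'm) chart \<Rightarrow> real \<Rightarrow> real ^ 'm" where
  "mom c t = momentum c (vel t)"

definition force :: "('p, 'm) chart \<Rightarrow> real \<Rightarrow> real ^ 'm" where
  "force c t = (\<chi> \<delta>. dx \<delta> (rep c) (state c t))"

lemma mom_nth: "mom c t $ \<delta> = dv \<delta> (rep c) (state c t)"
  by (simp add: mom_def momentum_def state_def)

lemma Cinf_mom:
  assumes c: "c \<in> A"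
  shows "Cinf_on (T c) (mom c)"
proof -
  interpret lf_chart "rep c" "snd c ` fst c" by (rule lf_chart[OF c])
  show ?thesis
  proof (intro Cinf_on_vec open_T c)
    fix i
    show "Cinf_on (T c) (\<lambda>t. mom c t $ i)"
      unfolding mom_nth
      by (rule Cinf_on_compose[OF open_T[OF c] openU _ Cinf_dv[OF smooth_l] Cinf_state[OF c]])
        (use state_in[OF c] in blast)
  qed
qed

text \<open>The Euler-Lagrange equation: the acceleration part of the chain rule is the lowered
  spray, and \<open>spray_lowered\<close> leaves the position derivative of L.\<close>

lemma mom_derivative:
  assumes "c \<in> A" "t \<in> T c"
  shows "(mom c has_vector_derivative force c t) (at t)"
proof (rule has_vector_derivative_vecI)
  fix \<delta>
  interpret lf_chart "rep c" "snd c ` fst c" by (rule lf_chart[OF assms(1)])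
  let ?z = "state c t"
  note z = state_in[OF assms]
  have d: "dv \<delta> (rep c) differentiable (at ?z)"
    by (rule Cinf_on_differentiable[OF Cinf_dv[OF smooth_l] z])
  have "((\<lambda>s. mom c s $ \<delta>) has_real_derivative
      frechet_derivative (dv \<delta> (rep c)) (at ?z) (vcoord c t, accel c t)) (at t)"
    unfolding mom_nth by (rule state_compose_derivative[OF assms d])
  also have "frechet_derivative (dv \<delta> (rep c)) (at ?z) (vcoord c t, accel c t) =
      (\<Sum>\<gamma>\<in>UNIV. dx \<gamma> (dv \<delta> (rep c)) ?z * snd ?z $ \<gamma>) -
      (\<Sum>\<gamma>\<in>UNIV. gcoef (rep c) \<delta> \<gamma> ?z * (2 * spray (rep c) \<gamma> ?z))"
    unfolding frechet_derivative_coords[OF d] gcoef_commute[OF z, of \<delta>]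
    by (simp add: gcoef_def accel_def state_eq sum_negf[symmetric] mult_ac)
  also have "\<dots> = force c t $ \<delta>"
    by (simp add: spray_lowered[OF z] force_def)
  finally show "((\<lambda>s. mom c s $ \<delta>) has_real_derivative force c t $ \<delta>) (at t)" .
qed

text \<open>The matrix to be added to the ordinary derivative of components to obtain the covariant
  derivative with the velocity as reference vector.\<close>

definition conn :: "('p, 'm) chart \<Rightarrow> real \<Rightarrow> real ^ 'm ^ 'm" where
  "conn c t = (\<chi> \<alpha> \<gamma>. \<Sum>\<beta>\<in>UNIV. chern_coef (rep c) \<alpha> \<beta> \<gamma> (state c t) * vcoord c t $ \<beta>)"

lemma conn_nth: "(conn c t *v w) $ \<alpha> =
    (\<Sum>\<beta>\<in>UNIV. \<Sum>\<gamma>\<in>UNIV. chern_coef (rep c) \<alpha> \<beta> \<gamma> (state c t) * vcoord c t $ \<beta> * w $ \<gamma>)"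
  unfolding conn_def matrix_vector_mult_def
  by (subst sum.swap) (simp add: sum_distrib_right)

lemma conn_vcoord:
  assumes "c \<in> A" "t \<in> T c"
  shows "conn c t *v vcoord c t = - accel c t"
proof -
  interpret lf_chart "rep c" "snd c ` fst c" by (rule lf_chart[OF assms(1)])
  show ?thesis
    using chern_contract[OF state_in[OF assms]]
    by (simp add: vec_eq_iff conn_nth accel_def) (simp add: state_eq)
qed

text \<open>Read with \<open>mom_derivative\<close>, this says that the covector \<open>mom\<close>
  is parallel, just as \<open>conn_vcoord\<close> says that the velocity is.\<close>

lemma mom_conn:
  assumes "c \<in> A" "t \<in> T c"
  shows "mom c t \<bullet> (conn c t *v w) = force c t \<bullet> w"
proof -
  interpret lf_chart "rep c" "snd c ` fst c" by (rule lf_chart[OF assms(1)])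
  let ?z = "state c t"
  have "mom c t \<bullet> (conn c t *v w) =
      (\<Sum>\<alpha>\<in>UNIV. \<Sum>\<gamma>\<in>UNIV. dv \<alpha> (rep c) ?z * (\<Sum>\<beta>\<in>UNIV. chern_coef (rep c) \<alpha> \<beta> \<gamma> ?z * snd ?z $ \<beta>) * w $ \<gamma>)"
    by (simp add: inner_vec_def mom_nth conn_def matrix_vector_mult_def sum_distrib_left
        sum_distrib_right mult.assoc) (simp add: state_eq)
  also have "\<dots> = (\<Sum>\<gamma>\<in>UNIV. (\<Sum>\<alpha>\<in>UNIV. dv \<alpha> (rep c) ?z * (\<Sum>\<beta>\<in>UNIV. chern_coef (rep c) \<alpha> \<beta> \<gamma> ?z * snd ?z $ \<beta>)) * w $ \<gamma>)"
    by (subst sum.swap) (simp add: sum_distrib_right)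
  also have "\<dots> = force c t \<bullet> w"
    by (simp add: chern_lowered[OF state_in[OF assms]] force_def inner_vec_def)
  finally show ?thesis .
qed

lemma covderiv_chart:
  assumes "has_covderiv A L \<eta> S Y Z" "t \<in> S" "c \<in> charts_at A (\<eta> t)"
  shows "snd (Z t) c = vector_derivative (\<lambda>s. snd (Y s) c) (at t) + conn c t *v snd (Y t) c"
  using assms unfolding has_covderiv_def by (simp add: vec_eq_iff conn_nth state_def vcoord_def)

lemma covderiv_in: "has_covderiv A L \<eta> S Y Z \<Longrightarrow> t \<in> S \<Longrightarrow> Z t \<in> tangent_space A (\<eta> t)"
  unfolding has_covderiv_def by blast

text \<open>Smooth components are required in every chart that the curve meets, so the Jacobian of
  the transition map has to be smooth along the curve.\<close>

lemma smooth_field_tvec: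
  assumes c: "c \<in> A" and u: "Cinf_on (T c) u"
  shows "smooth_field_along A \<eta> (T c) (\<lambda>t. tvec A c (\<eta> t) (u t))"
  unfolding smooth_field_along_def
proof (intro conjI ballI)
  fix t assume "t \<in> T c"
  then show "tvec A c (\<eta> t) (u t) \<in> tangent_space A (\<eta> t)"
    by (intro tvec_in charts_at_eta[OF c])
next
  fix d assume d: "d \<in> A"
  have S: "{t \<in> T c. \<eta> t \<in> fst d} = T c \<inter> T d" by (auto simp: T_def)
  have oS: "open (T c \<inter> T d)" by (intro open_Int open_T c d)
  let ?W = "snd c ` (fst c \<inter> fst d)" and ?\<phi> = "snd d \<circ> chart_inv c"
  have W: "open ?W" by (rule transition_domain_open[OF c d])
  have p: "Cinf_on (T c \<inter> T d) (pos c)" by (rule Cinf_on_subset[OF Cinf_pos[OF c]]) auto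
  have pW: "pos c ` (T c \<inter> T d) \<subseteq> ?W" by (auto simp: pos_def T_def)
  have "Cinf_on (T c \<inter> T d) (\<lambda>t. \<Sum>i\<in>UNIV. u t $ i *\<^sub>R frechet_derivative ?\<phi> (at (pos c t)) (axis i 1))"
    by (intro Cinf_on_sum oS Cinf_on_scaleR Cinf_on_nth Cinf_on_subset[OF u] Int_lower1
        Cinf_on_compose[OF oS W pW Cinf_on_frechet[OF transition_Cinf[OF c d]] p])
  moreover have "snd (tvec A c (\<eta> t) (u t)) d = (\<Sum>i\<in>UNIV. u t $ i *\<^sub>R frechet_derivative ?\<phi> (at (pos c t)) (axis i 1))"
    if "t \<in> T c \<inter> T d" for t
  proof -
    have ch: "c \<in> charts_at A (\<eta> t)" "d \<in> charts_at A (\<eta> t)" using that c d charts_at_eta by blast+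
    note lin = linear_chart_change[OF ch]
    have "snd (tvec A c (\<eta> t) (u t)) d = chart_change_deriv c d (\<eta> t) (\<Sum>i\<in>UNIV. u t $ i *\<^sub>R axis i 1)"
      using basis_expansion[of "u t"] by (simp add: snd_tvec[OF ch(2)] scalar_mult_eq_scaleR)
    then show ?thesis
      by (simp only: linear_sum[OF lin] linear_cmul[OF lin]) (simp add: chart_change_deriv_def pos_def)
  qed
  ultimately have "Cinf_on (T c \<inter> T d) (\<lambda>t. snd (tvec A c (\<eta> t) (u t)) d)"
    by (subst Cinf_on_cong[OF oS]) auto
  then show "smooth_on {t \<in> T c. \<eta> t \<in> fst d} (\<lambda>t. snd (tvec A c (\<eta> t) (u t)) d)"
    unfolding S smooth_on_open_iff[OF oS] .
qed

end

locale unit_geodesic = lorentz_finsler_manifold M A L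
  for M :: "'p topology" and A :: "('p, 'm::finite) chart set" and L :: "('p, 'm) tangent \<Rightarrow> real" +
  fixes X :: "'p \<Rightarrow> ('p, 'm) tangent" and a b :: ereal and \<eta> :: "real \<Rightarrow> 'p"
  assumes unit_geodesic: "unit_timelike_geodesic M A L X a b \<eta>"

sublocale unit_geodesic \<subseteq> finsler_geodesic
  by unfold_locales (use unit_geodesic in \<open>simp add: unit_timelike_geodesic_def\<close>)

context unit_geodesic
begin

section \<open>Unit speed and the normal projection\<close>

lemma L_velocity: "t \<in> I \<Longrightarrow> L (vel t) = - 1 / 2"
  using unit_geodesic unfolding unit_timelike_geodesic_def finsler_norm_def
  by (force simp: real_sqrt_eq_1_iff)

lemma mom_vcoord:
  assumes "c \<in> A" "t \<in> T c"
  shows "mom c t \<bullet> vcoord c t = -1"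
proof -
  have t: "t \<in> I" using assms T_D by blast
  show ?thesis
    using momentum_self[OF velocity_in[OF t] velocity_nonzero[OF t] charts_at_eta[OF assms]]
    by (simp add: mom_def vcoord_def L_velocity[OF t])
qed

lemma normal_iff:
  assumes "t \<in> T c" "c \<in> A"
  shows "w \<in> normal_complement A L (vel t) \<longleftrightarrow> w \<in> tangent_space A (\<eta> t) \<and> mom c t \<bullet> snd w c = 0"
proof -
  have t: "t \<in> I" using assms T_D by blast
  show ?thesis
    unfolding mom_def
    by (rule normal_complement_iff[OF velocity_in[OF t] velocity_nonzero[OF t] charts_at_eta[OF assms(2,1)]])
qed

text \<open>The sign is plus because the momentum paired with the velocity is -1.\<close>

definition nproj :: "('p, 'm) chart \<Rightarrow> real ^ 'm \<Rightarrow> real \<Rightarrow> real ^ 'm" where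
  "nproj c y t = y + (mom c t \<bullet> y) *\<^sub>R vcoord c t"

text \<open>The test fields for \<open>has_endo_deriv\<close>. That definition ranges over fields on
  open subsets of the interval, so it is enough that these exist while the curve stays in one
  chart.\<close>

definition nfield :: "('p, 'm) chart \<Rightarrow> real ^ 'm \<Rightarrow> real \<Rightarrow> ('p, 'm) tangent" where
  "nfield c y t = tvec A c (\<eta> t) (nproj c y t)"

lemma mom_nproj: "c \<in> A \<Longrightarrow> t \<in> T c \<Longrightarrow> mom c t \<bullet> nproj c y t = 0"
  by (simp add: nproj_def inner_add_right mom_vcoord)

lemma nproj_vcoord: "c \<in> A \<Longrightarrow> t \<in> T c \<Longrightarrow> nproj c (vcoord c t) t = 0"
  by (simp add: nproj_def mom_vcoord)

lemma nproj_normal: "mom c t \<bullet> y = 0 \<Longrightarrow> nproj c y t = y"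
  by (simp add: nproj_def)

lemma Cinf_nproj: "c \<in> A \<Longrightarrow> Cinf_on (T c) (nproj c y)"
  unfolding nproj_def[abs_def]
  by (intro Cinf_on_add Cinf_on_scaleR Cinf_on_const open_T Cinf_on_inner_left Cinf_mom Cinf_vcoord)

lemma snd_nfield: "c \<in> A \<Longrightarrow> t \<in> T c \<Longrightarrow> snd (nfield c y t) c = nproj c y t"
  unfolding nfield_def by (intro snd_tvec_self charts_at_eta)

lemma nfield_normal:
  assumes "c \<in> A" "t \<in> T c"
  shows "nfield c y t \<in> normal_complement A L (vel t)"
  unfolding normal_iff[OF assms(2,1)] snd_nfield[OF assms] mom_nproj[OF assms]
  by (simp add: nfield_def tvec_in[OF charts_at_eta[OF assms]])

lemma smooth_nfield:
  assumes "c \<in> A"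
  shows "smooth_normal_field A L \<eta> (T c) (nfield c y)"
  unfolding smooth_normal_field_def
  using smooth_field_tvec[OF assms Cinf_nproj[OF assms]] nfield_normal[OF assms]
  by (simp add: nfield_def[abs_def])

lemma nproj_derivative:
  assumes "c \<in> A" "t \<in> T c"
  shows "(nproj c y has_vector_derivative
    ((mom c t \<bullet> y) *\<^sub>R accel c t + (force c t \<bullet> y) *\<^sub>R vcoord c t)) (at t)"
proof -
  have "((\<lambda>s. mom c s \<bullet> y) has_real_derivative force c t \<bullet> y) (at t)"
    using bounded_linear.has_vector_derivative[OF bounded_linear_inner_left mom_derivative[OF assms]]
    by (simp add: has_real_derivative_iff_has_vector_derivative)
  from has_vector_derivative_scaleR[OF this vcoord_derivative[OF assms]]
  show ?thesis
    unfolding nproj_def[abs_def] by (rule has_vector_derivative_const[THEN has_vector_derivative_add, THEN has_vector_derivative_eq_rhs]) simp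
qed

text \<open>The normal projection is parallel.\<close>

lemma covderiv_nfield:
  assumes "c \<in> A" "t \<in> T c" "has_covderiv A L \<eta> (T c) (nfield c y) Z"
  shows "Z t = nfield c (conn c t *v y) t"
proof (rule tangent_eqI[OF covderiv_in[OF assms(3,2)] _ charts_at_eta[OF assms(1,2)]])
  show "nfield c (conn c t *v y) t \<in> tangent_space A (\<eta> t)"
    unfolding nfield_def by (rule tvec_in[OF charts_at_eta[OF assms(1,2)]])
  have "((\<lambda>s. snd (nfield c y s) c) has_vector_derivative
    ((mom c t \<bullet> y) *\<^sub>R accel c t + (force c t \<bullet> y) *\<^sub>R vcoord c t)) (at t)"
    by (rule has_vector_derivative_transform_within_open[OF nproj_derivative[OF assms(1,2)] open_T[OF assms(1)] assms(2)])
      (simp add: snd_nfield[OF assms(1)])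
  then have "snd (Z t) c = (mom c t \<bullet> y) *\<^sub>R accel c t + (force c t \<bullet> y) *\<^sub>R vcoord c t + conn c t *v nproj c y t"
    using covderiv_chart[OF assms(3,2) charts_at_eta[OF assms(1,2)]]
    by (simp add: vector_derivative_at snd_nfield[OF assms(1,2)])
  also have "\<dots> = nproj c (conn c t *v y) t"
    by (simp add: nproj_def matrix_vector_right_distrib matrix_vector_mult_scaleR
        conn_vcoord[OF assms(1,2)] mom_conn[OF assms(1,2)])
  finally show "snd (Z t) c = snd (nfield c (conn c t *v y) t) c"
    by (simp add: snd_nfield[OF assms(1,2)])
qed

end

section \<open>Entrywise derivatives of matrices\<close>

definition has_matrix_derivative ::
  "(real \<Rightarrow> real ^ 'n ^ 'm) \<Rightarrow> real ^ 'n ^ 'm \<Rightarrow> real \<Rightarrow> bool" where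
  "has_matrix_derivative F F' t \<longleftrightarrow>
    (\<forall>i j. ((\<lambda>s. F s $ i $ j) has_real_derivative F' $ i $ j) (at t))"

lemma matrix_entry: "(F *v axis j (1::real)) $ i = F $ i $ j"
  by (simp add: matrix_vector_mult_basis column_def)

lemma has_matrix_derivativeI:
  assumes "\<And>y. ((\<lambda>s. F s *v y) has_vector_derivative F' *v y) (at t)"
  shows "has_matrix_derivative F F' t"
  unfolding has_matrix_derivative_def
proof (intro allI)
  fix i j
  show "((\<lambda>s. F s $ i $ j) has_real_derivative F' $ i $ j) (at t)"
    using bounded_linear.has_vector_derivative[OF bounded_linear_vec_nth[of i] assms[of "axis j 1"]]
    by (simp add: has_real_derivative_iff_has_vector_derivative matrix_entry)
qed

lemma has_matrix_derivative_mult: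
  assumes "has_matrix_derivative F F' t" "has_matrix_derivative G G' t"
  shows "has_matrix_derivative (\<lambda>s. F s ** G s) (F' ** G t + F t ** G') t"
  unfolding has_matrix_derivative_def matrix_matrix_mult_def
proof (intro allI)
  fix i j
  have "((\<lambda>s. \<Sum>k\<in>UNIV. F s $ i $ k * G s $ k $ j) has_real_derivative
      (\<Sum>k\<in>UNIV. F t $ i $ k * G' $ k $ j + F' $ i $ k * G t $ k $ j)) (at t)"
    using assms unfolding has_matrix_derivative_def by (intro DERIV_sum DERIV_mult') auto
  then show "((\<lambda>s. (\<chi> i j. \<Sum>k\<in>UNIV. F s $ i $ k * G s $ k $ j) $ i $ j) has_real_derivative
      ((\<chi> i j. \<Sum>k\<in>UNIV. F' $ i $ k * G t $ k $ j) +
       (\<chi> i j. \<Sum>k\<in>UNIV. F t $ i $ k * G' $ k $ j)) $ i $ j) (at t)"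
    by (simp add: sum.distrib add.commute)
qed

lemma has_matrix_derivative_trace:
  assumes "has_matrix_derivative F F' t"
  shows "((\<lambda>s. trace (F s)) has_real_derivative trace F') (at t)"
  using assms unfolding has_matrix_derivative_def trace_def by (intro DERIV_sum) auto

lemma matrix_mult_linear_simps:
  fixes F G H :: "real ^ 'm ^ 'm"
  shows matrix_mult_minus_right: "F ** (- G) = - (F ** G)"
    and matrix_mult_minus_left: "(- F) ** G = - (F ** G)"
    and minus_matrix_vector_mult: "(- F) *v x = - (F *v x)"
    and matrix_mult_diff_right: "F ** (G - H) = F ** G - F ** H"
    and matrix_mult_diff_left: "(F - G) ** H = F ** H - G ** H"
    and matrix_mult_add_left: "(F + G) ** H = F ** H + G ** H"
  by (simp_all add: vec_eq_iff matrix_matrix_mult_def matrix_vector_mult_def sum_negf sum.distrib sum_subtractf algebra_simps)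

text \<open>Cramer's rule guarantees that some derivative exists; differentiating the constant
  product of \<open>F\<close> with its inverse then determines it.\<close>

lemma has_matrix_derivative_inv:
  fixes F :: "real \<Rightarrow> real ^ 'm ^ 'm"
  assumes F: "has_matrix_derivative F F' t"
    and S: "open S" "t \<in> S" "\<And>i j. Cinf_on S (\<lambda>s. F s $ i $ j)" "\<And>s. s \<in> S \<Longrightarrow> det (F s) \<noteq> 0"
  shows "has_matrix_derivative (\<lambda>s. matrix_inv (F s)) (- (matrix_inv (F t) ** F' ** matrix_inv (F t))) t"
proof -
  define G' where "G' = (\<chi> i j. deriv (\<lambda>s. matrix_inv (F s) $ i $ j) t)"
  have G: "has_matrix_derivative (\<lambda>s. matrix_inv (F s)) G' t"
    unfolding has_matrix_derivative_def
  proof (intro allI)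
    fix i j
    have "(\<lambda>s. matrix_inv (F s) $ i $ j) differentiable (at t)"
      by (rule Cinf_on_differentiable[OF Cinf_on_matrix_inv[OF S(1,3,4)] S(2)])
    then show "((\<lambda>s. matrix_inv (F s) $ i $ j) has_real_derivative G' $ i $ j) (at t)"
      by (simp add: G'_def real_differentiableE DERIV_deriv_iff_real_differentiable)
  qed
  have "F' ** matrix_inv (F t) + F t ** G' = 0"
  proof -
    have "(F' ** matrix_inv (F t) + F t ** G') $ i $ j = 0" for i j
    proof -
      have "((\<lambda>s. (F s ** matrix_inv (F s)) $ i $ j) has_real_derivative
          (F' ** matrix_inv (F t) + F t ** G') $ i $ j) (at t)"
        using has_matrix_derivative_mult[OF F G] unfolding has_matrix_derivative_def by blast
      moreover have "((\<lambda>s. (F s ** matrix_inv (F s)) $ i $ j) has_real_derivative 0) (at t)"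
        by (rule has_field_derivative_transform_within_open[OF DERIV_const S(1,2)])
          (simp add: matrix_inv_right_det S(4))
      ultimately show ?thesis by (rule DERIV_unique)
    qed
    then show ?thesis by (simp add: vec_eq_iff)
  qed
  then have "F t ** G' = - (F' ** matrix_inv (F t))" by (simp add: eq_neg_iff_add_eq_0 add.commute)
  then have "matrix_inv (F t) ** (F t ** G') = - (matrix_inv (F t) ** F' ** matrix_inv (F t))"
    by (simp add: matrix_mult_minus_right matrix_mul_assoc)
  then have "G' = - (matrix_inv (F t) ** F' ** matrix_inv (F t))"
    by (simp add: matrix_mul_assoc matrix_inv_left_det S)
  with G show ?thesis by simp
qed

text \<open>For covariantly differentiated \<open>F\<close> and \<open>K\<close> the connection terms cancel under the trace.\<close>

lemma trace_quotient_derivative: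
  fixes F K :: "real \<Rightarrow> real ^ 'm ^ 'm"
  assumes F: "has_matrix_derivative F (K t - C ** F t + F t ** C) t"
    and K: "has_matrix_derivative K (K' - C ** K t + K t ** C) t"
    and S: "open S" "t \<in> S" "\<And>i j. Cinf_on S (\<lambda>s. F s $ i $ j)" "\<And>s. s \<in> S \<Longrightarrow> det (F s) \<noteq> 0"
  shows "((\<lambda>s. trace (K s ** matrix_inv (F s))) has_real_derivative
    trace (K' ** matrix_inv (F t)) - trace ((K t ** matrix_inv (F t)) ** (K t ** matrix_inv (F t)))) (at t)"
proof -
  define G where "G = matrix_inv (F t)"
  have FG: "F t ** G = mat 1" "G ** F t = mat 1"
    using S by (simp_all add: G_def matrix_inv_right_det matrix_inv_left_det)
  have "((\<lambda>s. trace (K s ** matrix_inv (F s))) has_real_derivative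
     trace ((K' - C ** K t + K t ** C) ** G + K t ** - (G ** (K t - C ** F t + F t ** C) ** G))) (at t)"
    unfolding G_def
    by (rule has_matrix_derivative_trace[OF has_matrix_derivative_mult[OF K has_matrix_derivative_inv[OF F S]]])
  also have "(K' - C ** K t + K t ** C) ** G + K t ** - (G ** (K t - C ** F t + F t ** C) ** G) =
     K' ** G - (K t ** G) ** (K t ** G) + ((K t ** G) ** C - C ** (K t ** G))"
  proof -
    have 1: "K t ** (G ** (C ** F t) ** G) = (K t ** G) ** C"
      by (simp add: matrix_mul_assoc[symmetric] FG)
    have 2: "K t ** (G ** (F t ** C) ** G) = K t ** C ** G"
      by (simp add: matrix_mul_assoc FG)
    show ?thesis
      using 1 2 by (simp add: matrix_mult_linear_simps matrix_add_ldistrib matrix_mul_assoc)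
  qed
  also have "trace \<dots> = trace (K' ** G) - trace ((K t ** G) ** (K t ** G))"
    by (simp add: trace_add trace_sub trace_mul_sym[of C])
  finally show ?thesis unfolding G_def .
qed


section \<open>The Riccati inequality\<close>

context unit_geodesic
begin

text \<open>\<open>em c E t\<close> is the matrix, in the chart \<open>c\<close>, of \<open>E t\<close> composed with the normal
  projection, and \<open>jm c J t\<close> is the matrix of the extension of \<open>J t\<close> by the identity on the span of
  the velocity: as the velocity \<open>v\<close> satisfies \<open>g\<^sub>v(v, v) = -1\<close>, the tangential part of \<open>y\<close>
  is \<open>- (mom \<bullet> y) v\<close>. Covariant derivatives become commutators with the connection matrix.\<close>

definition em :: "('p, 'm) chart \<Rightarrow> (real \<Rightarrow> ('p, 'm) tangent \<Rightarrow> ('p, 'm) tangent) \<Rightarrow> real \<Rightarrow> real ^ 'm ^ 'm" where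
  "em c E t = matrix (\<lambda>y. snd (E t (nfield c y t)) c)"

definition jm :: "('p, 'm) chart \<Rightarrow> (real \<Rightarrow> ('p, 'm) tangent \<Rightarrow> ('p, 'm) tangent) \<Rightarrow> real \<Rightarrow> real ^ 'm ^ 'm" where
  "jm c J t = em c J t - (\<chi> i j. vcoord c t $ i * mom c t $ j)"

lemma nfield_add:
  "c \<in> A \<Longrightarrow> t \<in> T c \<Longrightarrow> nfield c (x + y) t = tadd (nfield c x t) (nfield c y t)"
  unfolding nfield_def
  by (simp add: tvec_add[OF charts_at_eta, symmetric] nproj_def inner_add_right scaleR_add_left algebra_simps)

lemma nfield_scale:
  "c \<in> A \<Longrightarrow> t \<in> T c \<Longrightarrow> nfield c (r *\<^sub>R y) t = tscale r (nfield c y t)"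
  unfolding nfield_def
  by (simp add: tvec_scale[OF charts_at_eta, symmetric] nproj_def scaleR_add_right)

lemma nfield_of_normal:
  assumes "c \<in> A" "t \<in> T c" "w \<in> normal_complement A L (vel t)"
  shows "nfield c (snd w c) t = w"
  using assms(3) unfolding normal_iff[OF assms(2,1)] nfield_def
  by (simp add: nproj_normal tvec_eq[OF _ charts_at_eta[OF assms(1,2)]])

lemma endo_field_linear:
  "smooth_endo_field A L \<eta> I E \<Longrightarrow> t \<in> I \<Longrightarrow> tangent_linear_on (normal_complement A L (vel t)) (E t)"
  unfolding smooth_endo_field_def by blast

lemma endo_field_normal:
  "smooth_endo_field A L \<eta> I E \<Longrightarrow> t \<in> I \<Longrightarrow> w \<in> normal_complement A L (vel t) \<Longrightarrow>
    E t w \<in> normal_complement A L (vel t)"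
  using endo_field_linear unfolding tangent_linear_on_def by blast

lemma em_mult:
  assumes E: "smooth_endo_field A L \<eta> I E" and c: "c \<in> A" "t \<in> T c"
  shows "em c E t *v y = snd (E t (nfield c y t)) c"
proof -
  note lin = endo_field_linear[OF E T_D[OF c(2)], unfolded tangent_linear_on_def]
  have "linear (\<lambda>y. snd (E t (nfield c y t)) c)"
  proof (rule linearI)
    fix x y
    show "snd (E t (nfield c (x + y) t)) c = snd (E t (nfield c x t)) c + snd (E t (nfield c y t)) c"
      using lin nfield_normal[OF c] by (simp add: nfield_add[OF c])
  next
    fix r y
    show "snd (E t (nfield c (r *\<^sub>R y) t)) c = r *\<^sub>R snd (E t (nfield c y t)) c"
      using lin nfield_normal[OF c] by (simp add: nfield_scale[OF c])
  qed
  then show ?thesis unfolding em_def by (rule matrix_mult_linear)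
qed

lemma mom_em:
  assumes E: "smooth_endo_field A L \<eta> I E" and c: "c \<in> A" "t \<in> T c"
  shows "mom c t \<bullet> (em c E t *v y) = 0"
  using endo_field_normal[OF E T_D[OF c(2)] nfield_normal[OF c]]
  unfolding em_mult[OF E c] normal_iff[OF c(2,1)] by blast

lemma em_vcoord:
  assumes E: "smooth_endo_field A L \<eta> I E" and c: "c \<in> A" "t \<in> T c"
  shows "em c E t *v vcoord c t = 0"
proof -
  have "nfield c (vcoord c t) t = nfield c 0 t"
    unfolding nfield_def nproj_vcoord[OF c] by (simp add: nproj_def)
  then have "em c E t *v vcoord c t = em c E t *v 0" by (simp only: em_mult[OF E c])
  then show ?thesis by simp
qed

lemma Cinf_em_mult:
  assumes E: "smooth_endo_field A L \<eta> I E" and c: "c \<in> A"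
  shows "Cinf_on (T c) (\<lambda>t. em c E t *v y)"
proof -
  have "smooth_field_along A \<eta> (T c) (\<lambda>t. E t (nfield c y t))"
    using E open_T[OF c] T_D smooth_nfield[OF c] unfolding smooth_endo_field_def by blast
  moreover have "{t \<in> T c. \<eta> t \<in> fst c} = T c" by (auto simp: T_def)
  ultimately have "smooth_on (T c) (\<lambda>t. snd (E t (nfield c y t)) c)"
    using c unfolding smooth_field_along_def by force
  then have "Cinf_on (T c) (\<lambda>t. snd (E t (nfield c y t)) c)"
    by (simp add: smooth_on_open_iff[OF open_T[OF c]])
  then show ?thesis
    by (subst Cinf_on_cong[OF open_T[OF c]]) (simp_all add: em_mult[OF E c])
qed

text \<open>Insert the field \<open>nfield c y\<close> into the product rule defining E'. The
  derivative of E(P) contributes \<open>conn\<close> on the left, and as the projection is parallel,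
  P' is the field of \<open>conn c t *v y\<close>, which contributes \<open>conn\<close> on the
  right.\<close>

lemma em_mult_derivative:
  assumes E: "has_endo_deriv A L \<eta> I E E'" and c: "c \<in> A" "t \<in> T c"
  shows "((\<lambda>s. em c E s *v y) has_vector_derivative
    (em c E' t - conn c t ** em c E t + em c E t ** conn c t) *v y) (at t)"
proof -
  have s: "smooth_endo_field A L \<eta> I E" "smooth_endo_field A L \<eta> I E'"
    using E unfolding has_endo_deriv_def by blast+
  have "T c \<subseteq> I" using T_D by blast
  then obtain P' EP' where P: "has_covderiv A L \<eta> (T c) (nfield c y) P'"
    "has_covderiv A L \<eta> (T c) (\<lambda>t. E t (nfield c y t)) EP'"
    "\<forall>t\<in>T c. E' t (nfield c y t) = tdiff (EP' t) (E t (P' t))"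
    using E open_T[OF c(1)] smooth_nfield[OF c(1), of y] unfolding has_endo_deriv_def by blast
  note ch = charts_at_eta[OF c]
  let ?D = "vector_derivative (\<lambda>s. em c E s *v y) (at t)"
  have D: "((\<lambda>s. em c E s *v y) has_vector_derivative ?D) (at t)"
    by (rule Cinf_on_has_vector_derivative[OF Cinf_em_mult[OF s(1) c(1)] c(2)])
  then have "((\<lambda>s. snd (E s (nfield c y s)) c) has_vector_derivative ?D) (at t)"
    by (rule has_vector_derivative_transform_within_open[OF _ open_T[OF c(1)] c(2)])
      (simp add: em_mult[OF s(1) c(1)])
  then have "snd (EP' t) c = ?D + conn c t *v (em c E t *v y)"
    using covderiv_chart[OF P(2) c(2) ch] by (simp add: vector_derivative_at em_mult[OF s(1) c])
  moreover have "snd (E' t (nfield c y t)) c = snd (EP' t) c - snd (E t (P' t)) c"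
    using P(3) c(2) by simp
  ultimately have "em c E' t *v y = ?D + conn c t *v (em c E t *v y) - em c E t *v (conn c t *v y)"
    unfolding em_mult[OF s(2) c] covderiv_nfield[OF c P(1)] em_mult[OF s(1) c, of "conn c t *v y"]
    by simp
  then have "?D = (em c E' t - conn c t ** em c E t + em c E t ** conn c t) *v y"
    by (simp add: matrix_vector_mult_add_rdistrib matrix_vector_mult_diff_rdistrib matrix_vector_mul_assoc)
  with D show ?thesis by simp
qed

text \<open>Both derivatives enter the same formula for the ordinary derivative of
  \<open>em\<close>. This makes the choice in \<open>endo_deriv\<close> and the witnesses in the
  tensor definitions interchangeable.\<close>

lemma em_deriv_unique:
  assumes "has_endo_deriv A L \<eta> I E E1" "has_endo_deriv A L \<eta> I E E2" and c: "c \<in> A" "t \<in> T c"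
  shows "em c E1 t = em c E2 t"
proof -
  have "em c E1 t *v y = em c E2 t *v y" for y
    using vector_derivative_unique_at[OF em_mult_derivative[OF assms(1) c] em_mult_derivative[OF assms(2) c], of y]
    by (simp add: matrix_vector_mult_add_rdistrib matrix_vector_mult_diff_rdistrib)
  then show ?thesis by (simp add: matrix_eq)
qed

lemma jm_mult: "jm c J t *v y = em c J t *v y - (mom c t \<bullet> y) *\<^sub>R vcoord c t"
proof -
  have "(\<chi> i j. vcoord c t $ i * mom c t $ j) *v y = (mom c t \<bullet> y) *\<^sub>R vcoord c t"
    by (simp add: vec_eq_iff matrix_vector_mult_def inner_vec_def sum_distrib_left sum_distrib_right mult_ac)
  then show ?thesis by (simp add: jm_def matrix_vector_mult_diff_rdistrib)
qed

lemma mom_jm: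
  assumes "smooth_endo_field A L \<eta> I J" "c \<in> A" "t \<in> T c"
  shows "mom c t \<bullet> (jm c J t *v y) = mom c t \<bullet> y"
  by (simp add: jm_mult inner_diff_right mom_em[OF assms] mom_vcoord[OF assms(2,3)])

lemma jm_vcoord:
  assumes "smooth_endo_field A L \<eta> I J" "c \<in> A" "t \<in> T c"
  shows "jm c J t *v vcoord c t = vcoord c t"
  by (simp add: jm_mult em_vcoord[OF assms] mom_vcoord[OF assms(2,3)])

lemma Cinf_jm:
  assumes "smooth_endo_field A L \<eta> I J" "c \<in> A"
  shows "Cinf_on (T c) (\<lambda>t. jm c J t $ i $ j)"
proof -
  have "Cinf_on (T c) (\<lambda>t. (em c J t *v axis j 1 - (mom c t \<bullet> axis j 1) *\<^sub>R vcoord c t) $ i)"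
    by (intro Cinf_on_nth Cinf_on_diff Cinf_on_scaleR open_T Cinf_em_mult assms Cinf_on_inner_left
        Cinf_mom Cinf_vcoord)
  then show ?thesis by (simp only: jm_mult[symmetric] matrix_entry)
qed

text \<open>The added tangential part is the product of \<open>mom\<close> and the velocity, both
  parallel, so it produces only a commutator. Hence the covariant derivative of the extension is
  still \<open>em c J'\<close>, which kills the velocity.\<close>

lemma jm_mult_derivative:
  assumes J: "has_endo_deriv A L \<eta> I J J'" and c: "c \<in> A" "t \<in> T c"
  shows "((\<lambda>s. jm c J s *v y) has_vector_derivative
    (em c J' t - conn c t ** jm c J t + jm c J t ** conn c t) *v y) (at t)"
proof -
  have "((\<lambda>s. em c J s *v y - (nproj c y s - y)) has_vector_derivative
      (em c J' t - conn c t ** em c J t + em c J t ** conn c t) *v y -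
      ((mom c t \<bullet> y) *\<^sub>R accel c t + (force c t \<bullet> y) *\<^sub>R vcoord c t - 0)) (at t)"
    by (intro has_vector_derivative_diff em_mult_derivative[OF J c] nproj_derivative[OF c]
        has_vector_derivative_const)
  moreover have "em c J s *v y - (nproj c y s - y) = jm c J s *v y" for s
    by (simp add: jm_mult nproj_def)
  moreover have "(em c J' t - conn c t ** em c J t + em c J t ** conn c t) *v y -
      ((mom c t \<bullet> y) *\<^sub>R accel c t + (force c t \<bullet> y) *\<^sub>R vcoord c t - 0) =
      (em c J' t - conn c t ** jm c J t + jm c J t ** conn c t) *v y"
    by (simp add: matrix_vector_mult_add_rdistrib matrix_vector_mult_diff_rdistrib
        matrix_vector_mul_assoc[symmetric] jm_mult matrix_vector_mult_diff_distrib
        matrix_vector_mult_scaleR conn_vcoord[OF c] mom_conn[OF c])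
  ultimately show ?thesis by simp
qed

section \<open>Change of chart and the expansion as a matrix trace\<close>

lemma em_chart:
  assumes E: "smooth_endo_field A L \<eta> I E" and c: "c \<in> A" "t \<in> T c" and d: "d \<in> A" "t \<in> T d"
  defines "D \<equiv> chart_change_deriv c d (\<eta> t)"
  shows "em d E t *v D y = D (em c E t *v y)"
    and "jm d E t *v D y = D (jm c E t *v y)"
proof -
  note ch = charts_at_eta[OF c] charts_at_eta[OF d]
  have t: "t \<in> I" using T_D[OF c(2)] .
  have lin: "linear D" unfolding D_def by (rule linear_chart_change[OF ch])
  have vD: "vcoord d t = D (vcoord c t)"
    unfolding vcoord_def D_def by (rule tangent_change[OF velocity_in[OF t] ch])
  have mD: "mom d t \<bullet> D y = mom c t \<bullet> y"
    using momentum_chart[OF velocity_in[OF t] velocity_nonzero[OF t] tvec_in[OF ch(1), of y] ch(2,1)]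
    by (simp add: mom_def D_def snd_tvec ch chart_change_self)
  have "nproj d (D y) t = D (nproj c y t)"
    by (simp add: nproj_def mD vD linear_add[OF lin] linear_cmul[OF lin])
  then have n: "nfield d (D y) t = nfield c y t"
    unfolding nfield_def D_def by (simp add: tvec_change[OF ch])
  have "E t (nfield c y t) \<in> tangent_space A (\<eta> t)"
    using endo_field_normal[OF E t nfield_normal[OF c]] normal_iff[OF c(2,1)] by blast
  then show em: "em d E t *v D y = D (em c E t *v y)"
    unfolding em_mult[OF E c] em_mult[OF E d] n unfolding D_def by (rule tangent_change[OF _ ch])
  show "jm d E t *v D y = D (jm c E t *v y)"
    by (simp add: jm_mult em mD vD linear_diff[OF lin] linear_cmul[OF lin])
qed

text \<open>The matrices in the two charts are conjugate by the Jacobian. This is indispensable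
  because the expansion at parameter s is evaluated in \<open>chart_at A (\<eta> s)\<close>, which
  may jump with s, whereas differentiation needs one chart near the point.\<close>

lemma trace_chart:
  assumes E: "smooth_endo_field A L \<eta> I E" and J: "smooth_endo_field A L \<eta> I J"
    and c: "c \<in> A" "t \<in> T c" and d: "d \<in> A" "t \<in> T d" and det: "det (jm c J t) \<noteq> 0"
  shows "det (jm d J t) \<noteq> 0"
    "trace (em d E t ** matrix_inv (jm d J t)) = trace (em c E t ** matrix_inv (jm c J t))"
proof -
  note ch = charts_at_eta[OF c] charts_at_eta[OF d]
  define D where "D = matrix (chart_change_deriv c d (\<eta> t))"
  define B where "B = matrix (chart_change_deriv d c (\<eta> t))"
  have Dy: "D *v y = chart_change_deriv c d (\<eta> t) y" for y
    unfolding D_def by (rule matrix_mult_linear[OF linear_chart_change[OF ch]])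
  have By: "B *v y = chart_change_deriv d c (\<eta> t) y" for y
    unfolding B_def by (rule matrix_mult_linear[OF linear_chart_change[OF ch(2,1)]])
  have DB: "D ** B = mat 1"
    by (simp add: matrix_eq matrix_vector_mul_assoc[symmetric] Dy By chart_change_compose[OF ch(2,1,2)] chart_change_self[OF ch(2)])
  have BD: "B ** D = mat 1"
    by (simp add: matrix_eq matrix_vector_mul_assoc[symmetric] Dy By chart_change_compose[OF ch(1,2,1)] chart_change_self[OF ch(1)])
  have "jm d J t ** D = D ** jm c J t" and eD: "em d E t ** D = D ** em c E t"
    using em_chart[OF J c d] em_chart[OF E c d]
    by (simp_all add: matrix_eq matrix_vector_mul_assoc[symmetric] Dy)
  then have jD: "jm d J t = D ** jm c J t ** B"
    by (metis DB matrix_mul_assoc matrix_mul_rid)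
  have detD: "det D * det B = 1" using DB by (metis det_I det_mul)
  then show dd: "det (jm d J t) \<noteq> 0"
    using det by (auto simp: jD det_mul)
  let ?Sc = "em c E t ** matrix_inv (jm c J t)" and ?Sd = "em d E t ** matrix_inv (jm d J t)"
  have "jm d J t ** (D ** matrix_inv (jm c J t)) = D ** (jm c J t ** (B ** D) ** matrix_inv (jm c J t))"
    by (simp add: jD matrix_mul_assoc)
  also have "\<dots> = D" by (simp add: BD matrix_inv_right_det[OF det])
  finally have "matrix_inv (jm d J t) ** (jm d J t ** (D ** matrix_inv (jm c J t))) = matrix_inv (jm d J t) ** D"
    by simp
  then have "matrix_inv (jm d J t) ** D = D ** matrix_inv (jm c J t)"
    by (simp add: matrix_mul_assoc matrix_inv_left_det[OF dd])
  then have "?Sd ** D = (em d E t ** D) ** matrix_inv (jm c J t)"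
    by (simp add: matrix_mul_assoc[symmetric])
  then have "?Sd ** D = D ** ?Sc" by (simp add: eD matrix_mul_assoc)
  then have "?Sd ** (D ** B) = D ** ?Sc ** B" by (simp add: matrix_mul_assoc)
  then have "trace ?Sd = trace (D ** (?Sc ** B))" by (simp add: DB matrix_mul_assoc)
  also have "\<dots> = trace (?Sc ** (B ** D))" by (subst trace_mul_sym) (simp add: matrix_mul_assoc)
  finally show "trace ?Sd = trace ?Sc" by (simp add: BD)
qed

lemma chart_at_eta:
  assumes "t \<in> I"
  shows "chart_at A (\<eta> t) \<in> A" "t \<in> T (chart_at A (\<eta> t))"
  using chart_at_in[OF eta_in[OF assms]] in_T[OF assms] charts_atD(1) by blast+

lemma normal_coords_eq:
  assumes "t \<in> I"
  shows "normal_coords A L (vel t) = {y. mom (chart_at A (\<eta> t)) t \<bullet> y = 0}"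
proof -
  note c = chart_at_eta[OF assms]
  let ?c = "chart_at A (\<eta> t)"
  have "y \<in> normal_coords A L (vel t)" if y: "mom ?c t \<bullet> y = 0" for y
  proof -
    have "snd (nfield ?c y t) ?c = y" by (simp add: snd_nfield[OF c] nproj_normal[OF y])
    then show ?thesis
      using nfield_normal[OF c, of y] unfolding normal_coords_def fst_velocity by force
  qed
  then show ?thesis
    unfolding normal_coords_def fst_velocity by (auto simp: normal_iff[OF c(2,1)])
qed

text \<open>\<open>jm\<close> preserves the pairing with the momentum, so its kernel lies in the
  normal space, where it acts as J.\<close>

lemma det_jm_nonzero:
  assumes J: "smooth_endo_field A L \<eta> I J" and t: "t \<in> I"
    and det: "endo_det A L (vel t) (J t) \<noteq> 0"
  shows "det (jm (chart_at A (\<eta> t)) J t) \<noteq> 0"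
  unfolding matrix_det_nonzero_iff
proof (intro allI impI)
  note c = chart_at_eta[OF t]
  let ?c = "chart_at A (\<eta> t)"
  fix y assume y: "jm ?c J t *v y = 0"
  have n: "mom ?c t \<bullet> y = 0" using mom_jm[OF J c, of y] y by simp
  show "y = 0"
  proof (rule det_on_nonzero_imp_inj[where f = "\<lambda>y. em ?c J t *v y"])
    show "det_on (normal_coords A L (vel t)) (endo_coords A (\<eta> t) (J t)) \<noteq> 0"
      using det by (simp add: endo_det_def)
    show "subspace (normal_coords A L (vel t))"
      unfolding normal_coords_eq[OF t] by (rule subspace_hyperplane)
    show "endo_coords A (\<eta> t) (J t) y = em ?c J t *v y" if "y \<in> normal_coords A L (vel t)" for y
      using that unfolding normal_coords_eq[OF t] em_mult[OF J c] endo_coords_def Let_def nfield_def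
      by (simp add: nproj_normal)
  qed (use y n in \<open>auto simp: normal_coords_eq[OF t] mom_em[OF J c] jm_mult\<close>)
qed

text \<open>The definition involves a chosen derivative, a chosen chart, a chosen basis and
  \<open>inv_into\<close>; all are removed here. On the normal space J' J^-1 is given by the matrix
  \<open>S\<close>, and \<open>S\<close> kills the velocity because \<open>jm\<close> and hence its
  inverse fix it.\<close>

lemma expansion_eq:
  assumes J: "has_endo_deriv A L \<eta> I J J'" and c: "c \<in> A" "t \<in> T c" and det: "det (jm c J t) \<noteq> 0"
  shows "expansion A L \<eta> I J t = trace (em c J' t ** matrix_inv (jm c J t))"
proof -
  have t: "t \<in> I" using T_D[OF c(2)] .
  define J1 where "J1 = endo_deriv A L \<eta> I J"
  have J1: "has_endo_deriv A L \<eta> I J J1"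
    using someI[where P = "has_endo_deriv A L \<eta> I J", OF J] by (simp add: J1_def endo_deriv_def)
  have s: "smooth_endo_field A L \<eta> I J" "smooth_endo_field A L \<eta> I J1"
    using J1 unfolding has_endo_deriv_def by blast+
  note d = chart_at_eta[OF t]
  define d where "d = chart_at A (\<eta> t)"
  have dA: "d \<in> A" "t \<in> T d" using d by (simp_all add: d_def)
  note tr = trace_chart[OF s(2,1) c dA det]
  define S where "S = em d J1 t ** matrix_inv (jm d J t)"
  let ?V = "normal_coords A L (vel t)"
  let ?h = "endo_coords A (\<eta> t) (J1 t \<circ> inv_into (normal_complement A L (vel t)) (J t))"
  have V: "?V = {y. mom d t \<bullet> y = 0}" unfolding d_def by (rule normal_coords_eq[OF t])
  have inv: "matrix_inv (jm d J t) *v (jm d J t *v y) = y" "jm d J t *v (matrix_inv (jm d J t) *v y) = y" for y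
    by (simp_all add: matrix_vector_mul_assoc matrix_inv_left_det[OF tr(1)] matrix_inv_right_det[OF tr(1)])
  have Jn: "jm d J t *v snd w d = snd (J t w) d" if w: "w \<in> normal_complement A L (vel t)" for w
    using w by (simp add: jm_mult em_mult[OF s(1) dA] nfield_of_normal[OF dA w] normal_iff[OF dA(2,1)])
  have "trace_on ?V ?h = trace (matrix (\<lambda>y. S *v y))"
  proof (rule trace_on_eq_trace[where v = "vcoord d t"])
    show "subspace ?V" unfolding V by (rule subspace_hyperplane)
    show "vcoord d t \<notin> ?V" by (simp add: V mom_vcoord[OF dA])
    show "span (insert (vcoord d t) ?V) = UNIV"
    proof -
      have "y \<in> span (insert (vcoord d t) ?V)" for y
      proof -
        have "nproj d y t \<in> ?V" by (simp add: V mom_nproj[OF dA])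
        then have "nproj d y t - (mom d t \<bullet> y) *\<^sub>R vcoord d t \<in> span (insert (vcoord d t) ?V)"
          by (intro span_diff span_scale span_base) auto
        then show ?thesis by (simp add: nproj_def)
      qed
      then show ?thesis by blast
    qed
    have "jm d J t *v vcoord d t = vcoord d t" by (rule jm_vcoord[OF s(1) dA])
    then have "matrix_inv (jm d J t) *v vcoord d t = vcoord d t" using inv(1) by metis
    then show "S *v vcoord d t = 0"
      by (simp add: S_def matrix_vector_mul_assoc[symmetric] em_vcoord[OF s(2) dA])
    show "S *v y \<in> ?V" for y
      by (simp add: V S_def matrix_vector_mul_assoc[symmetric] mom_em[OF s(2) dA])
    show "?h y = S *v y" if "y \<in> ?V" for y
    proof -
      define u where "u = matrix_inv (jm d J t) *v y"
      have ju: "jm d J t *v u = y" by (simp add: u_def inv)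
      have mu: "mom d t \<bullet> u = 0" using mom_jm[OF s(1) dA, of u] that by (simp add: ju V)
      define w where "w = nfield d u t"
      have w: "w \<in> normal_complement A L (vel t)" unfolding w_def by (rule nfield_normal[OF dA])
      have wu: "snd w d = u" by (simp add: w_def snd_nfield[OF dA] nproj_normal[OF mu])
      have "J t w \<in> tangent_space A (\<eta> t)"
        using endo_field_normal[OF s(1) t w] normal_iff[OF dA(2,1)] by blast
      then have Jw: "tvec A d (\<eta> t) y = J t w"
        using tvec_eq[OF _ charts_at_eta[OF dA], of "J t w"] Jn[OF w] by (simp add: wu ju)
      have "inj_on (J t) (normal_complement A L (vel t))"
      proof (rule inj_onI)
        fix w1 w2 assume w12: "w1 \<in> normal_complement A L (vel t)" "w2 \<in> normal_complement A L (vel t)"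
          "J t w1 = J t w2"
        then have "jm d J t *v snd w1 d = jm d J t *v snd w2 d" by (simp add: Jn)
        then have "snd w1 d = snd w2 d" using inv(1) by metis
        then show "w1 = w2" using nfield_of_normal[OF dA] w12 by metis
      qed
      then have "inv_into (normal_complement A L (vel t)) (J t) (tvec A d (\<eta> t) y) = w"
        unfolding Jw by (rule inv_into_f_f[OF _ w])
      then have "?h y = snd (J1 t w) d"
        by (simp add: endo_coords_def Let_def d_def[symmetric])
      also have "\<dots> = em d J1 t *v u" by (simp add: em_mult[OF s(2) dA] w_def)
      finally show ?thesis by (simp add: S_def u_def matrix_vector_mul_assoc)
    qed
  qed (rule matrix_vector_mul_linear)
  then have "expansion A L \<eta> I J t = trace S"
    by (simp add: expansion_def endo_trace_def J1_def matrix_of_matrix_vector_mul)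
  also have "\<dots> = trace (em c J1 t ** matrix_inv (jm c J t))" unfolding S_def by (rule tr(2))
  finally show ?thesis by (simp only: em_deriv_unique[OF J1 J c])
qed

section \<open>Symmetry from the Lagrange condition and the Riccati inequality\<close>

lemma gform_chart_at:
  assumes "t \<in> I"
  shows "gform A L (vel t) u w =
    snd u (chart_at A (\<eta> t)) \<bullet> (gmatrix (rep (chart_at A (\<eta> t))) (state (chart_at A (\<eta> t)) t) *v snd w (chart_at A (\<eta> t)))"
  by (simp add: gform_def Let_def state_def gmatrix_def inner_vec_def matrix_vector_mult_def
      sum_distrib_left mult_ac)

text \<open>Moving the transposes to the other side of the metric turns the operator identity into a
  bilinear one, in which no transpose occurs.\<close>

lemma lagrange_symmetric:
  assumes lag: "\<exists>JT J'T. is_transpose A L (vel t) (J t) JT \<and> is_transpose A L (vel t) (J' t) J'T \<and>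
      (\<forall>w\<in>normal_complement A L (vel t). tdiff (J'T (J t w)) (JT (J' t w)) = tzero (\<eta> t))"
    and J: "smooth_endo_field A L \<eta> I J" and J': "smooth_endo_field A L \<eta> I J'" and t: "t \<in> I"
    and u: "u \<in> normal_complement A L (vel t)" and w: "w \<in> normal_complement A L (vel t)"
  shows "gform A L (vel t) (J t w) (J' t u) = gform A L (vel t) (J' t w) (J t u)"
proof -
  obtain JT J'T where T: "is_transpose A L (vel t) (J t) JT" "is_transpose A L (vel t) (J' t) J'T"
      "\<forall>w\<in>normal_complement A L (vel t). tdiff (J'T (J t w)) (JT (J' t w)) = tzero (\<eta> t)"
    using lag by blast
  have "gform A L (vel t) (J t w) (J' t u) = gform A L (vel t) (J'T (J t w)) u"
    using T(2) endo_field_normal[OF J t w] u unfolding is_transpose_def by simp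
  also have "\<dots> = gform A L (vel t) (JT (J' t w)) u"
  proof -
    have "tdiff (J'T (J t w)) (JT (J' t w)) = tzero (\<eta> t)" using T(3) w by blast
    then have "snd (tdiff (J'T (J t w)) (JT (J' t w))) c = 0" for c by simp
    then have "snd (J'T (J t w)) c = snd (JT (J' t w)) c" for c by simp
    then show ?thesis by (simp add: gform_chart_at[OF t])
  qed
  also have "\<dots> = gform A L (vel t) (J' t w) (J t u)"
    using T(1) endo_field_normal[OF J' t w] u unfolding is_transpose_def by simp
  finally show ?thesis .
qed

text \<open>The witness is \<open>r\<close> = -Ric - trace(S S) with S = J' J^-1, so the second
  conclusion is the trace inequality for S. The chart \<open>chart_at A (\<eta> t)\<close> is the
  one used by \<open>ricci\<close>, \<open>curv_op\<close> and \<open>gform\<close> at this point,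
  so none of them has to be transformed.\<close>

lemma riccati:
  assumes J: "has_endo_deriv A L \<eta> I J J'" and J': "has_endo_deriv A L \<eta> I J' J''"
    and jacobi: "\<And>w. w \<in> normal_complement A L (vel t) \<Longrightarrow>
      tadd (J'' t w) (curv_op A L (vel t) (J t w)) = tzero (\<eta> t)"
    and lag: "\<exists>JT J'T. is_transpose A L (vel t) (J t) JT \<and> is_transpose A L (vel t) (J' t) J'T \<and>
      (\<forall>w\<in>normal_complement A L (vel t). tdiff (J'T (J t w)) (JT (J' t w)) = tzero (\<eta> t))"
    and t: "t \<in> I" and det: "det (jm (chart_at A (\<eta> t)) J t) \<noteq> 0"
  obtains r where "(expansion A L \<eta> I J has_real_derivative r) (at t)"
    "(expansion A L \<eta> I J t)\<^sup>2 \<le> (real CARD('m) - 1) * (- ricci A L (vel t) - r)"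
proof -
  define c where "c = chart_at A (\<eta> t)"
  have c: "c \<in> A" "t \<in> T c" using chart_at_eta[OF t] by (simp_all add: c_def)
  note ch = charts_at_eta[OF c]
  interpret lf_chart "rep c" "snd c ` fst c" by (rule lf_chart[OF c(1)])
  have s: "smooth_endo_field A L \<eta> I J" "smooth_endo_field A L \<eta> I J'" "smooth_endo_field A L \<eta> I J''"
    using J J' unfolding has_endo_deriv_def by blast+
  note z = state_in[OF c]
  define F where "F = jm c J t"
  define K where "K = em c J' t"
  define G where "G = matrix_inv F"
  define R where "R = curv_matrix (rep c) (state c t)"
  have detF: "det F \<noteq> 0" using det by (simp add: F_def c_def)
  have FG: "F ** G = mat 1" "G ** F = mat 1"
    using detF by (simp_all add: G_def matrix_inv_right_det matrix_inv_left_det)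
  have Fm: "has_matrix_derivative (jm c J) (em c J' t - conn c t ** jm c J t + jm c J t ** conn c t) t"
    by (rule has_matrix_derivativeI[OF jm_mult_derivative[OF J c]])
  have Km: "has_matrix_derivative (em c J') (em c J'' t - conn c t ** em c J' t + em c J' t ** conn c t) t"
    by (rule has_matrix_derivativeI[OF em_mult_derivative[OF J' c]])
  \<comment> \<open>In the fixed chart the determinant stays nonzero near \<open>t\<close>, so the
    matrix formula for the expansion holds on a neighbourhood and may be differentiated.\<close>
  define W where "W = {s \<in> T c. det (jm c J s) \<noteq> 0}"
  have W: "open W"
  proof -
    have "continuous_on (T c) (\<lambda>s. det (jm c J s))"
      by (rule Cinf_on_continuous[OF Cinf_on_det[OF open_T[OF c(1)] Cinf_jm[OF s(1) c(1)]]])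
    then have "open (T c \<inter> (\<lambda>s. det (jm c J s)) -` (- {0}))"
      using continuous_open_preimage[OF _ open_T[OF c(1)]] by blast
    moreover have "T c \<inter> (\<lambda>s. det (jm c J s)) -` (- {0}) = W" by (auto simp: W_def)
    ultimately show ?thesis by simp
  qed
  have tW: "t \<in> W" using detF c by (simp add: W_def F_def)
  have "((\<lambda>s. trace (em c J' s ** matrix_inv (jm c J s))) has_real_derivative
      trace (em c J'' t ** G) - trace ((K ** G) ** (K ** G))) (at t)"
    unfolding G_def K_def F_def
    by (rule trace_quotient_derivative[OF Fm Km W tW])
      (auto simp: W_def intro: Cinf_on_subset[OF Cinf_jm[OF s(1) c(1)]])
  then have D: "(expansion A L \<eta> I J has_real_derivative
      trace (em c J'' t ** G) - trace ((K ** G) ** (K ** G))) (at t)"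
    by (rule has_field_derivative_transform_within_open[OF _ W tW])
      (simp add: W_def expansion_eq[OF J c(1)])
  have Rv: "R *v vcoord c t = 0"
    using curv_contract[OF z]
    by (simp add: vec_eq_iff R_def curv_matrix_def matrix_vector_mult_def) (simp add: state_eq)
  \<comment> \<open>The Jacobi equation is known for J on normal vectors; since \<open>R\<close>
    kills the velocity it holds with the invertible extension \<open>F\<close> on all vectors, and
    \<open>F\<close> then cancels against \<open>G\<close>.\<close>
  have "em c J'' t *v y = - (R ** F) *v y" for y
  proof -
    let ?w = "nfield c y t"
    have "snd (tadd (J'' t ?w) (curv_op A L (vel t) (J t ?w))) c = 0"
      using jacobi[OF nfield_normal[OF c]] by simp
    then have "snd (J'' t ?w) c + R *v snd (J t ?w) c = 0"
      by (simp add: curv_op_def Let_def c_def[symmetric] snd_tvec_self[OF ch] R_def state_def)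
    then have "em c J'' t *v y = - (R *v (em c J t *v y))"
      by (simp add: em_mult[OF s(3) c] em_mult[OF s(1) c] eq_neg_iff_add_eq_0)
    also have "em c J t *v y = F *v y + (mom c t \<bullet> y) *\<^sub>R vcoord c t"
      by (simp add: F_def jm_mult)
    finally show ?thesis
      by (simp add: matrix_vector_right_distrib matrix_vector_mult_scaleR Rv matrix_vector_mul_assoc
          minus_matrix_vector_mult)
  qed
  then have "em c J'' t = - (R ** F)" by (simp add: matrix_eq)
  then have "em c J'' t ** G = - R"
    by (simp add: matrix_mult_minus_left matrix_mul_assoc[symmetric] FG)
  moreover have "trace (- R) = - trace R" by (simp add: trace_def sum_negf)
  moreover have "trace R = ricci A L (vel t)"
    by (simp add: ricci_def Let_def R_def c_def state_def)
  ultimately have tr1: "trace (em c J'' t ** G) = - ricci A L (vel t)" by simp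
  define g where "g = gmatrix (rep c) (state c t)"
  have lor: "lorentzian_matrix g"
    using lorentzian_l[of "fst (state c t)" "snd (state c t)"] z by (simp add: g_def mem_Times_iff)
  have gv: "g *v vcoord c t = mom c t"
    using gcoef_contract'[OF z]
    by (simp add: vec_eq_iff g_def gmatrix_def matrix_vector_mult_def mom_nth) (simp add: state_eq)
  have gsym: "x \<bullet> (g *v y) = y \<bullet> (g *v x)" for x y
    by (metis dot_lmul_matrix inner_commute lorentzian_symmetric[OF lor] transpose_matrix_vector)
  have gform: "gform A L (vel t) u w = snd u c \<bullet> (g *v snd w c)" for u w
    unfolding g_def c_def by (rule gform_chart_at[OF t])
  \<comment> \<open>The Lagrange condition passes to the extension because the values of
    \<open>K\<close> are normal: the additional tangential terms of \<open>F\<close> are orthogonal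
    to them.\<close>
  have KF: "(K *v x) \<bullet> (g *v (F *v y)) = (F *v x) \<bullet> (g *v (K *v y))" for x y
  proof -
    have 1: "(K *v x) \<bullet> (g *v vcoord c t) = 0" for x
      using mom_em[OF s(2) c, of x] by (simp add: gv K_def inner_commute)
    have Fy: "F *v y = em c J t *v y - (mom c t \<bullet> y) *\<^sub>R vcoord c t" for y
      by (simp add: F_def jm_mult)
    have "(K *v x) \<bullet> (g *v (F *v y)) = (K *v x) \<bullet> (g *v (em c J t *v y))"
      by (simp add: Fy matrix_vector_mult_diff_distrib matrix_vector_mult_scaleR inner_diff_right 1)
    also have "\<dots> = gform A L (vel t) (J' t (nfield c x t)) (J t (nfield c y t))"
      by (simp add: gform K_def em_mult[OF s(1) c] em_mult[OF s(2) c])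
    also have "\<dots> = gform A L (vel t) (J t (nfield c x t)) (J' t (nfield c y t))"
      by (rule lagrange_symmetric[OF lag s(1,2) t nfield_normal[OF c] nfield_normal[OF c], symmetric])
    also have "\<dots> = (em c J t *v x) \<bullet> (g *v (K *v y))"
      by (simp add: gform K_def em_mult[OF s(1) c] em_mult[OF s(2) c])
    also have "\<dots> = (F *v x) \<bullet> (g *v (K *v y))"
      using gsym[of "vcoord c t" "K *v y"] 1[of y] by (simp add: Fy inner_diff_left)
    finally show ?thesis .
  qed
  define S where "S = K ** G"
  have sym: "transpose S ** g = g ** S"
  proof (rule matrix_eq_bilinear)
    fix x y
    have "x \<bullet> ((transpose S ** g) *v y) = (S *v x) \<bullet> (g *v y)"
      by (metis dot_lmul_matrix inner_commute matrix_vector_mul_assoc transpose_matrix_vector)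
    also have "\<dots> = (K *v (G *v x)) \<bullet> (g *v (F *v (G *v y)))"
      by (simp add: S_def matrix_vector_mul_assoc FG)
    also have "\<dots> = (F *v (G *v x)) \<bullet> (g *v (K *v (G *v y)))" by (rule KF)
    also have "\<dots> = x \<bullet> ((g ** S) *v y)" by (simp add: S_def matrix_vector_mul_assoc FG matrix_mul_assoc)
    finally show "x \<bullet> ((transpose S ** g) *v y) = x \<bullet> ((g ** S) *v y)" .
  qed
  have "G *v vcoord c t = G *v (F *v vcoord c t)"
    by (simp add: F_def jm_vcoord[OF s(1) c])
  then have "G *v vcoord c t = vcoord c t" by (simp add: matrix_vector_mul_assoc FG)
  then have Sv: "S *v vcoord c t = 0"
    by (simp add: S_def matrix_vector_mul_assoc[symmetric] K_def em_vcoord[OF s(2) c])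
  have "vcoord c t \<bullet> (g *v vcoord c t) < 0"
    using mom_vcoord[OF c] by (simp add: gv inner_commute)
  from lorentzian_trace_square[OF lor this sym Sv]
  have ineq: "(trace S)\<^sup>2 \<le> (real CARD('m) - 1) * trace (S ** S)" .
  have "expansion A L \<eta> I J t = trace S"
    using expansion_eq[OF J c] detF by (simp add: S_def K_def G_def F_def)
  then show ?thesis using that[OF D] ineq tr1 by (simp add: S_def)
qed

end

section \<open>The weight along geodesics\<close>

context lorentz_finsler_manifold
begin

lemma timelike_nonzero: "p \<in> topspace M \<Longrightarrow> L v < 0 \<Longrightarrow> v \<noteq> tzero p"
  using L_tzero[of p] by auto

text \<open>The open ray through \<open>v\<close> is connected and consists of timelike vectors, so
  it stays in one component.\<close>

lemma future_directed_scale: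
  assumes v: "v \<in> tangent_space A p" "p \<in> topspace M" "L v < 0" and r: "r > 0"
    and f: "future_directed A L X v"
  shows "future_directed A L X (tscale r v)"
proof -
  let ?c = "chart_at A p"
  let ?S = "closure ((\<lambda>u. snd u ?c) ` {u \<in> tangent_space A p. timelike L u}) - {0}"
  note c = chart_at_in[OF v(2)]
  have vc: "snd v ?c \<noteq> 0" using snd_eq_0_iff[OF v(1) c] timelike_nonzero[OF v(2,3)] by simp
  let ?R = "(\<lambda>r. r *\<^sub>R snd v ?c) ` {0<..}"
  have "connected ?R"
    by (rule connected_continuous_image) (auto intro!: continuous_intros convex_connected)
  moreover have "?R \<subseteq> ?S"
  proof
    fix y assume "y \<in> ?R"
    then obtain q where q: "q > 0" "y = snd (tscale q v) ?c" by auto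
    have "L (tscale q v) < 0"
      using homogeneous_L[OF tangent_bundleI[OF v(1) c] q(1)] q v(3) by (simp add: mult_less_0_iff)
    then have "y \<in> (\<lambda>u. snd u ?c) ` {u \<in> tangent_space A p. timelike L u}"
      using tscale_in[OF v(1)] by (intro image_eqI[where x = "tscale q v"]) (simp_all add: timelike_def q(2))
    then have "y \<in> closure ((\<lambda>u. snd u ?c) ` {u \<in> tangent_space A p. timelike L u})"
      by (rule subsetD[OF closure_subset])
    then show "y \<in> ?S" using q vc by simp
  qed
  moreover have "snd v ?c \<in> ?R" by (intro image_eqI[of _ _ 1]) auto
  moreover have "snd (tscale r v) ?c \<in> ?R" using r by (intro image_eqI[of _ _ r]) simp_all
  ultimately have 1: "connected_component ?S (snd v ?c) (snd (tscale r v) ?c)"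
    unfolding connected_component_def by (intro exI[of _ ?R] conjI)
  have 2: "connected_component ?S (snd (X p) ?c) (snd v ?c)"
    using f unfolding future_directed_def Let_def tangent_fst[OF v(1)] .
  have "connected_component ?S (snd (X p) ?c) (snd (tscale r v) ?c)"
    by (rule connected_component_trans[OF 2 1])
  moreover have fst: "fst (tscale r v) = p" using tangent_fst[OF v(1)] by (simp add: tscale_def)
  ultimately show ?thesis unfolding future_directed_def Let_def by (simp only: fst)
qed

lemma weight_domainI:
  assumes v: "v \<in> tangent_space A p" "p \<in> topspace M" "L v < 0" and f: "future_directed A L X v"
  shows "v \<in> weight_domain M A L X"
proof -
  have "v \<in> future_timelike_cone A L X p"
    using v f by (simp add: future_timelike_cone_def timelike_def)
  then have "snd v (chart_at A p) \<in> closure ((\<lambda>u. snd u (chart_at A p)) ` future_timelike_cone A L X p)"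
    by (intro subsetD[OF closure_subset] imageI)
  then have "v \<in> closed_future_cone A L X p"
    using v by (simp add: closed_future_cone_def Let_def)
  then show ?thesis
    using v timelike_nonzero[OF v(2,3)] unfolding weight_domain_def by (intro UN_I[of p]) auto
qed

lemma ricci_scale:
  assumes v: "v \<in> tangent_space A p" "p \<in> topspace M" "v \<noteq> tzero p" and r: "r > 0"
  shows "ricci A L (tscale r v) = r\<^sup>2 * ricci A L v"
proof -
  define c where "c = chart_at A p"
  have c: "c \<in> charts_at A p" "c \<in> A" using chart_at_in[OF v(2)] charts_atD(1)[OF chart_at_in[OF v(2)]] by (simp_all add: c_def)
  interpret lf_chart "bundle_rep A c L" "snd c ` fst c" by (rule lf_chart[OF c(2)])
  have z: "snd c p \<in> snd c ` fst c" "snd v c \<noteq> 0"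
    using bundle_coords_in[OF v(1,3) c(1)] tangent_fst[OF v(1)] by (auto simp: bundle_coords_def)
  have "curv_coef (bundle_rep A c L) \<alpha> \<beta> (snd c p, r *\<^sub>R snd v c) =
      r\<^sup>2 * curv_coef (bundle_rep A c L) \<alpha> \<beta> (snd c p, snd v c)" for \<alpha> \<beta>
    using homogD[OF homog_curv_coef z r] by simp
  moreover have "fst (tscale r v) = p" "fst v = p" using tangent_fst[OF v(1)] by (simp_all add: tscale_def)
  ultimately show ?thesis
    by (simp add: ricci_def Let_def c_def[symmetric] curv_matrix_def trace_def bundle_coords_def
        sum_distrib_left)
qed

end

locale weighted_spacetime = lorentz_finsler_manifold M A L
  for M :: "'p topology" and A :: "('p, 'm::finite) chart set" and L :: "('p, 'm) tangent \<Rightarrow> real" +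
  fixes X :: "'p \<Rightarrow> ('p, 'm) tangent" and \<psi> :: "('p, 'm) tangent \<Rightarrow> real"
  assumes weighted: "weighted_finsler_spacetime M A L X \<psi>"
begin

text \<open>The first two derivatives of the weight along a geodesic only depend on the velocity, since
  the geodesic equation expresses them as derivatives of the weight along the geodesic spray. This
  makes the choice of the geodesic in \<^const>\<open>geodesic_from\<close> irrelevant without
  uniqueness of geodesics.\<close>

lemma weight_jet:
  assumes v: "v \<in> tangent_space A p" "p \<in> topspace M" "L v < 0" and f: "future_directed A L X v"
  shows "\<exists>P Q. \<forall>a b \<eta> t. causal_geodesic M A L X a b \<eta> \<longrightarrow> t \<in> einterval a b \<longrightarrow> velocity A \<eta> t = v \<longrightarrow>
    (weight_along A \<psi> \<eta> has_real_derivative P) (at t) \<and>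
    (deriv (weight_along A \<psi> \<eta>) has_real_derivative Q) (at t)"
proof -
  define c where "c = chart_at A p"
  have c: "c \<in> charts_at A p" "c \<in> A" using chart_at_in[OF v(2)] charts_atD(1)[OF chart_at_in[OF v(2)]] by (simp_all add: c_def)
  interpret lf_chart "bundle_rep A c L" "snd c ` fst c" by (rule lf_chart[OF c(2)])
  define z0 where "z0 = bundle_coords c v"
  let ?Z = "bundle_coords c ` {v \<in> weight_domain M A L X. fst v \<in> fst c}"
  have "z0 \<in> ?Z"
    using weight_domainI[OF v f] charts_atD(2)[OF c(1)] tangent_fst[OF v(1)] by (simp add: z0_def)
  moreover have "smooth_on ?Z (bundle_rep A c \<psi>)"
    using weighted c(2) unfolding weighted_finsler_spacetime_def smooth_on_bundle_def by blast
  ultimately obtain W g where W: "open W" "z0 \<in> W" "\<forall>k. Ck_on k W g" "\<forall>y\<in>?Z \<inter> W. bundle_rep A c \<psi> y = g y"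
    unfolding smooth_on_def by blast
  \<comment> \<open>The extension \<open>g\<close> is known to agree with the weight on the weight
    domain only, which need not be open. Restricting to nonzero timelike vectors suffices: the
    future-directed velocities among them lie in that domain.\<close>
  define S where "S = W \<inter> (U \<inter> bundle_rep A c L -` {..<0})"
  have S: "open S"
    unfolding S_def
    by (rule open_Int[OF W(1) continuous_open_preimage[OF Cinf_on_continuous[OF smooth_l] openU open_lessThan]])
  have zS: "z0 \<in> S"
    using W(2) bundle_coords_in[OF v(1) timelike_nonzero[OF v(2,3)] c(1)] bundle_rep_coords[OF v(1) c(1), of L] v(3)
    by (auto simp: S_def z0_def)
  have g: "Cinf_on S g"
  proof (rule Cinf_on_subset[of W])
    show "Cinf_on W g" using W(3) by (simp add: Cinf_on_def)
  qed (simp add: S_def)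
  \<comment> \<open>The geodesic spray applied to \<open>g\<close>; applying it once more to
    \<open>H\<close> gives the second derivative \<open>Q\<close>.\<close>
  define H where "H z = (\<Sum>\<alpha>\<in>UNIV. snd z $ \<alpha> * dx \<alpha> g z) +
    (\<Sum>\<alpha>\<in>UNIV. (- 2 * spray (bundle_rep A c L) \<alpha> z) * dv \<alpha> g z)" for z
  have SU: "S \<subseteq> U" unfolding S_def by blast
  have H: "Cinf_on S H"
    unfolding H_def[abs_def] dx_def dv_def
    by (intro Cinf_on_add Cinf_on_sum Cinf_on_mult S Cinf_on_const Cinf_on_frechet g
        Cinf_on_subset[OF Cinf_snd_nth SU] Cinf_on_subset[OF Cinf_spray SU])
  define Q where "Q = frechet_derivative H (at z0) (snd z0, \<chi> \<alpha>. - 2 * spray (bundle_rep A c L) \<alpha> z0)"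
  have "(weight_along A \<psi> \<eta> has_real_derivative H z0) (at t) \<and>
    (deriv (weight_along A \<psi> \<eta>) has_real_derivative Q) (at t)"
    if geo: "causal_geodesic M A L X a b \<eta>" and t: "t \<in> einterval a b" and vel: "velocity A \<eta> t = v" for a b \<eta> t
  proof -
    interpret G: finsler_geodesic M A L X a b \<eta> by unfold_locales (rule geo)
    have "\<eta> t = p" using tangent_fst[OF v(1)] G.fst_velocity[of t] by (simp add: vel)
    then have tc: "t \<in> G.T c" using G.in_T[OF t] c by simp
    have z0: "G.state c t = z0" by (simp add: G.state_def vel z0_def)
    define B where "B = G.T c \<inter> G.state c -` S"
    have B: "open B"
      unfolding B_def
      by (rule continuous_open_preimage[OF Cinf_on_continuous[OF G.Cinf_state[OF c(2)]] G.open_T[OF c(2)] S])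
    have tB: "t \<in> B" using tc zS by (simp add: B_def z0)
    have w: "weight_along A \<psi> \<eta> s = g (G.state c s)" if s: "s \<in> B" for s
    proof -
      have sT: "s \<in> G.T c" and sS: "G.state c s \<in> S" using s by (auto simp: B_def)
      note sI = G.T_D[OF sT]
      note ch = G.charts_at_eta[OF c(2) sT]
      have "L (velocity A \<eta> s) < 0"
        using sS bundle_rep_coords[OF G.velocity_in[OF sI] ch, of L] by (simp add: S_def G.state_def)
      moreover have "future_directed A L X (velocity A \<eta> s)"
        using geo sI unfolding causal_geodesic_def by blast
      ultimately have "velocity A \<eta> s \<in> weight_domain M A L X"
        by (rule weight_domainI[OF G.velocity_in[OF sI] G.eta_in[OF sI]])
      then have "G.state c s \<in> ?Z"
        using charts_atD(2)[OF ch] by (simp add: G.state_def)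
      then have "bundle_rep A c \<psi> (G.state c s) = g (G.state c s)"
        using W(4) sS by (auto simp: S_def)
      then show ?thesis
        using bundle_rep_coords[OF G.velocity_in[OF sI] ch, of \<psi>] by (simp add: G.state_def weight_along_def)
    qed
    have d: "(weight_along A \<psi> \<eta> has_real_derivative H (G.state c s)) (at s)" if s: "s \<in> B" for s
    proof -
      have sT: "s \<in> G.T c" and sS: "G.state c s \<in> S" using s by (auto simp: B_def)
      note gd = Cinf_on_differentiable[OF g sS]
      have "((\<lambda>s. g (G.state c s)) has_real_derivative H (G.state c s)) (at s)"
        using G.state_compose_derivative[OF c(2) sT gd]
        unfolding frechet_derivative_coords[OF gd] by (simp add: H_def G.accel_def G.state_eq)
      then show ?thesis
        by (rule has_field_derivative_transform_within_open[OF _ B s]) (simp add: w)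
    qed
    have "((\<lambda>s. H (G.state c s)) has_real_derivative Q) (at t)"
    proof -
      have "snd z0 = G.vcoord c t" by (simp add: z0[symmetric] G.state_eq)
      then show ?thesis
        using G.state_compose_derivative[OF c(2) tc, of H] Cinf_on_differentiable[OF H zS] z0
        by (simp add: Q_def G.accel_def)
    qed
    then have "(deriv (weight_along A \<psi> \<eta>) has_real_derivative Q) (at t)"
      by (rule has_field_derivative_transform_within_open[OF _ B tB]) (simp add: DERIV_imp_deriv[OF d])
    with d[OF tB] z0 show ?thesis by simp
  qed
  then show ?thesis by blast
qed

end

section \<open>The weight along a rescaled geodesic\<close>

locale weighted_unit_geodesic = unit_geodesic M A L X a b \<eta> + weighted_spacetime M A L X \<psi>
  for M :: "'p topology" and A :: "('p, 'm::finite) chart set" and L X a b \<eta> \<psi>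
begin

lemma L_velocity_neg: "t \<in> I \<Longrightarrow> L (vel t) < 0"
  by (simp add: L_velocity)

lemma future_velocity: "t \<in> I \<Longrightarrow> future_directed A L X (vel t)"
  using geodesic unfolding causal_geodesic_def by blast

abbreviation w :: "real \<Rightarrow> real" where "w \<equiv> weight_along A \<psi> \<eta>"

lemma weight_derivatives:
  assumes "t \<in> I"
  shows "(w has_real_derivative deriv w t) (at t)" "(deriv w has_real_derivative deriv (deriv w) t) (at t)"
proof -
  obtain P Q where "\<forall>a b \<xi> s. causal_geodesic M A L X a b \<xi> \<longrightarrow> s \<in> einterval a b \<longrightarrow> velocity A \<xi> s = vel t \<longrightarrow>
    (weight_along A \<psi> \<xi> has_real_derivative P) (at s) \<and> (deriv (weight_along A \<psi> \<xi>) has_real_derivative Q) (at s)"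
    using weight_jet[OF velocity_in[OF assms] eta_in[OF assms] L_velocity_neg[OF assms] future_velocity[OF assms]]
    by (elim exE)
  from this[rule_format, OF geodesic assms refl]
  have "(w has_real_derivative P) (at t)" "(deriv w has_real_derivative Q) (at t)" by simp_all
  then show "(w has_real_derivative deriv w t) (at t)" "(deriv w has_real_derivative deriv (deriv w) t) (at t)"
    using DERIV_imp_deriv by metis+
qed

lemma weight_scale: "t \<in> I \<Longrightarrow> r > 0 \<Longrightarrow> \<psi> (tscale r (vel t)) = w t"
proof -
  assume t: "t \<in> I" and r: "r > 0"
  have "vel t \<in> weight_domain M A L X"
    by (rule weight_domainI[OF velocity_in eta_in L_velocity_neg future_velocity]) (rule t)+
  then show ?thesis
    using weighted r unfolding weighted_finsler_spacetime_def weight_along_def by blast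
qed

text \<open>The interval is shrunk so that its endpoints are real numbers.\<close>

lemma rescaled_geodesic:
  assumes t: "t \<in> I" and r: "r > 0"
  defines "\<zeta> \<equiv> \<lambda>u. \<eta> (t + r * u)"
  obtains q where "q > 0" "causal_geodesic M A L X (ereal (- q)) (ereal q) \<zeta>"
    "\<And>u. \<bar>u\<bar> < q \<Longrightarrow> t + r * u \<in> I" "\<And>u. \<bar>u\<bar> < q \<Longrightarrow> velocity A \<zeta> u = tscale r (vel (t + r * u))"
proof -
  obtain e where e: "e > 0" "ball t e \<subseteq> I" using open_I t openE by blast
  define q where "q = e / r"
  have q: "q > 0" using e r by (simp add: q_def)
  have inI: "t + r * u \<in> I" if "\<bar>u\<bar> < q" for u
  proof -
    have "\<bar>r * u\<bar> < e" using that r by (simp add: q_def abs_mult field_simps)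
    then show ?thesis using e(2) by (auto simp: dist_real_def)
  qed
  have J: "einterval (ereal (- q)) (ereal q) = {u. \<bar>u\<bar> < q}" by (auto simp: einterval_def)
  have pd: "((\<lambda>u. snd c (\<zeta> u)) has_vector_derivative r *\<^sub>R vcoord c (t + r * u)) (at u)"
    if "c \<in> A" "t + r * u \<in> T c" for c u
  proof -
    have "((\<lambda>u. t + r * u) has_vector_derivative r) (at u)"
      by (auto intro!: derivative_eq_intros)
    from vector_diff_chain_at[OF this, of "pos c"] pos_derivative[OF that]
    show ?thesis by (simp add: o_def pos_def[abs_def] \<zeta>_def)
  qed
  have vel: "velocity A \<zeta> u = tscale r (vel (t + r * u))" if u: "t + r * u \<in> I" for u
  proof -
    have "vector_derivative (\<lambda>s. snd c (\<zeta> s)) (at u) = r *\<^sub>R snd (vel (t + r * u)) c"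
      if "c \<in> charts_at A (\<zeta> u)" for c
      using vector_derivative_at[OF pd] that in_T[OF u] charts_atD(1)[OF that]
      by (simp add: \<zeta>_def vcoord_def)
    then show ?thesis
      by (auto simp: velocity_def tscale_def \<zeta>_def fun_eq_iff)
  qed
  have "causal_geodesic M A L X (ereal (- q)) (ereal q) \<zeta>"
    unfolding causal_geodesic_def J
  proof (intro conjI ballI allI)
    show "smooth_curve M A {u. \<bar>u\<bar> < q} \<zeta>"
      unfolding smooth_curve_def
    proof (intro conjI ballI)
      have "continuous_map (top_of_set {u. \<bar>u\<bar> < q}) (top_of_set I) (\<lambda>u. t + r * u)"
        using inI by (auto intro!: continuous_intros)
      moreover have "continuous_map (top_of_set I) M \<eta>" using curve by (simp add: smooth_curve_def)
      ultimately have "continuous_map (top_of_set {u. \<bar>u\<bar> < q}) M (\<eta> \<circ> (\<lambda>u. t + r * u))"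
        by (rule continuous_map_compose)
      then show "continuous_map (top_of_set {u. \<bar>u\<bar> < q}) M \<zeta>" by (simp add: o_def \<zeta>_def)
    next
      fix c assume c: "c \<in> A"
      let ?S = "{u \<in> {u. \<bar>u\<bar> < q}. \<zeta> u \<in> fst c}"
      have S: "?S = {u. \<bar>u\<bar> < q} \<inter> (\<lambda>u. t + r * u) -` T c"
        using inI by (auto simp: T_def \<zeta>_def)
      have oJ: "open {u. \<bar>u\<bar> < q}" unfolding J[symmetric] by (rule open_einterval)
      have oS: "open ?S"
        unfolding S by (intro continuous_open_preimage continuous_intros oJ open_T c)
      have "Cinf_on ?S (\<lambda>u. pos c (t + r * u))"
      proof (rule Cinf_on_compose[OF oS open_T[OF c] _ Cinf_pos[OF c]])
        show "(\<lambda>u. t + r * u) ` ?S \<subseteq> T c" using S by blast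
        show "Cinf_on ?S (\<lambda>u. t + r * u)"
          by (intro Cinf_on_add Cinf_on_mult Cinf_on_const Cinf_on_ident oS)
      qed
      then show "smooth_on ?S (\<lambda>u. snd c (\<zeta> u))"
        unfolding smooth_on_open_iff[OF oS] by (simp add: pos_def \<zeta>_def)
    qed
  next
    fix u assume "u \<in> {u. \<bar>u\<bar> < q}"
    then have u: "t + r * u \<in> I" using inI by simp
    have "L (velocity A \<zeta> u) < 0"
      unfolding vel[OF u]
      using homogeneous_L[OF tangent_bundleI[OF velocity_in[OF u] chart_at_in[OF eta_in[OF u]]] r] r
      by (simp add: L_velocity[OF u])
    then show "causal L (velocity A \<zeta> u)" by (simp add: causal_def timelike_def)
    show "future_directed A L X (velocity A \<zeta> u)"
      unfolding vel[OF u]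
      by (rule future_directed_scale[OF velocity_in eta_in L_velocity_neg r future_velocity]) (rule u)+
    fix c \<alpha> assume "c \<in> charts_at A (\<zeta> u)"
    then have c: "c \<in> A" "t + r * u \<in> T c"
      using in_T[OF u] charts_atD(1) unfolding \<zeta>_def by blast+
    interpret lf_chart "rep c" "snd c ` fst c" by (rule lf_chart[OF c(1)])
    have preT: "open ((\<lambda>u. t + r * u) -` T c)"
      by (intro open_vimage open_T c continuous_intros)
    have acc: "((\<lambda>s. r *\<^sub>R vcoord c (t + r * s)) has_vector_derivative r *\<^sub>R r *\<^sub>R accel c (t + r * u)) (at u)"
    proof -
      have "((\<lambda>u. t + r * u) has_vector_derivative r) (at u)"
        by (auto intro!: derivative_eq_intros)
      from vector_diff_chain_at[OF this, of "vcoord c"] vcoord_derivative[OF c]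
      have "((\<lambda>s. vcoord c (t + r * s)) has_vector_derivative r *\<^sub>R accel c (t + r * u)) (at u)"
        by (simp add: o_def)
      then show ?thesis
        by (rule bounded_linear.has_vector_derivative[OF bounded_linear_scaleR_right])
    qed
    have "((\<lambda>s. snd (velocity A \<zeta> s) c) has_vector_derivative r *\<^sub>R r *\<^sub>R accel c (t + r * u)) (at u)"
      by (rule has_vector_derivative_transform_within_open[OF acc preT])
        (use c in \<open>simp_all add: vel[OF T_D] vcoord_def\<close>)
    then have 1: "vector_derivative (\<lambda>s. snd (velocity A \<zeta> s) c) (at u) = r *\<^sub>R r *\<^sub>R accel c (t + r * u)"
      by (rule vector_derivative_at)
    have z: "pos c (t + r * u) \<in> snd c ` fst c" "vcoord c (t + r * u) \<noteq> 0"
      using state_in[OF c] by (auto simp: state_eq)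
    have "bundle_coords c (velocity A \<zeta> u) = (pos c (t + r * u), r *\<^sub>R vcoord c (t + r * u))"
      by (simp add: vel[OF u] bundle_coords_def pos_def vcoord_def) (simp add: tscale_def)
    \<comment> \<open>Degree two of the spray matches the two factors \<open>r\<close> that the
      chain rule puts on the acceleration.\<close>
    then have 2: "spray (rep c) \<alpha> (bundle_coords c (velocity A \<zeta> u)) = r\<^sup>2 * spray (rep c) \<alpha> (state c (t + r * u))"
      using homogD[OF homog_spray z r, of \<alpha>] by (simp add: state_eq)
    show "vector_derivative (\<lambda>s. snd (velocity A \<zeta> s) c) (at u) $ \<alpha> +
        2 * spray (rep c) \<alpha> (bundle_coords c (velocity A \<zeta> u)) = 0"
      unfolding 1 2 by (simp add: accel_def power2_eq_square)
  qed
  then show ?thesis by (rule that[OF q _ inI vel[OF inI]])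
qed

text \<open>The chosen geodesic and the rescaled curve \<open>\<zeta>\<close> start with the same
  velocity, so \<open>weight_jet\<close> gives their weights the same two derivatives. Along
  \<open>\<zeta>\<close> the weight is \<open>w\<close> at \<open>t + r * u\<close>, since \<psi> is
  homogeneous of degree zero, and the chain rule finishes.\<close>

lemma geodesic_from_weight:
  assumes t: "t \<in> I" and r: "r > 0"
  defines "f \<equiv> weight_along A \<psi> (geodesic_from M A L X (tscale r (vel t)))"
  shows "deriv f 0 = r * deriv w t" "deriv (deriv f) 0 = r\<^sup>2 * deriv (deriv w) t"
proof -
  define \<zeta> where "\<zeta> = (\<lambda>u. \<eta> (t + r * u))"
  obtain q where q: "q > 0" "causal_geodesic M A L X (ereal (- q)) (ereal q) \<zeta>"
    "\<And>u. \<bar>u\<bar> < q \<Longrightarrow> t + r * u \<in> I" "\<And>u. \<bar>u\<bar> < q \<Longrightarrow> velocity A \<zeta> u = tscale r (vel (t + r * u))"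
    by (rule rescaled_geodesic[OF t r, folded \<zeta>_def]) (rule that)
  let ?v = "tscale r (vel t)"
  have v0: "velocity A \<zeta> 0 = ?v" using q(4)[of 0] q(1) by simp
  have "\<exists>\<xi> a b. a < 0 \<and> 0 < b \<and> causal_geodesic M A L X a b \<xi> \<and> velocity A \<xi> 0 = ?v"
    using q(1,2) v0 by (intro exI[of _ \<zeta>] exI[of _ "ereal (- q)"] exI[of _ "ereal q"]) auto
  then have "\<exists>a b. a < 0 \<and> 0 < b \<and> causal_geodesic M A L X a b (geodesic_from M A L X ?v) \<and>
      velocity A (geodesic_from M A L X ?v) 0 = ?v"
    unfolding geodesic_from_def by (rule someI_ex)
  then obtain a' b' where ab: "a' < 0" "0 < b'" "causal_geodesic M A L X a' b' (geodesic_from M A L X ?v)"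
      "velocity A (geodesic_from M A L X ?v) 0 = ?v" by blast
  have vin: "?v \<in> tangent_space A (\<eta> t)" by (rule tscale_in[OF velocity_in[OF t]])
  have Lv: "L ?v < 0"
    using homogeneous_L[OF tangent_bundleI[OF velocity_in[OF t] chart_at_in[OF eta_in[OF t]]] r] r
    by (simp add: L_velocity[OF t])
  have fv: "future_directed A L X ?v"
    by (rule future_directed_scale[OF velocity_in eta_in L_velocity_neg r future_velocity]) (rule t)+
  obtain P Q where "\<forall>a b \<xi> s. causal_geodesic M A L X a b \<xi> \<longrightarrow> s \<in> einterval a b \<longrightarrow> velocity A \<xi> s = ?v \<longrightarrow>
    (weight_along A \<psi> \<xi> has_real_derivative P) (at s) \<and> (deriv (weight_along A \<psi> \<xi>) has_real_derivative Q) (at s)"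
    using weight_jet[OF vin eta_in[OF t] Lv fv] by (elim exE)
  note PQ = this[rule_format]
  have "0 \<in> einterval a' b'" using ab by (simp add: einterval_def zero_ereal_def[symmetric])
  note fPQ = PQ[OF ab(3) this ab(4)]
  have f: "deriv f 0 = P" "deriv (deriv f) 0 = Q"
    unfolding f_def by (rule DERIV_imp_deriv[OF conjunct1[OF fPQ]], rule DERIV_imp_deriv[OF conjunct2[OF fPQ]])
  let ?h = "weight_along A \<psi> \<zeta>"
  have "0 \<in> einterval (ereal (- q)) (ereal q)" using q(1) by (simp add: einterval_def)
  note hPQ = PQ[OF q(2) this v0]
  have h: "deriv ?h 0 = P" "deriv (deriv ?h) 0 = Q"
    by (rule DERIV_imp_deriv[OF conjunct1[OF hPQ]], rule DERIV_imp_deriv[OF conjunct2[OF hPQ]])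
  have hw: "?h u = w (t + r * u)" if "\<bar>u\<bar> < q" for u
    using weight_scale[OF q(3)[OF that] r] by (simp add: weight_along_def[of A \<psi> \<zeta>] q(4)[OF that])
  have oq: "open {u. \<bar>u\<bar> < q}"
  proof -
    have "einterval (ereal (- q)) (ereal q) = {u. \<bar>u\<bar> < q}" by (auto simp: einterval_def)
    then show ?thesis using open_einterval[of "ereal (- q)" "ereal q"] by simp
  qed
  have aff: "((\<lambda>u. t + r * u) has_real_derivative r) (at u)" for u
    by (auto intro!: derivative_eq_intros)
  have d1: "(?h has_real_derivative r * deriv w (t + r * u)) (at u)" if u: "\<bar>u\<bar> < q" for u
  proof -
    have "((\<lambda>u. w (t + r * u)) has_real_derivative deriv w (t + r * u) * r) (at u)"
      by (rule DERIV_chain2[OF weight_derivatives(1)[OF q(3)[OF u]] aff])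
    then have "(?h has_real_derivative deriv w (t + r * u) * r) (at u)"
      by (rule has_field_derivative_transform_within_open[OF _ oq]) (use u in \<open>auto simp: hw\<close>)
    then show ?thesis by (simp add: mult.commute)
  qed
  have "((\<lambda>u. r * deriv w (t + r * u)) has_real_derivative r * (deriv (deriv w) (t + r * 0) * r)) (at 0)"
    by (rule DERIV_cmult, rule DERIV_chain2[OF weight_derivatives(2)[OF q(3)] aff]) (use q(1) in simp)
  then have "(deriv ?h has_real_derivative r * (deriv (deriv w) (t + r * 0) * r)) (at 0)"
    by (rule has_field_derivative_transform_within_open[OF _ oq])
      (use q(1) in \<open>simp_all add: DERIV_imp_deriv[OF d1]\<close>)
  then have d2: "(deriv ?h has_real_derivative r * (deriv (deriv w) t * r)) (at 0)" by simp
  show "deriv f 0 = r * deriv w t"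
    using DERIV_imp_deriv[OF d1, of 0] q(1) by (simp add: f h)
  show "deriv (deriv f) 0 = r\<^sup>2 * deriv (deriv w) t"
    using DERIV_imp_deriv[OF d2] by (simp add: f h power2_eq_square mult_ac)
qed

text \<open>Every term carries the factor \<open>r\<^sup>2\<close>, so nonnegativity passes to the
  unit velocity. In the case N = n, nonnegativity excludes the value minus infinity and so forces
  the derivative of the weight to vanish.\<close>

lemma weighted_ricci_scale:
  assumes t: "t \<in> I" and r: "r > 0" and nonneg: "weighted_ricci M A L X \<psi> n N (tscale r (vel t)) \<ge> 0"
  shows "N = \<infinity> \<Longrightarrow> ricci A L (vel t) + deriv (deriv w) t \<ge> 0"
    and "N = ereal (real n) \<Longrightarrow> deriv w t = 0 \<and> ricci A L (vel t) + deriv (deriv w) t \<ge> 0"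
    and "N \<noteq> \<infinity> \<Longrightarrow> N \<noteq> ereal (real n) \<Longrightarrow>
      ricci A L (vel t) + deriv (deriv w) t - (deriv w t)\<^sup>2 / (real_of_ereal N - real n) \<ge> 0"
proof -
  have ric: "ricci A L (tscale r (vel t)) = r\<^sup>2 * ricci A L (vel t)"
    by (rule ricci_scale[OF velocity_in eta_in velocity_nonzero r]) (rule t)+
  note nn = nonneg[unfolded weighted_ricci_def Let_def geodesic_from_weight[OF t r] ric]
  have r2: "r\<^sup>2 > 0" using r by simp
  have pos: "x \<ge> 0" if "r\<^sup>2 * x \<ge> 0" for x using that r2 by (simp add: zero_le_mult_iff)
  show "ricci A L (vel t) + deriv (deriv w) t \<ge> 0" if "N = \<infinity>"
    by (rule pos) (use nn that in \<open>simp add: distrib_left\<close>)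
  show "deriv w t = 0 \<and> ricci A L (vel t) + deriv (deriv w) t \<ge> 0" if N: "N = ereal (real n)"
  proof -
    have "deriv w t = 0" using nn N r by (auto split: if_splits)
    moreover have "ricci A L (vel t) + deriv (deriv w) t \<ge> 0"
      by (rule pos) (use nn N \<open>deriv w t = 0\<close> in \<open>simp add: distrib_left\<close>)
    ultimately show ?thesis ..
  qed
  show "ricci A L (vel t) + deriv (deriv w) t - (deriv w t)\<^sup>2 / (real_of_ereal N - real n) \<ge> 0"
    if "N \<noteq> \<infinity>" "N \<noteq> ereal (real n)"
    by (rule pos) (use nn that in \<open>simp add: distrib_left right_diff_distrib power_mult_distrib\<close>)
qed

end

section \<open>Comparison\<close>

text \<open>\<open>f\<close> is nonincreasing, so a negative value at the left end stays negative to
  the right and a positive value at the right end stays positive to the left. In both cases the sign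
  of 1/f at the opposite end makes the inequality strict.\<close>

lemma riccati_blow_up:
  fixes f \<tau> \<tau>' :: "real \<Rightarrow> real"
  assumes ab: "a \<le> b" and c: "c > 0"
    and f: "\<And>t. t \<in> {a..b} \<Longrightarrow> \<exists>y. (f has_real_derivative y) (at t) \<and> y \<le> - c * (f t)\<^sup>2 * \<tau>' t"
    and \<tau>: "\<And>t. t \<in> {a..b} \<Longrightarrow> (\<tau> has_real_derivative \<tau>' t) (at t)" "\<And>t. t \<in> {a..b} \<Longrightarrow> \<tau>' t > 0"
  shows "f a < 0 \<Longrightarrow> c * (\<tau> b - \<tau> a) < - 1 / f a" and "f b > 0 \<Longrightarrow> c * (\<tau> b - \<tau> a) < 1 / f b"
proof -
  have decr: "f t \<le> f s" if "s \<in> {a..b}" "t \<in> {a..b}" "s \<le> t" for s t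
  proof (rule DERIV_nonpos_imp_nonincreasing[OF that(3)])
    fix x assume "s \<le> x" "x \<le> t"
    then have x: "x \<in> {a..b}" using that by auto
    then obtain y where y: "(f has_real_derivative y) (at x)" "y \<le> - c * (f x)\<^sup>2 * \<tau>' x"
      using f by blast
    have "c * (f x)\<^sup>2 * \<tau>' x \<ge> 0" using c \<tau>(2)[OF x] by simp
    with y show "\<exists>y. (f has_real_derivative y) (at x) \<and> y \<le> 0" by (intro exI[of _ y]) auto
  qed
  have main: "1 / f a - c * \<tau> a \<le> 1 / f b - c * \<tau> b" if nz: "\<And>t. t \<in> {a..b} \<Longrightarrow> f t \<noteq> 0"
  proof (rule DERIV_nonneg_imp_nondecreasing[OF ab])
    fix x assume "a \<le> x" "x \<le> b"
    then have x: "x \<in> {a..b}" by auto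
    then obtain y where y: "(f has_real_derivative y) (at x)" "y \<le> - c * (f x)\<^sup>2 * \<tau>' x"
      using f by blast
    have "((\<lambda>t. 1 / f t - c * \<tau> t) has_real_derivative (- y / (f x)\<^sup>2 - c * \<tau>' x)) (at x)"
      using nz[OF x] by (auto intro!: derivative_eq_intros y(1) \<tau>(1)[OF x] simp: power2_eq_square)
    moreover have "- y / (f x)\<^sup>2 - c * \<tau>' x \<ge> 0"
      using y(2) nz[OF x] by (simp add: field_simps)
    ultimately show "\<exists>y. ((\<lambda>t. 1 / f t - c * \<tau> t) has_real_derivative y) (at x) \<and> y \<ge> 0" by blast
  qed
  show "c * (\<tau> b - \<tau> a) < - 1 / f a" if fa: "f a < 0"
  proof -
    have neg: "f t < 0" if "t \<in> {a..b}" for t using decr[of a t] that fa ab by auto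
    have "1 / f b < 0" using neg[of b] ab by simp
    moreover have "1 / f a - c * \<tau> a \<le> 1 / f b - c * \<tau> b" by (rule main) (use neg in force)
    moreover have "- 1 / f a = - (1 / f a)" by simp
    ultimately show ?thesis unfolding right_diff_distrib by linarith
  qed
  show "c * (\<tau> b - \<tau> a) < 1 / f b" if fb: "f b > 0"
  proof -
    have pos: "f t > 0" if "t \<in> {a..b}" for t using decr[of t b] that fb ab by auto
    have "1 / f a > 0" using pos[of a] ab by simp
    moreover have "1 / f a - c * \<tau> a \<le> 1 / f b - c * \<tau> b" by (rule main) (use pos in force)
    ultimately show ?thesis unfolding right_diff_distrib by linarith
  qed
qed

section \<open>Positivity of the constant and the quadratic estimate\<close>

lemma einterval_between: "s \<in> einterval a b \<Longrightarrow> u \<in> einterval a b \<Longrightarrow> s \<le> t \<Longrightarrow> t \<le> u \<Longrightarrow> t \<in> einterval a b"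
  unfolding einterval_def
  by (auto intro: less_le_trans[of a "ereal s" "ereal t"] le_less_trans[of "ereal t" "ereal u" b])

lemma eps_const_pos:
  assumes n: "n > 0" and N: "(N \<noteq> -\<infinity> \<and> N \<le> 0) \<or> ereal (real n) \<le> N" and \<epsilon>: "eps_admissible n N \<epsilon>"
  shows "eps_const n N \<epsilon> > 0"
proof (cases N)
  case PInf
  have "\<bar>\<epsilon>\<bar> < 1" using \<epsilon> PInf by (simp add: eps_admissible_def)
  then have "\<epsilon>\<^sup>2 < 1" by (simp add: abs_square_less_1)
  then show ?thesis using n PInf by (simp add: eps_const_def)
next
  case MInf
  then show ?thesis using N by simp
next
  case (real k)
  show ?thesis
  proof (cases "k = 0 \<or> k = real n")
    case True
    then show ?thesis using n real by (auto simp: eps_const_def)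
  next
    case False
    have k: "k < 0 \<or> k > real n" using N False real by auto
    have q: "k / (k - real n) > 0" using k n by (auto simp: zero_less_divide_iff)
    have "\<bar>\<epsilon>\<bar> < sqrt (k / (k - real n))" using \<epsilon> real False by (auto simp: eps_admissible_def zero_ereal_def)
    then have "\<epsilon>\<^sup>2 < k / (k - real n)"
      using real_sqrt_less_iff[of "\<epsilon>\<^sup>2" "k / (k - real n)"] by simp
    then have "\<epsilon>\<^sup>2 * ((k - real n) / k) < 1"
      using q k by (auto simp: field_simps)
    then show ?thesis using n real False by (simp add: eps_const_def zero_ereal_def)
  qed
qed

text \<open>After completing the square, the terms in the derivative \<open>y\<close> of the weight leave the square
  \<open>(q y + \<epsilon> x)\<^sup>2 / q\<close>, where \<open>q = N / (N - n)\<close>.\<close>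

lemma eps_quadratic_bound:
  fixes x y r ric w'' :: real
  assumes n: "n > 0" and N: "(N \<noteq> -\<infinity> \<and> N \<le> 0) \<or> ereal (real n) \<le> N" and \<epsilon>: "eps_admissible n N \<epsilon>"
    and r: "(x + y)\<^sup>2 \<le> real n * (- ric - r)"
    and ric: "N = \<infinity> \<Longrightarrow> ric + w'' \<ge> 0" "N = ereal (real n) \<Longrightarrow> y = 0 \<and> ric + w'' \<ge> 0"
      "N \<noteq> \<infinity> \<Longrightarrow> N \<noteq> ereal (real n) \<Longrightarrow> ric + w'' - y\<^sup>2 / (real_of_ereal N - real n) \<ge> 0"
  shows "r - w'' + 2 * (1 - \<epsilon>) / real n * y * x \<le> - eps_const n N \<epsilon> * x\<^sup>2"
proof -
  have n0: "real n > 0" using n by simp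
  \<comment> \<open>The factor \<open>n\<close> clears the denominators, and the trace inequality
    leaves a quadratic form in \<open>x\<close> and \<open>y\<close> together with the Ricci
    term.\<close>
  have main: "real n * (r - w'' + 2 * (1 - \<epsilon>) / real n * y * x) \<le>
      - (x + y)\<^sup>2 - real n * (ric + w'') + 2 * (1 - \<epsilon>) * y * x"
  proof -
    have "real n * (r - w'' + 2 * (1 - \<epsilon>) / real n * y * x) = real n * r - real n * w'' + 2 * (1 - \<epsilon>) * y * x"
      using n0 by (simp add: field_simps)
    then show ?thesis using r by (simp add: right_diff_distrib distrib_left)
  qed
  have fin: ?thesis if "- (x + y)\<^sup>2 - real n * (ric + w'') + 2 * (1 - \<epsilon>) * y * x \<le> - (real n * eps_const n N \<epsilon>) * x\<^sup>2"
  proof -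
    have "real n * (r - w'' + 2 * (1 - \<epsilon>) / real n * y * x) \<le> real n * (- eps_const n N \<epsilon> * x\<^sup>2)"
      using main that by (simp add: mult.assoc)
    then show ?thesis using n0 by (simp only: mult_le_cancel_left_pos)
  qed
  show ?thesis
  proof (cases N)
    case MInf
    then show ?thesis using N by simp
  next
    case PInf
    have c: "real n * eps_const n N \<epsilon> = 1 - \<epsilon>\<^sup>2" using n0 PInf by (simp add: eps_const_def)
    have "real n * (ric + w'') \<ge> 0" using ric(1)[OF PInf] by simp
    \<comment> \<open>The limit case q = 1 of the general square.\<close>
    moreover have "(y + \<epsilon> * x)\<^sup>2 \<ge> 0" by simp
    ultimately show ?thesis
      by (intro fin) (simp add: c power2_eq_square algebra_simps)
  next
    case (real k)
    show ?thesis
    proof (cases "k = real n")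
      case True
      have c: "real n * eps_const n N \<epsilon> = 1" using n0 True real by (simp add: eps_const_def zero_ereal_def)
      \<comment> \<open>Without \<open>y\<close> there is no mixed term, hence no restriction on
        \<open>\<epsilon>\<close>.\<close>
      have "y = 0" "real n * (ric + w'') \<ge> 0" using ric(2) True real by auto
      then show ?thesis by (intro fin) (simp add: c)
    next
      case False
      have ric': "ric + w'' \<ge> y\<^sup>2 / (k - real n)" using ric(3) False real by auto
      then have R: "real n * (ric + w'') \<ge> real n * (y\<^sup>2 / (k - real n))"
        using n0 by (intro mult_left_mono) auto
      show ?thesis
      proof (cases "k = 0")
        case True
        have c: "real n * eps_const n N 0 = 1" "\<epsilon> = 0"
          using n0 True real \<epsilon> by (auto simp: eps_const_def eps_admissible_def zero_ereal_def)
        \<comment> \<open>The Ricci bound cancels the \<open>y\<^sup>2\<close> coming from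
          \<open>(x + y)\<^sup>2\<close>; only \<open>\<epsilon> = 0\<close> removes the remaining
          mixed term.\<close>
        have "real n * (y\<^sup>2 / (k - real n)) = - y\<^sup>2" using n0 True by simp
        then show ?thesis using R
          by (intro fin) (simp add: c power2_eq_square algebra_simps)
      next
        case k0: False
        have k: "k < 0 \<or> k > real n" using N False k0 real by auto
        define q where "q = k / (k - real n)"
        have q: "q > 0" using k n by (auto simp: q_def zero_less_divide_iff)
        have c: "real n * eps_const n N \<epsilon> = 1 - \<epsilon>\<^sup>2 / q"
          using n0 k0 real by (simp add: eps_const_def q_def zero_ereal_def)
        \<comment> \<open>This rests on n / (k - n) = q - 1. Together with the
          \<open>y\<^sup>2\<close> of the trace inequality the total coefficient becomes -q, the one
          needed for the square below.\<close>
        have yq: "real n * (y\<^sup>2 / (k - real n)) = q * y\<^sup>2 - y\<^sup>2"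
          using False by (simp add: q_def field_simps)
        have "(q * y + \<epsilon> * x)\<^sup>2 / q \<ge> 0" using q by simp
        moreover have "(q * y + \<epsilon> * x)\<^sup>2 / q = q * y\<^sup>2 + 2 * \<epsilon> * x * y + \<epsilon>\<^sup>2 / q * x\<^sup>2"
          using q by (simp add: power2_eq_square field_simps)
        ultimately have "0 \<le> q * y\<^sup>2 + 2 * \<epsilon> * x * y + \<epsilon>\<^sup>2 / q * x\<^sup>2" by simp
        then show ?thesis using R unfolding yq
          by (intro fin) (simp add: c power2_eq_square algebra_simps)
      qed
    qed
  qed
qed

section \<open>The differential inequality for the expansion with respect to the new proper
  time\<close>

context unit_geodesic
begin

text \<open>The Jacobi and the Lagrange condition each bind their own derivative of J; this
  identifies the two on normal vectors.\<close>

lemma endo_deriv_unique: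
  assumes E: "has_endo_deriv A L \<eta> I E E1" "has_endo_deriv A L \<eta> I E E2" and t: "t \<in> I"
    and w: "w \<in> normal_complement A L (vel t)"
  shows "E1 t w = E2 t w"
proof -
  define c where "c = chart_at A (\<eta> t)"
  have c: "c \<in> A" "t \<in> T c" using chart_at_eta[OF t] by (simp_all add: c_def)
  have s: "smooth_endo_field A L \<eta> I E1" "smooth_endo_field A L \<eta> I E2"
    using E unfolding has_endo_deriv_def by blast+
  have "snd (E1 t w) c = em c E1 t *v snd w c" "snd (E2 t w) c = em c E2 t *v snd w c"
    by (simp_all add: em_mult[OF s(1) c] em_mult[OF s(2) c] nfield_of_normal[OF c w])
  then have eq: "snd (E1 t w) c = snd (E2 t w) c" by (simp add: em_deriv_unique[OF E c])
  have "E1 t w \<in> tangent_space A (\<eta> t)" "E2 t w \<in> tangent_space A (\<eta> t)"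
    using endo_field_normal[OF s(1) t w] endo_field_normal[OF s(2) t w] normal_iff[OF c(2,1)] by blast+
  then show ?thesis by (rule tangent_eqI[OF _ _ charts_at_eta[OF c] eq])
qed

lemma lagrange_riccati:
  assumes J: "lagrange_tensor_field A L \<eta> I J" and t: "t \<in> I" and det: "endo_det A L (vel t) (J t) \<noteq> 0"
  obtains r where "(expansion A L \<eta> I J has_real_derivative r) (at t)"
    "(expansion A L \<eta> I J t)\<^sup>2 \<le> (real CARD('m) - 1) * (- ricci A L (vel t) - r)"
proof -
  obtain J' J'' where J': "has_endo_deriv A L \<eta> I J J'" "has_endo_deriv A L \<eta> I J' J''"
    and jac: "\<forall>t\<in>I. \<forall>w\<in>normal_complement A L (vel t).
       tadd (J'' t w) (curv_op A L (vel t) (J t w)) = tzero (\<eta> t) \<and>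
       (J t w = tzero (\<eta> t) \<and> J' t w = tzero (\<eta> t) \<longrightarrow> w = tzero (\<eta> t))"
    using J unfolding lagrange_tensor_field_def jacobi_tensor_field_def by (elim conjE exE)
  obtain J1 where J1: "has_endo_deriv A L \<eta> I J J1"
    and lag: "\<forall>t\<in>I. \<exists>JT J'T. is_transpose A L (vel t) (J t) JT \<and> is_transpose A L (vel t) (J1 t) J'T \<and>
           (\<forall>w\<in>normal_complement A L (vel t). tdiff (J'T (J t w)) (JT (J1 t w)) = tzero (\<eta> t))"
    using J unfolding lagrange_tensor_field_def by (elim conjE exE)
  have eq: "J1 t w = J' t w" if "w \<in> normal_complement A L (vel t)" for w
    by (rule endo_deriv_unique[OF J1 J'(1) t that])
  have "is_transpose A L (vel t) (J1 t) S \<longleftrightarrow> is_transpose A L (vel t) (J' t) S" for S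
    unfolding is_transpose_def using eq by (auto simp del: split_paired_All)
  then have lag': "\<exists>JT J'T. is_transpose A L (vel t) (J t) JT \<and> is_transpose A L (vel t) (J' t) J'T \<and>
           (\<forall>w\<in>normal_complement A L (vel t). tdiff (J'T (J t w)) (JT (J' t w)) = tzero (\<eta> t))"
    using bspec[OF lag t] by (simp add: eq cong: ball_cong)
  have s: "smooth_endo_field A L \<eta> I J" using J'(1) unfolding has_endo_deriv_def by blast
  show ?thesis
  proof (rule riccati[OF J' _ lag' t det_jm_nonzero[OF s t det]])
    show "tadd (J'' t w) (curv_op A L (vel t) (J t w)) = tzero (\<eta> t)"
      if "w \<in> normal_complement A L (vel t)" for w
      using jac t that by blast
  qed (rule that)
qed

end

context weighted_unit_geodesic
begin

text \<open>The product rule gives the exponential factor times r - w'' + k w' x, which is the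
  expression estimated by \<open>eps_quadratic_bound\<close> with y = w'.\<close>

lemma eps_expansion_riccati:
  assumes dim: "CARD('m) = n + 1" "n > 0"
    and N: "(N \<noteq> -\<infinity> \<and> N \<le> 0) \<or> ereal (real n) \<le> N" and \<epsilon>: "eps_admissible n N \<epsilon>"
    and J: "lagrange_tensor_field A L \<eta> I J" and t: "t \<in> I" and det: "endo_det A L (vel t) (J t) \<noteq> 0"
    and ric: "weighted_ricci M A L X \<psi> n N (eps_velocity A \<psi> n \<epsilon> \<eta> t) \<ge> 0"
  shows "\<exists>y. (eps_expansion A L \<psi> n \<epsilon> \<eta> I J has_real_derivative y) (at t) \<and>
    y \<le> - eps_const n N \<epsilon> * (eps_expansion A L \<psi> n \<epsilon> \<eta> I J t)\<^sup>2 * exp (2 * (\<epsilon> - 1) / real n * w t)"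
proof -
  define k where "k = 2 * (1 - \<epsilon>) / real n"
  define x where "x = expansion A L \<eta> I J t - deriv w t"
  let ?c = "eps_const n N \<epsilon>" and ?E = "exp (k * w t)"
  obtain r where r: "(expansion A L \<eta> I J has_real_derivative r) (at t)"
    "(expansion A L \<eta> I J t)\<^sup>2 \<le> (real CARD('m) - 1) * (- ricci A L (vel t) - r)"
    by (rule lagrange_riccati[OF J t det]) (rule that)
  have r2: "(x + deriv w t)\<^sup>2 \<le> real n * (- ricci A L (vel t) - r)"
    using r(2) dim by (simp add: x_def)
  note ricci = weighted_ricci_scale[OF t exp_gt_zero ric[unfolded eps_velocity_def]]
  have bound: "r - deriv (deriv w) t + k * deriv w t * x \<le> - ?c * x\<^sup>2"
    unfolding k_def by (rule eps_quadratic_bound[OF dim(2) N \<epsilon> r2 ricci])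
  have "((\<lambda>s. exp (k * w s) * (expansion A L \<eta> I J s - deriv w s)) has_real_derivative
      ?E * (r - deriv (deriv w) t + k * deriv w t * x)) (at t)"
    by (auto intro!: derivative_eq_intros r(1) weight_derivatives[OF t] simp: x_def algebra_simps)
  then have "(eps_expansion A L \<psi> n \<epsilon> \<eta> I J has_real_derivative
      ?E * (r - deriv (deriv w) t + k * deriv w t * x)) (at t)"
    by (simp add: eps_expansion_def[abs_def] k_def)
  moreover have "?E * (r - deriv (deriv w) t + k * deriv w t * x) \<le> ?E * (- ?c * x\<^sup>2)"
    using bound by (intro mult_left_mono) auto
  \<comment> \<open>The square of the expansion contains \<open>?E\<close> twice, and the derivative
    of \<tau> is the inverse of \<open>?E\<close>, which removes one of them.\<close>
  moreover have "?E * (- ?c * x\<^sup>2) =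
      - ?c * (eps_expansion A L \<psi> n \<epsilon> \<eta> I J t)\<^sup>2 * exp (2 * (\<epsilon> - 1) / real n * w t)"
  proof -
    have "2 * (\<epsilon> - 1) / real n * w t = - (k * w t)"
      by (simp add: k_def minus_divide_left[symmetric]) (simp add: algebra_simps diff_divide_distrib)
    moreover have "eps_expansion A L \<psi> n \<epsilon> \<eta> I J t = ?E * x"
      by (simp add: eps_expansion_def k_def x_def)
    ultimately show ?thesis by (simp add: exp_minus power2_eq_square field_simps)
  qed
  ultimately show ?thesis by (metis (no_types))
qed

end

theorem proposition5p8:
  fixes M :: "'p topology"
    and A :: "('p, 'm::finite) chart set"
    and L \<psi> :: "('p, 'm) tangent \<Rightarrow> real"
    and X :: "'p \<Rightarrow> ('p, 'm) tangent"
    and n :: nat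
    and N :: ereal
    and \<epsilon> c t0 s0 :: real
    and a b :: ereal
    and \<eta> :: "real \<Rightarrow> 'p"
    and J :: "real \<Rightarrow> ('p, 'm) tangent \<Rightarrow> ('p, 'm) tangent"
    and \<tau> \<theta>\<epsilon> :: "real \<Rightarrow> real"
  assumes "weighted_finsler_spacetime M A L X \<psi>"
    and "CARD('m) = n + 1"
    and "(N \<noteq> -\<infinity> \<and> N \<le> 0) \<or> ereal (real n) \<le> N"
    and "eps_admissible n N \<epsilon>"
    and "c = eps_const n N \<epsilon>"
    and "unit_timelike_geodesic M A L X a b \<eta>"
    and "\<forall>t\<in>einterval a b. weighted_ricci M A L X \<psi> n N (eps_velocity A \<psi> n \<epsilon> \<eta> t) \<ge> 0"
    and "lagrange_tensor_field A L \<eta> (einterval a b) J"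
    and "eps_proper_time A \<psi> n \<epsilon> \<eta> (einterval a b) \<tau>"
    and "t0 \<in> einterval a b"
    and "bij_betw (J t0) (normal_complement A L (velocity A \<eta> t0)) (normal_complement A L (velocity A \<eta> t0))"
    and "\<theta>\<epsilon> = eps_expansion A L \<psi> n \<epsilon> \<eta> (einterval a b) J"
    and "s0 = inv_into (einterval a b) \<tau> (\<tau> t0 - 1 / (c * \<theta>\<epsilon> t0)) - t0"
  shows "(\<theta>\<epsilon> t0 < 0 \<and> \<tau> t0 - 1 / (c * \<theta>\<epsilon> t0) \<in> \<tau> ` einterval a b \<longrightarrow>
            (\<exists>t\<in>{t0..t0 + s0}. endo_det A L (velocity A \<eta> t) (J t) = 0)) \<and>
         (\<theta>\<epsilon> t0 > 0 \<and> \<tau> t0 - 1 / (c * \<theta>\<epsilon> t0) \<in> \<tau> ` einterval a b \<longrightarrow>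
            (\<exists>t\<in>{t0 + s0..t0}. endo_det A L (velocity A \<eta> t) (J t) = 0))"
proof -
  have fs: "finsler_spacetime M A L X" using assms(1) unfolding weighted_finsler_spacetime_def by blast
  have sm: "smooth_manifold M A" "lorentz_finsler M A L" and dim2: "2 \<le> CARD('m)"
    using fs unfolding finsler_spacetime_def by blast+
  interpret weighted_unit_geodesic M A L X a b \<eta> \<psi>
    by unfold_locales (use sm assms(1,6) in auto)
  have n: "n > 0" using dim2 assms(2) by simp
  have c: "c > 0" unfolding assms(5) by (rule eps_const_pos[OF n assms(3,4)])
  let ?\<tau>' = "\<lambda>t. exp (2 * (\<epsilon> - 1) / real n * w t)"
  have \<tau>: "(\<tau> has_real_derivative ?\<tau>' t) (at t)" if "t \<in> I" for t
    using assms(9) that unfolding eps_proper_time_def by blast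
  have ric: "\<exists>y. (\<theta>\<epsilon> has_real_derivative y) (at t) \<and> y \<le> - c * (\<theta>\<epsilon> t)\<^sup>2 * ?\<tau>' t"
    if "t \<in> I" "endo_det A L (vel t) (J t) \<noteq> 0" for t
    unfolding assms(5,12)
    by (rule eps_expansion_riccati[OF assms(2) n assms(3,4,8) that assms(7)[rule_format, OF that(1)]])
  \<comment> \<open>Weak monotonicity is enough: its contrapositive orders \<open>t0\<close> and
    \<open>t1\<close> once their values under \<tau> are strictly ordered.\<close>
  have mono: "\<tau> s \<le> \<tau> t" if "s \<in> I" "t \<in> I" "s \<le> t" for s t
  proof (rule DERIV_nonneg_imp_nondecreasing[OF that(3)])
    fix u assume "s \<le> u" "u \<le> t"
    then have "u \<in> I" using einterval_between that by blast
    then show "\<exists>y. (\<tau> has_real_derivative y) (at u) \<and> 0 \<le> y"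
      using \<tau> by (intro exI[of _ "?\<tau>' u"]) auto
  qed
  define t1 where "t1 = t0 + s0"
  \<comment> \<open>Membership in the image of \<tau> is what makes \<open>inv_into\<close> return a
    genuine preimage, and hence makes \<open>t1\<close> a parameter of the curve.\<close>
  have t1: "t1 \<in> I" "\<tau> t1 = \<tau> t0 - 1 / (c * \<theta>\<epsilon> t0)" if "\<tau> t0 - 1 / (c * \<theta>\<epsilon> t0) \<in> \<tau> ` I"
    using inv_into_into[OF that] f_inv_into_f[OF that] by (simp_all add: t1_def assms(13))
  show ?thesis
    unfolding t1_def[symmetric]
  proof (intro conjI impI; elim conjE; rule ccontr)
    assume neg: "\<theta>\<epsilon> t0 < 0" and im: "\<tau> t0 - 1 / (c * \<theta>\<epsilon> t0) \<in> \<tau> ` I"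
      and "\<not> (\<exists>t\<in>{t0..t1}. endo_det A L (vel t) (J t) = 0)"
    then have det: "endo_det A L (vel t) (J t) \<noteq> 0" if "t \<in> {t0..t1}" for t using that by blast
    have "1 / (c * \<theta>\<epsilon> t0) < 0" using c neg by (simp add: mult_pos_neg)
    then have "\<tau> t0 < \<tau> t1" using t1(2)[OF im] by simp
    then have le: "t0 \<le> t1" using mono[OF t1(1)[OF im] assms(10)] by linarith
    have sub: "t \<in> I" if "t \<in> {t0..t1}" for t
      using einterval_between[OF assms(10) t1(1)[OF im]] that by simp
    \<comment> \<open>By the choice of \<open>t1\<close> the left side equals the right side
      exactly, so strictness is the contradiction.\<close>
    have "c * (\<tau> t1 - \<tau> t0) < - 1 / \<theta>\<epsilon> t0"
      by (rule riccati_blow_up(1)[OF le c, where \<tau>' = ?\<tau>']) (use ric \<tau> sub det neg in auto)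
    then show False using c neg by (simp add: t1(2)[OF im])
  next
    assume pos: "0 < \<theta>\<epsilon> t0" and im: "\<tau> t0 - 1 / (c * \<theta>\<epsilon> t0) \<in> \<tau> ` I"
      and "\<not> (\<exists>t\<in>{t1..t0}. endo_det A L (vel t) (J t) = 0)"
    then have det: "endo_det A L (vel t) (J t) \<noteq> 0" if "t \<in> {t1..t0}" for t using that by blast
    have "1 / (c * \<theta>\<epsilon> t0) > 0" using c pos by simp
    then have "\<tau> t1 < \<tau> t0" using t1(2)[OF im] by simp
    then have le: "t1 \<le> t0" using mono[OF assms(10) t1(1)[OF im]] by linarith
    have sub: "t \<in> I" if "t \<in> {t1..t0}" for t
      using einterval_between[OF t1(1)[OF im] assms(10)] that by simp
    have "c * (\<tau> t0 - \<tau> t1) < 1 / \<theta>\<epsilon> t0"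
      by (rule riccati_blow_up(2)[OF le c, where \<tau>' = ?\<tau>']) (use ric \<tau> sub det pos in auto)
    then show False using c pos by (simp add: t1(2)[OF im])
  qed
qed

end
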